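(* Let $p>5$ be prime and let $\mathcal M$ be a $2n$-valent type I regular balanced Cayley map on $\mathrm{PSL}(2,p)$. Then $2n\mid p-1$ or $2n\mid p+1$. Moreover: (i) If $2n\mid p-1$, then $\mathcal M\cong \mathcal{CM}_{\omega(\mathrm{i},a)}^{\alpha^{(p-1)u/2n}}$ for a unique pair $(a,u)$ with $a\in\mathbb F_p$, $a\notin\{\pm1,0\}$, $u$ an integer with $\gcd(u,2n)=1$ and $1\le u<n$, and moreover $2a^2\neq 1$ if $n=2$. (ii) If $2n\mid p+1$, then $\mathcal M\cong\mathcal{CM}_{\tilde\omega(\mathrm{i},a)}^{\gamma^{(p+1)v/2n}}$ for a unique pair $(a,v)$ with $a\in\mathbb F_p$, $a\notin\{\pm1,0\}$, $v$ an integer with $\gcd(v,2n)=1$ and $1\le v<n$.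
   Context: Cayley maps: for a finite group $\Gamma$ and a generating set $\Omega$ with $1\notin\Omega=\Omega^{-1}$, and a cyclic permutation $\rho$ of $\Omega$, $\mathcal{CM}(\Gamma,\Omega,\rho)$ is the cellular embedding of the Cayley graph $\mathrm{Cay}(\Gamma,\Omega)$ (vertices $\Gamma$, arcs $(\eta,\omega)$ from $\eta$ to $\eta\omega$) into a closed oriented surface determined by the cyclic order $(\eta,\omega)\mapsto(\eta,\rho(\omega))$ on arcs at each vertex. Isomorphisms are graph isomorphisms compatible with the cyclic orders. It is regular if its automorphism group is arc-transitive, balanced if $\rho(\omega^{-1})=\rho(\omega)^{-1}$ for all $\omega\in\Omega$; valency is $\#\Omega$. In a regular balanced Cayley map all elements of $\Omega$ have the same order; type I means they are not involutions (then $\#\Omega=2n$ and $\omega_{i+n}=\omega_i^{-1}$ where $\rho(\omega_i)=\omega_{i+1}$), type II means they are all involutions. Notation: for $\sigma\in\mathrm{PGL}(2,p)$ and $\omega\in\mathrm{PSL}(2,p)$ (with $\mathrm{PGL}(2,p)$ acting on $\mathrm{PSL}(2,p)$ by conjugation), $\mathcal{CM}_\omega^\sigma$ is $\mathcal{CM}(\mathrm{PSL}(2,p),\Omega,\rho)$ with $\Omega=\{\sigma^i\omega\sigma^{-i}\}_{i\ge1}$ and $\rho(\sigma^i\omega\sigma^{-i})=\sigma^{i+1}\omega\sigma^{-(i+1)}$. Fixed data: $e$ a generator of $\mathbb F_p^\times$; $\sqrt e\in\mathbb F_{p^2}$ a square root; $w_1+w_2\sqrt e$ a generator of $\mathbb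 F_{p^2}^\times$ and $w=w_1/w_2\in\mathbb F_p$. Matrices (in $\mathrm{PGL}(2,p)$ or $\mathrm{PSL}(2,p)$): $\alpha=\begin{pmatrix} e&0\\0&1\end{pmatrix}$, $\gamma=\begin{pmatrix} w&e\\1&w\end{pmatrix}$, $\omega(\mathrm{i},a)=\begin{pmatrix} a&1\\ a^2-1& a\end{pmatrix}$. For each $a\in\mathbb F_p$ choose and fix a solution $(x_{\mathrm{i},a},z_{\mathrm{i},a})\in\mathbb F_p^2$ of $(x-a)^2-ez^2=a^2-1$ (such solutions exist), and set $\tilde\omega(\mathrm{i},a)=\begin{pmatrix} x_{\mathrm{i},a} & -e z_{\mathrm{i},a}\\ z_{\mathrm{i},a} & 2a-x_{\mathrm{i},a}\end{pmatrix}$.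
   Formalization: Uniqueness of (a,u) and of (a,v) is false as stated, since a and −a give isomorphic maps (e.g. p=7, n=3, u=1, a=±2); the formal theorem says the admissible pairs are exactly (a,u) and (−a,u), respectively (a,v) and (−a,v), i.e. uniqueness up to the sign of a. *)

theory Defs
  imports
    "HOL-Analysis.Determinants"
    "HOL-Algebra.Generated_Groups"
    "HOL-Combinatorics.Orbits"
    "HOL-Computational_Algebra.Primes"
    "Graph_Theory.Digraph_Isomorphism"
begin

section \<open>Cayley maps\<close>

text \<open>
  A cellular embedding of a graph into a closed oriented surface is encoded by its rotation
  system: an edge is a pair of opposite arcs, and the rotation sends each arc to the next arc,
  in the cyclic order given by the orientation, with the same initial vertex.
\<close>

type_synonym ('v, 'a) embedded_graph = "('v, 'a) pre_digraph \<times> ('a \<Rightarrow> 'a)"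

text \<open>
  The arc \<open>(\<eta>, \<omega>)\<close> runs from \<open>\<eta>\<close> to \<open>\<eta>\<omega>\<close>; the opposite arc is \<open>(\<eta>\<omega>, \<omega>\<inverse>)\<close>.
\<close>

definition cayley_digraph :: "('g, 'm) monoid_scheme \<Rightarrow> 'g set \<Rightarrow> ('g, 'g \<times> 'g) pre_digraph" where
  "cayley_digraph G \<Omega> =
     \<lparr>verts = carrier G, arcs = carrier G \<times> \<Omega>,
      tail = (\<lambda>(\<eta>, \<omega>). \<eta>), head = (\<lambda>(\<eta>, \<omega>). \<eta> \<otimes>\<^bsub>G\<^esub> \<omega>)\<rparr>"

definition cayley_map ::
    "('g, 'm) monoid_scheme \<Rightarrow> 'g set \<Rightarrow> ('g \<Rightarrow> 'g) \<Rightarrow> ('g, 'g \<times> 'g) embedded_graph" where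
  "cayley_map G \<Omega> \<rho> = (cayley_digraph G \<Omega>, \<lambda>(\<eta>, \<omega>). (\<eta>, \<rho> \<omega>))"

text \<open>The data \<open>(\<Gamma>, \<Omega>, \<rho>)\<close> for which \<open>\<C>\<M>(\<Gamma>, \<Omega>, \<rho>)\<close> is defined.\<close>

definition cayley_map_data :: "('g, 'm) monoid_scheme \<Rightarrow> 'g set \<Rightarrow> ('g \<Rightarrow> 'g) \<Rightarrow> bool" where
  "cayley_map_data G \<Omega> \<rho> \<longleftrightarrow>
     group G \<and> finite (carrier G) \<and>
     \<Omega> \<subseteq> carrier G \<and> generate G \<Omega> = carrier G \<and>
     \<one>\<^bsub>G\<^esub> \<notin> \<Omega> \<and> m_inv G ` \<Omega> = \<Omega> \<and> cyclic_on \<rho> \<Omega>"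

text \<open>
  An isomorphism is a graph isomorphism that commutes with the rotations. Compatibility with
  reversal of arcs needs no separate clause for Cayley maps: an arc of a Cayley graph is
  determined by its two end vertices, so a digraph isomorphism maps opposite arcs to
  opposite arcs.
\<close>

definition map_isomorphism ::
    "('v, 'a) embedded_graph \<Rightarrow> ('w, 'b) embedded_graph \<Rightarrow>
     ('v, 'a, 'w, 'b) digraph_isomorphism \<Rightarrow> bool" where
  "map_isomorphism M N h \<longleftrightarrow>
     pre_digraph.digraph_isomorphism (fst M) h \<and> app_iso h (fst M) = fst N \<and>
     (\<forall>d \<in> arcs (fst M). iso_arcs h (snd M d) = snd N (iso_arcs h d))"

definition map_isomorphic ::
    "('v, 'a) embedded_graph \<Rightarrow> ('w, 'b) embedded_graph \<Rightarrow> bool"  (infix "\<cong>\<^sub>m" 50) where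
  "M \<cong>\<^sub>m N \<longleftrightarrow> (\<exists>h. map_isomorphism M N h)"

definition regular_map :: "('v, 'a) embedded_graph \<Rightarrow> bool" where
  "regular_map M \<longleftrightarrow>
     (\<forall>d \<in> arcs (fst M). \<forall>d' \<in> arcs (fst M). \<exists>h. map_isomorphism M M h \<and> iso_arcs h d = d')"

definition balanced :: "('g, 'm) monoid_scheme \<Rightarrow> 'g set \<Rightarrow> ('g \<Rightarrow> 'g) \<Rightarrow> bool" where
  "balanced G \<Omega> \<rho> \<longleftrightarrow> (\<forall>\<omega> \<in> \<Omega>. \<rho> (inv\<^bsub>G\<^esub> \<omega>) = inv\<^bsub>G\<^esub> (\<rho> \<omega>))"

text \<open>As \<open>\<one> \<notin> \<Omega>\<close>, an element of \<open>\<Omega>\<close> is an involution iff its square is \<open>\<one>\<close>.\<close>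

definition type_I :: "('g, 'm) monoid_scheme \<Rightarrow> 'g set \<Rightarrow> bool" where
  "type_I G \<Omega> \<longleftrightarrow> (\<forall>\<omega> \<in> \<Omega>. \<omega> \<otimes>\<^bsub>G\<^esub> \<omega> \<noteq> \<one>\<^bsub>G\<^esub>)"


section \<open>Projective linear groups\<close>

definition GL2 :: "('k::field ^ 2 ^ 2) monoid" where
  "GL2 = \<lparr>carrier = {A. det A \<noteq> 0}, mult = (**), one = mat 1\<rparr>"

definition SL2 :: "('k::field ^ 2 ^ 2) monoid" where
  "SL2 = \<lparr>carrier = {A. det A = 1}, mult = (**), one = mat 1\<rparr>"

definition PGL2 :: "('k::field ^ 2 ^ 2) set monoid" where
  "PGL2 = GL2 Mod {mat c | c. c \<noteq> 0}"

definition PSL2 :: "('k::field ^ 2 ^ 2) set monoid" where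
  "PSL2 = SL2 Mod {mat 1, mat (- 1)}"

definition matrix2 :: "'k::field \<Rightarrow> 'k \<Rightarrow> 'k \<Rightarrow> 'k \<Rightarrow> 'k ^ 2 ^ 2" where
  "matrix2 a b c d = vector [vector [a, b], vector [c, d]]"

definition pgl :: "'k::field ^ 2 ^ 2 \<Rightarrow> ('k ^ 2 ^ 2) set" where
  "pgl A = {mat c | c. c \<noteq> 0} #>\<^bsub>GL2\<^esub> A"

definition psl :: "'k::field ^ 2 ^ 2 \<Rightarrow> ('k ^ 2 ^ 2) set" where
  "psl A = {mat 1, mat (- 1)} #>\<^bsub>SL2\<^esub> A"

text \<open>
  The conjugation action of \<open>PGL2\<close> on \<open>PSL2\<close>: the class of \<open>B\<close> sends the class \<open>{A, -A}\<close> to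
  \<open>{BAB\<inverse>, -BAB\<inverse>}\<close>, which does not depend on the choice of \<open>B\<close>.
\<close>

definition conj_action ::
    "('k::field ^ 2 ^ 2) set \<Rightarrow> ('k ^ 2 ^ 2) set \<Rightarrow> ('k ^ 2 ^ 2) set" where
  "conj_action \<sigma> \<omega> = {B ** A ** matrix_inv B | A B. A \<in> \<omega> \<and> B \<in> \<sigma>}"

text \<open>
  The map \<open>\<C>\<M>\<close> with lower index \<open>\<omega>\<close> and upper index \<open>\<sigma>\<close> is given by the connection set
  \<open>orbit_set \<sigma> \<omega>\<close> and the rotation \<open>conj_action \<sigma>\<close>, which sends
  \<open>\<sigma>\<^sup>i \<omega> \<sigma>\<^sup>-\<^sup>i\<close> to its conjugate by one more factor \<open>\<sigma>\<close>.
\<close>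

definition orbit_set ::
    "('k::field ^ 2 ^ 2) set \<Rightarrow> ('k ^ 2 ^ 2) set \<Rightarrow> ('k ^ 2 ^ 2) set set" where
  "orbit_set \<sigma> \<omega> = {conj_action (\<sigma> [^]\<^bsub>PGL2\<^esub> i) \<omega> | i::nat. i \<ge> 1}"

definition CM ::
    "('k::field ^ 2 ^ 2) set \<Rightarrow> ('k ^ 2 ^ 2) set \<Rightarrow>
     (('k ^ 2 ^ 2) set, ('k ^ 2 ^ 2) set \<times> ('k ^ 2 ^ 2) set) embedded_graph" where
  "CM \<sigma> \<omega> = cayley_map PSL2 (orbit_set \<sigma> \<omega>) (conj_action \<sigma>)"

definition CM_data :: "('k::field ^ 2 ^ 2) set \<Rightarrow> ('k ^ 2 ^ 2) set \<Rightarrow> bool" where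
  "CM_data \<sigma> \<omega> \<longleftrightarrow> cayley_map_data PSL2 (orbit_set \<sigma> \<omega>) (conj_action \<sigma>)"


section \<open>The matrices of the classification\<close>

text \<open>For a finite field: \<open>g\<close> generates the multiplicative group.\<close>

definition generates_units :: "'k::field \<Rightarrow> bool" where
  "generates_units g \<longleftrightarrow> range (\<lambda>i::nat. g ^ i) = UNIV - {0}"

definition field_embedding :: "('k::field \<Rightarrow> 'l::field) \<Rightarrow> bool" where
  "field_embedding \<iota> \<longleftrightarrow>
     \<iota> 1 = 1 \<and> (\<forall>x y. \<iota> (x + y) = \<iota> x + \<iota> y) \<and> (\<forall>x y. \<iota> (x * y) = \<iota> x * \<iota> y)"

definition alpha_pgl :: "'k::field \<Rightarrow> ('k ^ 2 ^ 2) set" where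
  "alpha_pgl e = pgl (matrix2 e 0 0 1)"

definition gamma_pgl :: "'k::field \<Rightarrow> 'k \<Rightarrow> ('k ^ 2 ^ 2) set" where
  "gamma_pgl e w = pgl (matrix2 w e 1 w)"

text \<open>
  The parameter \<open>a\<close> is half the trace of a matrix representing an element of \<open>PSL2\<close>, hence is
  determined by that element only up to sign. In fact \<open>omega_i (- a)\<close> is the inverse of
  \<open>omega_i a\<close>. Let \<open>u\<close> be odd, and let \<open>\<sigma>\<close> be \<open>alpha_pgl e\<close> to the power \<open>(p - 1)u/2n\<close>. Then
  \<open>\<sigma>\<^sup>n\<close> is the class of \<open>diag(-1, 1)\<close> and conjugates \<open>omega_i a\<close> to its inverse, so
  \<open>CM \<sigma> (omega_i (- a)) = CM \<sigma> (omega_i a)\<close>. Likewise \<open>a\<close> and \<open>- a\<close> give isomorphic maps for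
  \<open>omega_tilde_i\<close>. A uniqueness statement about \<open>a\<close> can therefore only hold with \<open>a\<close> and
  \<open>- a\<close> identified.
\<close>

definition omega_i :: "'k::field \<Rightarrow> ('k ^ 2 ^ 2) set" where
  "omega_i a = psl (matrix2 a 1 (a\<^sup>2 - 1) a)"

text \<open>
  \<open>x\<close> and \<open>z\<close> are the chosen solutions of \<open>(x - a)\<^sup>2 - ez\<^sup>2 = a\<^sup>2 - 1\<close>, as functions of \<open>a\<close>.
\<close>

definition omega_tilde_i ::
    "'k::field \<Rightarrow> ('k \<Rightarrow> 'k) \<Rightarrow> ('k \<Rightarrow> 'k) \<Rightarrow> 'k \<Rightarrow> ('k ^ 2 ^ 2) set" where
  "omega_tilde_i e x z a = psl (matrix2 (x a) (- e * z a) (z a) (2 * a - x a))"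

end

theory Submission
  imports Defs "HOL-Algebra.Multiplicative_Group" "HOL-Number_Theory.Residues"
begin

text \<open>
  An isomorphism of balanced maps of type I that fixes the identity vertex is a group
  isomorphism carrying one rotation to the other, because inversion is the \<open>n\<close>-th power of the
  rotation on both sides. Together with \<open>Aut PSL(2, p) = PGL(2, p)\<close> this reduces the problem to
  pairs \<open>(\<sigma>, \<omega>)\<close> up to conjugacy in \<open>PGL(2, p)\<close>, where \<open>\<sigma>\<close> has order \<open>2n\<close>, \<open>\<sigma>\<^sup>n\<close> inverts
  \<open>\<omega>\<close>, and the conjugates of \<open>\<omega>\<close> under \<open>\<sigma>\<close> generate. As \<open>2n\<close> is even, \<open>\<sigma>\<close> is not unipotent,
  so it lies in a torus of order \<open>p - 1\<close> or \<open>p + 1\<close>, where it is determined by \<open>u\<close> up to the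
  inversion of the torus. The torus acts transitively on the elements of given trace \<open>2a\<close> that
  are inverted by its involution \<open>\<sigma>\<^sup>n\<close>; the trace is determined up to sign.
\<close>

section \<open>Two by two matrices\<close>

text \<open>Bringing \<open>\<sigma>\<close> into normal form uses up the inversion of the torus;
  what is left for normalising \<open>\<omega>\<close> is the centraliser of the torus, so the
  conjugators acting on \<open>\<omega>\<close> are required to commute with its generator. The side
  conditions have separate origins. Trace 0 is excluded by type I, since such a matrix of
  determinant 1 squares to -1. In the split torus \<open>a\<^sup>2 = 1\<close> would make the whole
  connection set triangular; in the non-split torus it would make \<open>\<omega>\<close> trivial,
  because the norm form of the quadratic extension is anisotropic. The interval
  \<open>1 \<le> u < n\<close> is a fundamental domain for inversion on the exponents, its missing
  end point \<open>n\<close> being excluded by coprimality once \<open>n \<ge> 2\<close>. The value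
  \<open>n = 1\<close> cannot occur, since then the connection set would generate a cyclic group;
  \<open>n \<ge> 2\<close> also keeps the two cases disjoint, as p - 1 and p + 1 differ by 2. In the
  non-split torus direct matrix powers are unwieldy. It is treated as the units of the field of
  order p^2 modulo those of the prime field, where powers are field powers and transitivity on
  elements of given trace is an instance of Hilbert 90.\<close>

lemma matrix2_nth [simp]:
  "matrix2 a b c d $ 1 $ 1 = a" "matrix2 a b c d $ 1 $ 2 = b"
  "matrix2 a b c d $ 2 $ 1 = c" "matrix2 a b c d $ 2 $ 2 = d"
  by (simp_all add: matrix2_def)

lemma matrix2_cases: obtains a b c d where "A = matrix2 a b c d"
proof
  show "A = matrix2 (A$1$1) (A$1$2) (A$2$1) (A$2$2)"
    by (simp add: vec_eq_iff forall_2)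
qed

lemma matrix2_eq_iff [simp]:
  "matrix2 a b c d = matrix2 a' b' c' d' \<longleftrightarrow> a = a' \<and> b = b' \<and> c = c' \<and> d = d'"
  by (metis matrix2_nth)

lemma matrix2_mult [simp]:
  "matrix2 a b c d ** matrix2 a' b' c' d' =
     matrix2 (a * a' + b * c') (a * b' + b * d') (c * a' + d * c') (c * b' + d * d')"
  by (simp add: vec_eq_iff forall_2 matrix_matrix_mult_def sum_2)

lemma det_matrix2 [simp]: "det (matrix2 a b c d) = a * d - b * c"
  by (simp add: det_2)

lemma trace_matrix2 [simp]: "trace (matrix2 a b c d) = a + d"
  by (simp add: trace_def sum_2)

lemma mat_eq_matrix2: "(mat c :: 'k::field^2^2) = matrix2 c 0 0 c"
  by (simp add: vec_eq_iff forall_2 mat_def)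

lemma uminus_matrix2 [simp]: "- matrix2 a b c d = matrix2 (-a) (-b) (-c) (-d)"
  by (simp add: vec_eq_iff forall_2)

lemma mat_mult_matrix2 [simp]: "mat r ** matrix2 a b c d = matrix2 (r*a) (r*b) (r*c) (r*d)"
  by (simp add: mat_eq_matrix2)

lemma mat_minus_one_mult:
  fixes A :: "'k::field^2^2" shows "mat (- 1) ** A = - A"
  by (cases A rule: matrix2_cases) simp

lemma mat_mult_commute:
  fixes A :: "'k::field^2^2" shows "mat c ** A = A ** mat c"
  by (cases A rule: matrix2_cases) (simp add: mat_eq_matrix2 mult.commute)

lemma det_mat [simp]: "det (mat c :: 'k::field^2^2) = c\<^sup>2"
  by (simp add: mat_eq_matrix2 power2_eq_square)

lemma det_uminus [simp]:
  fixes A :: "'k::field^2^2" shows "det (- A) = det A"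
  by (cases A rule: matrix2_cases) simp

lemma trace_uminus [simp]:
  fixes A :: "'k::field^2^2" shows "trace (- A) = - trace A"
  by (cases A rule: matrix2_cases) simp

lemma matrix_uminus_mult [simp]:
  fixes A B :: "'k::field^2^2"
  shows "(- A) ** B = - (A ** B)" "A ** (- B) = - (A ** B)"
  by (cases A rule: matrix2_cases, cases B rule: matrix2_cases, simp)+

lemma ex_inverse:
  fixes A :: "'k::field^2^2"
  assumes "det A \<noteq> 0"
  shows "\<exists>B. A ** B = mat 1 \<and> B ** A = mat 1"
proof (cases A rule: matrix2_cases)
  case (1 a b c d)
  let ?D = "a * d - b * c"
  define i where "i = 1 / ?D"
  let ?B = "matrix2 (d * i) (- b * i) (- c * i) (a * i)"
  have "?D * i = 1" using assms 1 by (simp add: i_def)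
  then have "A ** ?B = mat 1 \<and> ?B ** A = mat 1"
    unfolding 1 mat_eq_matrix2 by (simp add: algebra_simps)
  then show ?thesis by blast
qed

lemma matrix_inv2:
  fixes A :: "'k::field^2^2"
  assumes "det A \<noteq> 0"
  shows "A ** matrix_inv A = mat 1" "matrix_inv A ** A = mat 1"
  using someI_ex[OF ex_inverse[OF assms]] unfolding matrix_inv_def by auto

lemma det_matrix_inv:
  fixes A :: "'k::field^2^2"
  assumes "det A \<noteq> 0"
  shows "det A * det (matrix_inv A) = 1"
  by (metis matrix_inv2(1)[OF assms] det_mul det_I)

text \<open>Conjugations are checked in this intertwining form throughout: it is a polynomial
  identity in the entries and involves no inverse.\<close>

lemma matrix_inv_eqI:
  fixes A B C :: "'k::field^2^2"
  assumes "det B \<noteq> 0" "B ** A = C ** B"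
  shows "B ** A ** matrix_inv B = C"
  by (simp only: assms(2) matrix_inv2(1)[OF assms(1)] matrix_mul_rid flip: matrix_mul_assoc)


section \<open>The groups PGL(2) and PSL(2)\<close>

lemma group_GL2: "group GL2"
proof (rule groupI)
  fix A :: "'k::field^2^2" assume "A \<in> carrier GL2"
  then have A: "det A \<noteq> 0" by (simp add: GL2_def)
  then have "det (matrix_inv A) \<noteq> 0" using det_matrix_inv by fastforce
  then show "\<exists>B\<in>carrier GL2. B \<otimes>\<^bsub>GL2\<^esub> A = \<one>\<^bsub>GL2\<^esub>"
    using matrix_inv2[OF A] by (auto simp: GL2_def)
qed (auto simp: GL2_def det_mul matrix_mul_assoc)

lemma group_SL2: "group SL2"
proof (rule groupI)
  fix A :: "'k::field^2^2" assume "A \<in> carrier SL2"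
  then have A: "det A = 1" by (simp add: SL2_def)
  then have "det (matrix_inv A) = 1" using det_matrix_inv[of A] by simp
  then show "\<exists>B\<in>carrier SL2. B \<otimes>\<^bsub>SL2\<^esub> A = \<one>\<^bsub>SL2\<^esub>"
    using matrix_inv2[of A] A by (auto simp: SL2_def)
qed (auto simp: SL2_def det_mul matrix_mul_assoc)

lemma central_normal:
  assumes "group G" "subgroup H G" "\<And>h x. h \<in> H \<Longrightarrow> x \<in> carrier G \<Longrightarrow> h \<otimes>\<^bsub>G\<^esub> x = x \<otimes>\<^bsub>G\<^esub> h"
  shows "H \<lhd> G"
proof -
  interpret group G by fact
  interpret subgroup H G by fact
  show ?thesis
    by (rule normalI[OF assms(2)]) (auto simp: r_coset_def l_coset_def assms(3))
qed

lemma normal_scalars_GL2: "{mat c | c. c \<noteq> 0} \<lhd> (GL2 :: ('k::field^2^2) monoid)"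
proof (rule central_normal[OF group_GL2])
  interpret group "GL2 :: ('k::field^2^2) monoid" by (rule group_GL2)
  have mm: "mat c ** mat d = (mat (c * d) :: 'k^2^2)" for c d
    by (simp add: mat_eq_matrix2)
  have iv: "inv\<^bsub>GL2\<^esub> (mat c :: 'k^2^2) = mat (1 / c)" if "c \<noteq> 0" for c
    using that by (intro inv_equality) (auto simp: GL2_def mm)
  show "subgroup {mat c | c. c \<noteq> 0} (GL2 :: ('k::field^2^2) monoid)"
  proof (rule subgroupI)
    show "inv\<^bsub>GL2\<^esub> A \<in> {mat c | c. c \<noteq> 0}" if A: "A \<in> {mat c | c. c \<noteq> 0}" for A :: "'k^2^2"
    proof -
      obtain c where c: "A = mat c" "c \<noteq> 0" using A by blast
      then have "inv\<^bsub>GL2\<^esub> A = mat (1 / c)" by (simp add: iv)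
      moreover have "1 / c \<noteq> 0" using c by simp
      ultimately show ?thesis by blast
    qed
    show "A \<otimes>\<^bsub>GL2\<^esub> B \<in> {mat c | c. c \<noteq> 0}"
      if AB: "A \<in> {mat c | c. c \<noteq> 0}" "B \<in> {mat c | c. c \<noteq> 0}" for A B :: "'k^2^2"
    proof -
      obtain c d where "A = mat c" "c \<noteq> 0" "B = mat d" "d \<noteq> 0" using AB by blast
      then have "A \<otimes>\<^bsub>GL2\<^esub> B = mat (c * d)" "c * d \<noteq> 0" by (auto simp: GL2_def mm)
      then show ?thesis by blast
    qed
    have "mat 1 \<in> {mat c :: 'k^2^2 | c. c \<noteq> 0}" by (intro CollectI exI[of _ 1]) simp
    then show "{mat c :: 'k^2^2 | c. c \<noteq> 0} \<noteq> {}" by (metis empty_iff)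
  qed (auto simp: GL2_def)
qed (auto simp: GL2_def mat_mult_commute)

lemma normal_signs_SL2: "{mat 1, mat (- 1)} \<lhd> (SL2 :: ('k::field^2^2) monoid)"
proof (rule central_normal[OF group_SL2])
  interpret group "SL2 :: ('k::field^2^2) monoid" by (rule group_SL2)
  have iv: "inv\<^bsub>SL2\<^esub> (mat (-1) :: 'k^2^2) = mat (- 1)" "inv\<^bsub>SL2\<^esub> (mat 1 :: 'k^2^2) = mat 1"
    by (rule inv_equality; simp add: SL2_def mat_eq_matrix2)+
  show "subgroup {mat 1, mat (- 1)} (SL2 :: ('k::field^2^2) monoid)"
  proof (rule subgroupI)
    show "inv\<^bsub>SL2\<^esub> A \<in> {mat 1, mat (- 1)}" if "A \<in> {mat 1, mat (- 1)}" for A :: "'k^2^2"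
      using that iv by auto
  qed (auto simp: SL2_def mat_eq_matrix2)
qed (auto simp: SL2_def mat_mult_commute)

interpretation PGL2: group "PGL2 :: ('k::field^2^2) set monoid"
  unfolding PGL2_def by (rule normal.factorgroup_is_group[OF normal_scalars_GL2])

interpretation PSL2: group "PSL2 :: ('k::field^2^2) set monoid"
  unfolding PSL2_def by (rule normal.factorgroup_is_group[OF normal_signs_SL2])

lemma carrier_PGL2: "carrier PGL2 = pgl ` {A. det A \<noteq> 0}"
  by (auto simp: PGL2_def carrier_FactGroup pgl_def GL2_def)

lemma carrier_PSL2: "carrier PSL2 = psl ` {A. det A = 1}"
  by (auto simp: PSL2_def carrier_FactGroup psl_def SL2_def)

lemma pgl_eq: "pgl A = {mat c ** A | c. c \<noteq> 0}"
  by (auto simp: pgl_def r_coset_def GL2_def)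

lemma psl_eq: "psl A = {A, - A}"
  by (auto simp: psl_def r_coset_def SL2_def mat_minus_one_mult)

lemma psl_uminus [simp]: "psl (- A) = psl A"
  by (auto simp: psl_eq)

lemma psl_eq_iff: "psl A = psl B \<longleftrightarrow> A = B \<or> A = - B"
  by (auto simp: psl_eq doubleton_eq_iff)

lemma mem_pgl: "B \<in> pgl A \<longleftrightarrow> (\<exists>c. c \<noteq> 0 \<and> B = mat c ** A)"
  by (auto simp: pgl_eq)

lemma self_in_pgl: "A \<in> pgl A"
  unfolding mem_pgl by (rule exI[of _ 1]) simp

lemma pgl_mat_mult:
  assumes "c \<noteq> 0" shows "pgl (mat c ** A) = pgl A"
proof -
  have mm: "mat r ** (mat s ** A) = mat (r * s) ** A" for r s
    by (cases A rule: matrix2_cases) simp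
  show ?thesis
  proof (intro subset_antisym subsetI)
    fix B assume "B \<in> pgl (mat c ** A)"
    then obtain r where "r \<noteq> 0" "B = mat (r * c) ** A" by (auto simp: mem_pgl mm)
    then show "B \<in> pgl A" using assms unfolding mem_pgl by (intro exI[of _ "r * c"]) simp
  next
    fix B assume "B \<in> pgl A"
    then obtain r where "r \<noteq> 0" "B = mat r ** A" by (auto simp: mem_pgl)
    then show "B \<in> pgl (mat c ** A)" using assms unfolding mem_pgl mm by (intro exI[of _ "r / c"]) simp
  qed
qed

lemma pgl_eq_iff: "pgl A = pgl B \<longleftrightarrow> (\<exists>c. c \<noteq> 0 \<and> A = mat c ** B)"
  using self_in_pgl[of A] pgl_mat_mult mem_pgl by metis

lemma pgl_closed [simp]: "det A \<noteq> 0 \<Longrightarrow> pgl A \<in> carrier PGL2"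
  by (auto simp: carrier_PGL2)

lemma psl_closed [simp]: "det A = 1 \<Longrightarrow> psl A \<in> carrier PSL2"
  by (auto simp: carrier_PSL2)

lemma pgl_cases:
  assumes "\<sigma> \<in> carrier PGL2" obtains B where "\<sigma> = pgl B" "det B \<noteq> 0"
  using assms by (auto simp: carrier_PGL2)

lemma psl_cases:
  assumes "\<omega> \<in> carrier PSL2" obtains A where "\<omega> = psl A" "det A = 1"
  using assms by (auto simp: carrier_PSL2)

lemma pgl_mult: "det A \<noteq> 0 \<Longrightarrow> det B \<noteq> 0 \<Longrightarrow> pgl A \<otimes>\<^bsub>PGL2\<^esub> pgl B = pgl (A ** B)"
  using normal.rcos_sum[OF normal_scalars_GL2, of A B] by (simp add: PGL2_def pgl_def GL2_def)

lemma psl_mult: "det A = 1 \<Longrightarrow> det B = 1 \<Longrightarrow> psl A \<otimes>\<^bsub>PSL2\<^esub> psl B = psl (A ** B)"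
  using normal.rcos_sum[OF normal_signs_SL2, of A B] by (simp add: PSL2_def psl_def SL2_def)

lemma one_PGL2: "\<one>\<^bsub>PGL2\<^esub> = pgl (mat 1)"
  by (auto simp: PGL2_def pgl_eq)

lemma one_PSL2: "\<one>\<^bsub>PSL2\<^esub> = psl (mat 1)"
  by (auto simp: PSL2_def psl_eq mat_eq_matrix2)

lemma inv_psl: "a * d - b * c = 1 \<Longrightarrow> inv\<^bsub>PSL2\<^esub> psl (matrix2 a b c d) = psl (matrix2 d (- b) (- c) a)"
  by (intro PSL2.inv_equality) (auto simp: psl_mult one_PSL2 mat_eq_matrix2 algebra_simps)


section \<open>The conjugation action\<close>

lemma conj_action_psl:
  assumes "det B \<noteq> 0"
  shows "conj_action (pgl B) (psl A) = psl (B ** A ** matrix_inv B)"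
proof -
  \<comment> \<open>Another representative of \<open>pgl B\<close> differs by a scalar, which is
    central and cancels in the conjugate.\<close>
  have *: "B' ** A' ** matrix_inv B' = B ** A' ** matrix_inv B" if "B' \<in> pgl B" for A' B'
  proof (rule matrix_inv_eqI)
    obtain c where c: "c \<noteq> 0" "B' = mat c ** B" using \<open>B' \<in> pgl B\<close> by (auto simp: pgl_eq)
    then show "det B' \<noteq> 0" using assms by (simp add: det_mul)
    have "B ** A' = B ** A' ** matrix_inv B ** B"
      by (simp only: matrix_inv2(2)[OF assms] matrix_mul_rid flip: matrix_mul_assoc)
    then have "B' ** A' = mat c ** (B ** A' ** matrix_inv B ** B)"
      unfolding c by (simp only: matrix_mul_assoc)
    also have "\<dots> = B ** A' ** matrix_inv B ** B'"
      unfolding c by (simp only: mat_mult_commute[of c] flip: matrix_mul_assoc)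
    finally show "B' ** A' = B ** A' ** matrix_inv B ** B'" .
  qed
  have "conj_action (pgl B) (psl A) = (\<lambda>A'. B ** A' ** matrix_inv B) ` psl A"
  proof (intro subset_antisym subsetI)
    fix C assume "C \<in> conj_action (pgl B) (psl A)"
    then obtain A' B' where "C = B' ** A' ** matrix_inv B'" "A' \<in> psl A" "B' \<in> pgl B"
      unfolding conj_action_def by blast
    then show "C \<in> (\<lambda>A'. B ** A' ** matrix_inv B) ` psl A" using *[of B' A'] by blast
  next
    fix C assume "C \<in> (\<lambda>A'. B ** A' ** matrix_inv B) ` psl A"
    then obtain A' where "C = B ** A' ** matrix_inv B" "A' \<in> psl A" by blast
    then show "C \<in> conj_action (pgl B) (psl A)"
      unfolding conj_action_def using self_in_pgl[of B] by blast
  qed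
  then show ?thesis by (simp add: psl_eq)
qed

lemma conj_action_psl_eqI:
  assumes "det B \<noteq> 0" "B ** A = A' ** B"
  shows "conj_action (pgl B) (psl A) = psl A'"
  by (simp only: conj_action_psl[OF assms(1)] matrix_inv_eqI[OF assms])

lemma conj_action_psl_ex:
  assumes "det B \<noteq> 0"
  obtains A' where "B ** A = A' ** B" "det A' = det A" "trace A' = trace A"
    "conj_action (pgl B) (psl A) = psl A'"
proof
  let ?A = "B ** A ** matrix_inv B"
  show eq: "B ** A = ?A ** B"
    by (simp only: matrix_inv2(2)[OF assms] matrix_mul_rid flip: matrix_mul_assoc)
  show "det ?A = det A" using det_matrix_inv[OF assms] by (simp add: det_mul)
  show "trace ?A = trace A"
    unfolding trace_mul_sym[of "B ** A"] matrix_mul_assoc matrix_inv2(2)[OF assms] matrix_mul_lid ..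
  show "conj_action (pgl B) (psl A) = psl ?A" by (rule conj_action_psl[OF assms])
qed

lemma conj_action_closed [simp]:
  assumes "\<sigma> \<in> carrier PGL2" "\<omega> \<in> carrier PSL2"
  shows "conj_action \<sigma> \<omega> \<in> carrier PSL2"
proof -
  obtain B where B: "\<sigma> = pgl B" "det B \<noteq> 0" using assms(1) by (rule pgl_cases)
  obtain A where A: "\<omega> = psl A" "det A = 1" using assms(2) by (rule psl_cases)
  show ?thesis using conj_action_psl_ex[OF B(2), of A] A B by (metis psl_closed)
qed

lemma conj_action_mult:
  assumes "\<sigma> \<in> carrier PGL2" "\<omega> \<in> carrier PSL2" "\<omega>' \<in> carrier PSL2"
  shows "conj_action \<sigma> (\<omega> \<otimes>\<^bsub>PSL2\<^esub> \<omega>') = conj_action \<sigma> \<omega> \<otimes>\<^bsub>PSL2\<^esub> conj_action \<sigma> \<omega>'"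
proof -
  obtain B where B: "\<sigma> = pgl B" "det B \<noteq> 0" using assms(1) by (rule pgl_cases)
  obtain A where A: "\<omega> = psl A" "det A = 1" using assms(2) by (rule psl_cases)
  obtain A' where A': "\<omega>' = psl A'" "det A' = 1" using assms(3) by (rule psl_cases)
  obtain C where C: "B ** A = C ** B" "det C = det A" "conj_action \<sigma> \<omega> = psl C"
    using conj_action_psl_ex[OF B(2), of A] A B by metis
  obtain C' where C': "B ** A' = C' ** B" "det C' = det A'" "conj_action \<sigma> \<omega>' = psl C'"
    using conj_action_psl_ex[OF B(2), of A'] A' B by metis
  have "B ** (A ** A') = C ** B ** A'"
    by (simp only: C(1) matrix_mul_assoc)
  also have "\<dots> = C ** C' ** B"
    by (simp only: C'(1) flip: matrix_mul_assoc)
  finally have "B ** (A ** A') = C ** C' ** B" .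
  then have "conj_action \<sigma> (psl (A ** A')) = psl (C ** C')"
    unfolding B using B(2) by (intro conj_action_psl_eqI)
  moreover have "\<omega> \<otimes>\<^bsub>PSL2\<^esub> \<omega>' = psl (A ** A')"
    unfolding A(1) A'(1) by (rule psl_mult[OF A(2) A'(2)])
  moreover have "psl C \<otimes>\<^bsub>PSL2\<^esub> psl C' = psl (C ** C')"
    using A(2) A'(2) C(2) C'(2) by (intro psl_mult) simp_all
  ultimately show ?thesis by (simp only: C(3) C'(3))
qed

lemma conj_action_comp:
  assumes "\<sigma> \<in> carrier PGL2" "\<tau> \<in> carrier PGL2" "\<omega> \<in> carrier PSL2"
  shows "conj_action (\<sigma> \<otimes>\<^bsub>PGL2\<^esub> \<tau>) \<omega> = conj_action \<sigma> (conj_action \<tau> \<omega>)"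
proof -
  obtain B where B: "\<sigma> = pgl B" "det B \<noteq> 0" using assms(1) by (rule pgl_cases)
  obtain B' where B': "\<tau> = pgl B'" "det B' \<noteq> 0" using assms(2) by (rule pgl_cases)
  obtain A where A: "\<omega> = psl A" "det A = 1" using assms(3) by (rule psl_cases)
  obtain C where C: "B' ** A = C ** B'" "conj_action \<tau> \<omega> = psl C"
    using conj_action_psl_ex[OF B'(2), of A] A B' by metis
  obtain C' where C': "B ** C = C' ** B" "conj_action \<sigma> (psl C) = psl C'"
    using conj_action_psl_ex[OF B(2), of C] B by metis
  have "(B ** B') ** A = B ** C ** B'"
    by (simp only: C(1) flip: matrix_mul_assoc)
  also have "\<dots> = C' ** (B ** B')"
    by (simp only: C'(1) matrix_mul_assoc)
  finally have "(B ** B') ** A = C' ** (B ** B')" .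
  then have "conj_action (pgl (B ** B')) (psl A) = psl C'"
    using B(2) B'(2) by (intro conj_action_psl_eqI) (auto simp: det_mul)
  moreover have "\<sigma> \<otimes>\<^bsub>PGL2\<^esub> \<tau> = pgl (B ** B')"
    unfolding B(1) B'(1) by (rule pgl_mult[OF B(2) B'(2)])
  ultimately show ?thesis by (simp only: C(2) C'(2)) (simp only: A(1))
qed

lemma conj_action_one [simp]:
  assumes "\<omega> \<in> carrier PSL2" shows "conj_action \<one>\<^bsub>PGL2\<^esub> \<omega> = \<omega>"
proof (rule psl_cases[OF assms])
  fix A assume A: "\<omega> = psl A"
  have "conj_action (pgl (mat 1)) (psl A) = psl A"
    by (rule conj_action_psl_eqI) (simp_all only: det_I matrix_mul_lid matrix_mul_rid one_neq_zero not_False_eq_True)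
  then show ?thesis by (simp only: A one_PGL2)
qed

lemma conj_action_inv:
  assumes "\<sigma> \<in> carrier PGL2" "\<omega> \<in> carrier PSL2"
  shows "conj_action (inv\<^bsub>PGL2\<^esub> \<sigma>) (conj_action \<sigma> \<omega>) = \<omega>"
    "conj_action \<sigma> (conj_action (inv\<^bsub>PGL2\<^esub> \<sigma>) \<omega>) = \<omega>"
proof -
  have i: "inv\<^bsub>PGL2\<^esub> \<sigma> \<in> carrier PGL2" by (rule PGL2.inv_closed[OF assms(1)])
  show "conj_action (inv\<^bsub>PGL2\<^esub> \<sigma>) (conj_action \<sigma> \<omega>) = \<omega>"
    unfolding conj_action_comp[OF i assms, symmetric] PGL2.l_inv[OF assms(1)]
    by (rule conj_action_one[OF assms(2)])
  show "conj_action \<sigma> (conj_action (inv\<^bsub>PGL2\<^esub> \<sigma>) \<omega>) = \<omega>"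
    unfolding conj_action_comp[OF assms(1) i assms(2), symmetric] PGL2.r_inv[OF assms(1)]
    by (rule conj_action_one[OF assms(2)])
qed

lemma conj_action_pow_Suc:
  assumes "\<sigma> \<in> carrier PGL2" "\<omega> \<in> carrier PSL2"
  shows "conj_action (\<sigma> [^]\<^bsub>PGL2\<^esub> Suc k) \<omega> = conj_action \<sigma> (conj_action (\<sigma> [^]\<^bsub>PGL2\<^esub> k) \<omega>)"
  unfolding PGL2.nat_pow_Suc2[OF assms(1)] using assms by (simp add: conj_action_comp)

lemma conj_action_funpow:
  assumes "\<sigma> \<in> carrier PGL2" "\<omega> \<in> carrier PSL2"
  shows "(conj_action \<sigma> ^^ k) \<omega> = conj_action (\<sigma> [^]\<^bsub>PGL2\<^esub> k) \<omega>"
proof (induction k)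
  case (Suc k)
  then show ?case unfolding conj_action_pow_Suc[OF assms] by simp
qed (use assms in simp)

lemma conj_action_iso:
  assumes "\<sigma> \<in> carrier PGL2" shows "conj_action \<sigma> \<in> iso PSL2 PSL2"
proof (rule isoI)
  show "conj_action \<sigma> \<in> hom PSL2 PSL2"
    using assms by (auto simp: hom_def conj_action_mult)
  show "bij_betw (conj_action \<sigma>) (carrier PSL2) (carrier PSL2)"
    by (rule bij_betw_byWitness[where f' = "conj_action (inv\<^bsub>PGL2\<^esub> \<sigma>)"])
      (use assms in \<open>auto simp: conj_action_inv\<close>)
qed

lemma conj_action_m_inv:
  assumes "\<sigma> \<in> carrier PGL2" "\<omega> \<in> carrier PSL2"
  shows "conj_action \<sigma> (inv\<^bsub>PSL2\<^esub> \<omega>) = inv\<^bsub>PSL2\<^esub> (conj_action \<sigma> \<omega>)"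
proof -
  interpret group_hom PSL2 PSL2 "conj_action \<sigma>"
    using conj_action_iso[OF assms(1)]
    by unfold_locales (auto simp: iso_def)
  show ?thesis using assms(2) by (rule hom_inv)
qed

text \<open>The trace is squared because a class in \<open>PSL2\<close> determines its matrix only
  up to sign.\<close>

lemma conj_action_trace:
  assumes "\<sigma> \<in> carrier PGL2" "conj_action \<sigma> (psl A) = psl A'"
  shows "(trace A')\<^sup>2 = (trace A)\<^sup>2"
proof -
  obtain B where B: "\<sigma> = pgl B" "det B \<noteq> 0" using assms(1) by (rule pgl_cases)
  obtain C where C: "trace C = trace A" "conj_action \<sigma> (psl A) = psl C"
    using conj_action_psl_ex[OF B(2), of A] B by metis
  then have "A' = C \<or> A' = - C" using assms(2) psl_eq_iff by metis
  then show ?thesis using C by auto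
qed

lemma pgl_scalar_iff: "det B \<noteq> 0 \<Longrightarrow> pgl B = \<one>\<^bsub>PGL2\<^esub> \<longleftrightarrow> (\<exists>c. B = mat c)"
  unfolding one_PGL2 pgl_eq_iff by (auto simp: mat_eq_matrix2)

lemma eq_minus_self_iff:
  fixes x :: "'k::field"
  assumes "(2::'k) \<noteq> 0" shows "x = - x \<longleftrightarrow> x = 0"
  by (metis assms add_eq_0_iff mult_2 mult_eq_0_iff)

text \<open>Fixing a class means commuting with its matrix up to sign. The two elementary unipotent
  matrices suffice as tests: commuting with both forces a scalar, and an anticommutation makes
  entries equal to their own negatives, hence zero.\<close>

lemma conj_action_faithful:
  fixes \<sigma> :: "('k::field^2^2) set"
  assumes "\<sigma> \<in> carrier PGL2" "\<And>\<omega>. \<omega> \<in> carrier PSL2 \<Longrightarrow> conj_action \<sigma> \<omega> = \<omega>" "(2::'k) \<noteq> 0"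
  shows "\<sigma> = \<one>\<^bsub>PGL2\<^esub>"
proof -
  obtain B where B: "\<sigma> = pgl B" "det B \<noteq> 0" using assms(1) by (rule pgl_cases)
  obtain a b c d where Bm: "B = matrix2 a b c d" by (rule matrix2_cases)
  have det: "a * d - b * c \<noteq> 0" using B Bm by simp
  have fix_pm: "B ** A = A ** B \<or> B ** A = - (A ** B)" if "det A = 1" for A
  proof -
    obtain A' where A': "B ** A = A' ** B" "conj_action \<sigma> (psl A) = psl A'"
      using conj_action_psl_ex[OF B(2), of A] B by metis
    then have "psl A' = psl A" using assms(2)[of "psl A"] that by simp
    then have "A' = A \<or> A' = - A" by (simp add: psl_eq_iff)
    then show ?thesis using A' by auto
  qed
  have "B ** matrix2 1 1 0 1 = matrix2 1 1 0 1 ** B \<or> B ** matrix2 1 1 0 1 = - (matrix2 1 1 0 1 ** B)"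
    by (rule fix_pm) simp
  then have "c = 0 \<and> a = d"
  proof
    assume "B ** matrix2 1 1 0 1 = matrix2 1 1 0 1 ** B"
    then show ?thesis by (simp add: Bm)
  next
    assume *: "B ** matrix2 1 1 0 1 = - (matrix2 1 1 0 1 ** B)"
    then have "c = - c" by (simp add: Bm)
    then have "c = 0" using eq_minus_self_iff[OF assms(3)] by blast
    moreover have "a = - a" using * \<open>c = 0\<close> by (simp add: Bm)
    then have "a = 0" using eq_minus_self_iff[OF assms(3)] by blast
    ultimately show ?thesis using det by simp
  qed
  moreover have "B ** matrix2 1 0 1 1 = matrix2 1 0 1 1 ** B \<or> B ** matrix2 1 0 1 1 = - (matrix2 1 0 1 1 ** B)"
    by (rule fix_pm) simp
  then have "b = 0"
  proof
    assume "B ** matrix2 1 0 1 1 = matrix2 1 0 1 1 ** B"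
    then show ?thesis by (simp add: Bm)
  next
    assume "B ** matrix2 1 0 1 1 = - (matrix2 1 0 1 1 ** B)"
    then have "b = - b" by (simp add: Bm)
    then show ?thesis using eq_minus_self_iff[OF assms(3)] by blast
  qed
  ultimately show ?thesis
    unfolding B(1) pgl_scalar_iff[OF B(2)] using Bm by (auto simp: mat_eq_matrix2)
qed


section \<open>Isomorphisms of Cayley maps\<close>

text \<open>The first return time of a point is the length of the cycle, and every return time is a
  multiple of it by division with remainder.\<close>

lemma cyclic_on_funpow_eq_iff:
  assumes "cyclic_on f S" "s \<in> S"
  shows "(f ^^ j) s = s \<longleftrightarrow> card S dvd j"
proof -
  have S: "S = orbit f s" using assms by (simp add: cyclic_on_alldef)
  then have s: "s \<in> orbit f s" using assms by simp
  define N where "N = funpow_dist1 f s s"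
  have N: "0 < N" "(f ^^ N) s = s" using funpow_dist1_prop[OF s] by (simp_all add: N_def)
  have "card S = N"
    unfolding S orbit_conv_funpow_dist1[OF s] N_def
    by (subst card_image[OF inj_on_funpow_dist1[OF s]]) simp
  moreover have mult: "(f ^^ (N * q)) s = s" for q
    by (induction q) (simp_all add: N funpow_add)
  moreover have "N dvd j" if "(f ^^ j) s = s"
  proof -
    have "(f ^^ j) s = (f ^^ (j mod N + N * (j div N))) s" by simp
    also have "\<dots> = (f ^^ (j mod N)) s" unfolding funpow_add o_apply mult ..
    finally have "\<not> 0 < j mod N" using funpow_dist1_least[of "j mod N" f s s] that N(1) N_def by auto
    then show ?thesis by (simp add: mod_eq_0_iff_dvd)
  qed
  ultimately show ?thesis by (auto elim!: dvdE)
qed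

lemma cyclic_on_obtain:
  assumes "cyclic_on f S" "s \<in> S" "t \<in> S"
  obtains j where "t = (f ^^ j) s"
proof -
  have "t \<in> orbit f s" using assms by (simp add: cyclic_on_alldef)
  then show ?thesis using that by (auto simp: orbit_altdef)
qed

lemma cyclic_on_image:
  assumes "cyclic_on f S" "\<And>s. s \<in> S \<Longrightarrow> h (f s) = g (h s)"
  shows "cyclic_on g (h ` S)"
proof -
  obtain s where s: "s \<in> S" "S = orbit f s" using assms(1) by (auto simp: cyclic_on_def)
  have in_S: "(f ^^ j) s \<in> S" for j using assms(1) s(1) by (rule cyclic_on_funpow_in)
  have comm: "h ((f ^^ j) s) = (g ^^ j) (h s)" for j
    by (induction j) (simp_all add: assms(2) in_S)
  have "h ` S = orbit g (h s)"
  proof (intro subset_antisym subsetI)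
    fix t assume "t \<in> h ` S"
    then obtain m where "t = (g ^^ m) (h s)" "0 < m"
      using s(2) comm by (auto simp: orbit_altdef)
    then show "t \<in> orbit g (h s)" unfolding orbit_altdef by blast
  next
    fix t assume "t \<in> orbit g (h s)"
    then obtain m where "t = h ((f ^^ m) s)" using comm by (auto simp: orbit_altdef)
    then show "t \<in> h ` S" using in_S by blast
  qed
  then show ?thesis using s(1) unfolding cyclic_on_def by blast
qed

text \<open>Write the inverse of \<open>\<omega>\<close> as the \<open>k\<close>-th rotate. Balance
  makes inversion commute with \<open>\<rho>\<close>, so inverting twice gives 2n | 2k. Type I
  forbids 2n | k, so \<open>k\<close> is an odd multiple of \<open>n\<close>.\<close>

lemma m_inv_eq_half_rotation:
  assumes data: "cayley_map_data G \<Omega> \<rho>" and card: "card \<Omega> = 2 * n"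
    and bal: "balanced G \<Omega> \<rho>" and type: "type_I G \<Omega>" and \<omega>: "\<omega> \<in> \<Omega>"
  shows "inv\<^bsub>G\<^esub> \<omega> = (\<rho> ^^ n) \<omega>"
proof -
  interpret group G using data by (simp add: cayley_map_data_def)
  have sub: "\<Omega> \<subseteq> carrier G" and cyc: "cyclic_on \<rho> \<Omega>" and invs: "m_inv G ` \<Omega> = \<Omega>"
    using data by (simp_all add: cayley_map_data_def)
  have "inv\<^bsub>G\<^esub> \<omega> \<in> \<Omega>" using invs \<omega> by blast
  then obtain k where k: "inv\<^bsub>G\<^esub> \<omega> = (\<rho> ^^ k) \<omega>" using cyclic_on_obtain[OF cyc \<omega>] by blast
  have in_\<Omega>: "(\<rho> ^^ j) \<omega> \<in> \<Omega>" for j using cyclic_on_funpow_in[OF cyc \<omega>] .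
  have comm: "(\<rho> ^^ j) (inv\<^bsub>G\<^esub> \<omega>) = inv\<^bsub>G\<^esub> ((\<rho> ^^ j) \<omega>)" for j
    by (induction j) (use bal in_\<Omega> in \<open>simp_all add: balanced_def\<close>)
  have "(\<rho> ^^ (k + k)) \<omega> = (\<rho> ^^ k) (inv\<^bsub>G\<^esub> \<omega>)" by (simp add: funpow_add k)
  also have "\<dots> = \<omega>" using comm k \<omega> sub by (metis inv_inv subsetD)
  finally have "2 * n dvd 2 * k" by (simp add: cyclic_on_funpow_eq_iff[OF cyc \<omega>] card mult_2)
  then have "n dvd k" by simp
  then obtain q where q: "k = n * q" by (elim dvdE)
  have "\<not> 2 * n dvd k"
  proof
    assume "2 * n dvd k"
    then have "inv\<^bsub>G\<^esub> \<omega> = \<omega>" unfolding k using cyclic_on_funpow_eq_iff[OF cyc \<omega>] card by simp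
    then have "\<omega> \<otimes>\<^bsub>G\<^esub> \<omega> = \<one>\<^bsub>G\<^esub>" using r_inv[of \<omega>] \<omega> sub by auto
    then show False using type \<omega> by (simp add: type_I_def)
  qed
  then have "odd q" unfolding q by auto
  then obtain r where "q = 2 * r + 1" by (elim oddE)
  then have "k = n + 2 * n * r" using q by (simp add: algebra_simps)
  moreover have "(\<rho> ^^ (2 * n * r)) \<omega> = \<omega>" using cyclic_on_funpow_eq_iff[OF cyc \<omega>] card by simp
  ultimately show ?thesis using k by (simp add: funpow_add)
qed

text \<open>
  An isomorphism sends the arc \<open>(\<eta>, \<omega>)\<close> to \<open>(V \<eta>, \<phi> \<eta> \<omega>)\<close>, where \<open>\<phi> \<eta>\<close> intertwines the
  rotations. Reversing arcs and using that inversion is a power of the rotation on both sides,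
  one finds that \<open>\<phi> \<eta>\<close> does not change along edges, hence does not depend on \<open>\<eta>\<close>. So \<open>V\<close> is
  a group isomorphism up to a left translation.
\<close>

lemma map_isomorphism_imp_group_iso:
  assumes data: "cayley_map_data G \<Omega> \<rho>" "cayley_map_data G' \<Omega>' \<rho>'"
    and half: "\<And>\<omega>. \<omega> \<in> \<Omega> \<Longrightarrow> inv\<^bsub>G\<^esub> \<omega> = (\<rho> ^^ n) \<omega>"
    and half': "\<And>\<omega>. \<omega> \<in> \<Omega>' \<Longrightarrow> inv\<^bsub>G'\<^esub> \<omega> = (\<rho>' ^^ n) \<omega>"
    and iso: "map_isomorphism (cayley_map G \<Omega> \<rho>) (cayley_map G' \<Omega>' \<rho>') h"
  obtains \<theta> where "\<theta> \<in> iso G G'" "\<theta> ` \<Omega> = \<Omega>'" "\<And>\<omega>. \<omega> \<in> \<Omega> \<Longrightarrow> \<theta> (\<rho> \<omega>) = \<rho>' (\<theta> \<omega>)"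
    "\<And>\<omega>. \<omega> \<in> \<Omega> \<Longrightarrow> snd (iso_arcs h (\<one>\<^bsub>G\<^esub>, \<omega>)) = \<theta> \<omega>"
proof -
  interpret G: group G using data by (simp add: cayley_map_data_def)
  interpret G': group G' using data by (simp add: cayley_map_data_def)
  have sub: "\<Omega> \<subseteq> carrier G" and cyc: "cyclic_on \<rho> \<Omega>" and invs: "m_inv G ` \<Omega> = \<Omega>"
    and gen: "generate G \<Omega> = carrier G"
    using data by (simp_all add: cayley_map_data_def)
  have sub': "\<Omega>' \<subseteq> carrier G'" using data by (simp add: cayley_map_data_def)
  have inv_\<Omega>: "inv\<^bsub>G\<^esub> \<omega> \<in> \<Omega>" if "\<omega> \<in> \<Omega>" for \<omega> using invs that by blast
  have \<rho>_closed: "\<rho> \<omega> \<in> \<Omega>" if "\<omega> \<in> \<Omega>" for \<omega>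
    using cyclic_on_funpow_in[OF cyc that, of 1] by simp
  define V where "V = iso_verts h"
  define \<phi> where "\<phi> \<eta> \<omega> = snd (iso_arcs h (\<eta>, \<omega>))" for \<eta> \<omega>
  note defs = map_isomorphism_def cayley_map_def cayley_digraph_def app_iso_def
    pre_digraph.digraph_isomorphism_def
  have inj_V: "inj_on V (carrier G)" and V_img: "V ` carrier G = carrier G'"
    and arcs_img: "iso_arcs h ` (carrier G \<times> \<Omega>) = carrier G' \<times> \<Omega>'"
    and tl: "iso_tail h = (\<lambda>(\<eta>, \<omega>). \<eta>)" and hd: "iso_head h = (\<lambda>(\<eta>, \<omega>). \<eta> \<otimes>\<^bsub>G'\<^esub> \<omega>)"
    using iso by (simp_all add: defs V_def)
  have V_closed [simp]: "V \<eta> \<in> carrier G'" if "\<eta> \<in> carrier G" for \<eta> using that V_img by blast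
  have V_tl: "V \<eta> = iso_tail h (iso_arcs h (\<eta>, \<omega>))" and V_hd: "V (\<eta> \<otimes>\<^bsub>G\<^esub> \<omega>) = iso_head h (iso_arcs h (\<eta>, \<omega>))"
    and V_rot: "iso_arcs h (\<eta>, \<rho> \<omega>) = (\<lambda>(\<eta>, \<omega>). (\<eta>, \<rho>' \<omega>)) (iso_arcs h (\<eta>, \<omega>))"
    if "\<eta> \<in> carrier G" "\<omega> \<in> \<Omega>" for \<eta> \<omega>
    using iso that by (auto simp: defs V_def)
  have arc: "iso_arcs h (\<eta>, \<omega>) = (V \<eta>, \<phi> \<eta> \<omega>)" if "\<eta> \<in> carrier G" "\<omega> \<in> \<Omega>" for \<eta> \<omega>
    using V_tl[OF that] tl by (simp add: \<phi>_def split: prod.splits)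
  have \<phi>_closed: "\<phi> \<eta> \<omega> \<in> \<Omega>'" if "\<eta> \<in> carrier G" "\<omega> \<in> \<Omega>" for \<eta> \<omega>
    using arc[OF that] arcs_img that by (metis SigmaI SigmaD2 image_eqI)
  then have \<phi>_carrier: "\<phi> \<eta> \<omega> \<in> carrier G'" if "\<eta> \<in> carrier G" "\<omega> \<in> \<Omega>" for \<eta> \<omega>
    using that sub' by blast
  have V_edge: "V (\<eta> \<otimes>\<^bsub>G\<^esub> \<omega>) = V \<eta> \<otimes>\<^bsub>G'\<^esub> \<phi> \<eta> \<omega>" if "\<eta> \<in> carrier G" "\<omega> \<in> \<Omega>" for \<eta> \<omega>
    using V_hd[OF that] hd arc[OF that] by simp
  have \<phi>_rot: "\<phi> \<eta> (\<rho> \<omega>) = \<rho>' (\<phi> \<eta> \<omega>)" if "\<eta> \<in> carrier G" "\<omega> \<in> \<Omega>" for \<eta> \<omega>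
    using V_rot[OF that] arc[OF that] arc[OF that(1) \<rho>_closed[OF that(2)]] by simp
  have \<phi>_funpow: "\<phi> \<eta> ((\<rho> ^^ j) \<omega>) = (\<rho>' ^^ j) (\<phi> \<eta> \<omega>)" if "\<eta> \<in> carrier G" "\<omega> \<in> \<Omega>" for \<eta> \<omega> j
    by (induction j) (simp_all add: \<phi>_rot that cyclic_on_funpow_in[OF cyc])
  have \<phi>_inv: "\<phi> \<eta> (inv\<^bsub>G\<^esub> \<omega>) = inv\<^bsub>G'\<^esub> (\<phi> \<eta> \<omega>)" if "\<eta> \<in> carrier G" "\<omega> \<in> \<Omega>" for \<eta> \<omega>
    by (simp add: half half' \<phi>_funpow \<phi>_closed that)
  have \<phi>_step_inv: "\<phi> (\<eta> \<otimes>\<^bsub>G\<^esub> \<omega>) (inv\<^bsub>G\<^esub> \<omega>) = \<phi> \<eta> (inv\<^bsub>G\<^esub> \<omega>)" if "\<eta> \<in> carrier G" "\<omega> \<in> \<Omega>" for \<eta> \<omega>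
  proof -
    have [simp]: "\<omega> \<in> carrier G" using that sub by blast
    have "V \<eta> = V ((\<eta> \<otimes>\<^bsub>G\<^esub> \<omega>) \<otimes>\<^bsub>G\<^esub> inv\<^bsub>G\<^esub> \<omega>)" using that by (simp add: G.m_assoc)
    also have "\<dots> = V \<eta> \<otimes>\<^bsub>G'\<^esub> (\<phi> \<eta> \<omega> \<otimes>\<^bsub>G'\<^esub> \<phi> (\<eta> \<otimes>\<^bsub>G\<^esub> \<omega>) (inv\<^bsub>G\<^esub> \<omega>))"
      using that by (subst V_edge) (simp_all add: V_edge inv_\<Omega> G'.m_assoc \<phi>_carrier)
    finally have "\<phi> \<eta> \<omega> \<otimes>\<^bsub>G'\<^esub> \<phi> (\<eta> \<otimes>\<^bsub>G\<^esub> \<omega>) (inv\<^bsub>G\<^esub> \<omega>) = \<one>\<^bsub>G'\<^esub>"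
      using that by (simp add: \<phi>_carrier inv_\<Omega>)
    then have "inv\<^bsub>G'\<^esub> (\<phi> \<eta> \<omega>) = \<phi> (\<eta> \<otimes>\<^bsub>G\<^esub> \<omega>) (inv\<^bsub>G\<^esub> \<omega>)"
      using that by (intro G'.inv_equality) (simp_all add: \<phi>_carrier inv_\<Omega> G'.inv_comm)
    then show ?thesis using \<phi>_inv that by simp
  qed
  \<comment> \<open>The inverse of \<open>\<omega>\<close> can be rotated to any
    \<open>\<omega>'\<close>, and \<open>\<phi>\<close> intertwines the rotations, so agreement at
    one arc of a vertex spreads to all its arcs.\<close>
  have \<phi>_step: "\<phi> (\<eta> \<otimes>\<^bsub>G\<^esub> \<omega>) \<omega>' = \<phi> \<eta> \<omega>'" if that3: "\<eta> \<in> carrier G" "\<omega> \<in> \<Omega>" "\<omega>' \<in> \<Omega>" for \<eta> \<omega> \<omega>'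
  proof -
    obtain j where "\<omega>' = (\<rho> ^^ j) (inv\<^bsub>G\<^esub> \<omega>)"
      using cyclic_on_obtain[OF cyc inv_\<Omega>[OF that3(2)] that3(3)] by blast
    then show ?thesis using that3 sub by (simp add: \<phi>_funpow inv_\<Omega> \<phi>_step_inv subsetD)
  qed
  have "g \<in> carrier G \<and> (\<forall>\<eta>\<in>carrier G. \<forall>\<omega>\<in>\<Omega>. \<phi> (\<eta> \<otimes>\<^bsub>G\<^esub> g) \<omega> = \<phi> \<eta> \<omega>)" if "g \<in> generate G \<Omega>" for g
    using that
  proof (induction rule: generate.induct)
    case (inv \<omega>)
    then show ?case using \<phi>_step inv_\<Omega> sub by blast
  next
    case (eng g1 g2)
    then show ?case by (metis G.m_assoc G.m_closed)
  qed (use \<phi>_step sub in auto)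
  then have \<phi>_const: "\<phi> \<eta> \<omega> = \<phi> \<one>\<^bsub>G\<^esub> \<omega>" if "\<eta> \<in> carrier G" "\<omega> \<in> \<Omega>" for \<eta> \<omega>
    using that gen by (metis G.l_one G.one_closed)
  define \<theta> where "\<theta> g = inv\<^bsub>G'\<^esub> (V \<one>\<^bsub>G\<^esub>) \<otimes>\<^bsub>G'\<^esub> V g" for g
  have \<theta>_closed [simp]: "\<theta> g \<in> carrier G'" if "g \<in> carrier G" for g using that by (simp add: \<theta>_def)
  have \<theta>_\<Omega>: "\<theta> \<omega> = \<phi> \<one>\<^bsub>G\<^esub> \<omega>" if "\<omega> \<in> \<Omega>" for \<omega>
    using that V_edge[of "\<one>\<^bsub>G\<^esub>" \<omega>] sub
    by (simp add: \<theta>_def \<phi>_carrier subsetD flip: G'.m_assoc)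
  have V_edge_\<theta>: "V (\<eta> \<otimes>\<^bsub>G\<^esub> \<omega>) = V \<eta> \<otimes>\<^bsub>G'\<^esub> \<theta> \<omega>" if "\<eta> \<in> carrier G" "\<omega> \<in> \<Omega>" for \<eta> \<omega>
    by (simp only: V_edge[OF that] \<phi>_const[OF that] \<theta>_\<Omega>[OF that(2)])
  have "g \<in> carrier G \<and> (\<forall>\<eta>\<in>carrier G. V (\<eta> \<otimes>\<^bsub>G\<^esub> g) = V \<eta> \<otimes>\<^bsub>G'\<^esub> \<theta> g)" if "g \<in> generate G \<Omega>" for g
    using that
  proof (induction rule: generate.induct)
    case one
    then show ?case by (simp add: \<theta>_def)
  next
    case (incl \<omega>)
    then show ?case using V_edge_\<theta> sub by blast
  next
    case (inv \<omega>)
    then show ?case using V_edge_\<theta> inv_\<Omega> sub by blast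
  next
    case (eng g1 g2)
    have "\<theta> (g1 \<otimes>\<^bsub>G\<^esub> g2) = \<theta> g1 \<otimes>\<^bsub>G'\<^esub> \<theta> g2"
      using eng by (simp add: \<theta>_def G'.m_assoc)
    then show ?case using eng by (simp add: G'.m_assoc flip: G.m_assoc)
  qed
  then have V_mult: "V (\<eta> \<otimes>\<^bsub>G\<^esub> g) = V \<eta> \<otimes>\<^bsub>G'\<^esub> \<theta> g" if "\<eta> \<in> carrier G" "g \<in> carrier G" for \<eta> g
    using that gen by blast
  show ?thesis
  proof (rule that)
    show "\<theta> \<in> iso G G'"
    proof (rule isoI)
      have "\<theta> (g1 \<otimes>\<^bsub>G\<^esub> g2) = \<theta> g1 \<otimes>\<^bsub>G'\<^esub> \<theta> g2" if "g1 \<in> carrier G" "g2 \<in> carrier G" for g1 g2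
        using that V_mult[OF that] \<theta>_closed[OF that(2)]
        by (simp add: \<theta>_def[of g1] \<theta>_def[of "g1 \<otimes>\<^bsub>G\<^esub> g2"] G'.m_assoc)
      then show "\<theta> \<in> hom G G'" by (simp add: hom_def Pi_iff)
      have "inj_on \<theta> (carrier G)"
        using inj_V by (auto simp: inj_on_def \<theta>_def)
      moreover have "\<theta> ` carrier G = carrier G'"
      proof (intro subset_antisym subsetI)
        fix g assume g: "g \<in> carrier G'"
        then have "V \<one>\<^bsub>G\<^esub> \<otimes>\<^bsub>G'\<^esub> g \<in> V ` carrier G" using V_img by simp
        then obtain g0 where "g0 \<in> carrier G" "V g0 = V \<one>\<^bsub>G\<^esub> \<otimes>\<^bsub>G'\<^esub> g" by force
        then show "g \<in> \<theta> ` carrier G"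
          using g by (intro image_eqI[of _ _ g0]) (simp_all add: \<theta>_def flip: G'.m_assoc)
      qed auto
      ultimately show "bij_betw \<theta> (carrier G) (carrier G')" by (simp add: bij_betw_def)
    qed
    show "\<theta> ` \<Omega> = \<Omega>'"
    proof (intro subset_antisym subsetI)
      fix \<omega> assume "\<omega> \<in> \<theta> ` \<Omega>"
      then show "\<omega> \<in> \<Omega>'" using \<theta>_\<Omega> \<phi>_closed by auto
    next
      fix \<omega>' assume "\<omega>' \<in> \<Omega>'"
      then have "(V \<one>\<^bsub>G\<^esub>, \<omega>') \<in> iso_arcs h ` (carrier G \<times> \<Omega>)" using arcs_img by simp
      then obtain \<eta> \<omega> where *: "\<eta> \<in> carrier G" "\<omega> \<in> \<Omega>" "iso_arcs h (\<eta>, \<omega>) = (V \<one>\<^bsub>G\<^esub>, \<omega>')" by force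
      then have "\<omega>' = \<phi> \<eta> \<omega>" using arc by simp
      also have "\<dots> = \<theta> \<omega>" using \<phi>_const[OF *(1,2)] \<theta>_\<Omega>[OF *(2)] by simp
      finally show "\<omega>' \<in> \<theta> ` \<Omega>" using *(2) by blast
    qed
    show "\<theta> (\<rho> \<omega>) = \<rho>' (\<theta> \<omega>)" if "\<omega> \<in> \<Omega>" for \<omega>
      using that \<theta>_\<Omega> \<phi>_rot \<rho>_closed by simp
    show "snd (iso_arcs h (\<one>\<^bsub>G\<^esub>, \<omega>)) = \<theta> \<omega>" if "\<omega> \<in> \<Omega>" for \<omega>
      using that \<theta>_\<Omega> by (simp add: \<phi>_def)
  qed
qed

text \<open>Arc-transitivity supplies a map automorphism turning one arc at the identity into the
  next. The group automorphism it induces agrees with \<open>\<rho>\<close> at one element and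
  commutes with \<open>\<rho>\<close>, hence agrees with it on the whole cycle.\<close>

lemma regular_balanced_imp_automorphism:
  assumes data: "cayley_map_data G \<Omega> \<rho>" and half: "\<And>\<omega>. \<omega> \<in> \<Omega> \<Longrightarrow> inv\<^bsub>G\<^esub> \<omega> = (\<rho> ^^ n) \<omega>"
    and reg: "regular_map (cayley_map G \<Omega> \<rho>)"
  obtains \<theta> where "\<theta> \<in> iso G G" "\<And>\<omega>. \<omega> \<in> \<Omega> \<Longrightarrow> \<theta> \<omega> = \<rho> \<omega>"
proof -
  interpret G: group G using data by (simp add: cayley_map_data_def)
  have cyc: "cyclic_on \<rho> \<Omega>" using data by (simp add: cayley_map_data_def)
  then obtain \<omega>0 where \<omega>0: "\<omega>0 \<in> \<Omega>" by (auto simp: cyclic_on_def)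
  then have "\<rho> \<omega>0 \<in> \<Omega>" using cyclic_on_funpow_in[OF cyc, of \<omega>0 1] by simp
  with \<omega>0 have "(\<one>\<^bsub>G\<^esub>, \<omega>0) \<in> arcs (fst (cayley_map G \<Omega> \<rho>))" "(\<one>\<^bsub>G\<^esub>, \<rho> \<omega>0) \<in> arcs (fst (cayley_map G \<Omega> \<rho>))"
    by (simp_all add: cayley_map_def cayley_digraph_def)
  then obtain h where h: "map_isomorphism (cayley_map G \<Omega> \<rho>) (cayley_map G \<Omega> \<rho>) h"
    "iso_arcs h (\<one>\<^bsub>G\<^esub>, \<omega>0) = (\<one>\<^bsub>G\<^esub>, \<rho> \<omega>0)"
    using reg by (auto simp: regular_map_def)
  obtain \<theta> where \<theta>: "\<theta> \<in> iso G G" "\<And>\<omega>. \<omega> \<in> \<Omega> \<Longrightarrow> \<theta> (\<rho> \<omega>) = \<rho> (\<theta> \<omega>)"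
      "\<And>\<omega>. \<omega> \<in> \<Omega> \<Longrightarrow> snd (iso_arcs h (\<one>\<^bsub>G\<^esub>, \<omega>)) = \<theta> \<omega>"
    using map_isomorphism_imp_group_iso[OF data data half half h(1)] by metis
  have pow: "\<theta> ((\<rho> ^^ j) \<omega>0) = \<rho> ((\<rho> ^^ j) \<omega>0)" for j
  proof (induction j)
    case 0
    show ?case using \<theta>(3)[OF \<omega>0] h(2) by simp
  next
    case (Suc j)
    then show ?case by (simp add: \<theta>(2) cyclic_on_funpow_in[OF cyc \<omega>0])
  qed
  have "\<theta> \<omega> = \<rho> \<omega>" if "\<omega> \<in> \<Omega>" for \<omega>
    by (rule cyclic_on_obtain[OF cyc \<omega>0 that]) (simp add: pow)
  then show ?thesis by (rule that[OF \<theta>(1)])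
qed

text \<open>Converse of the passage from maps to groups; it carries a given map onto its normal
  form.\<close>

lemma group_iso_imp_map_isomorphic:
  assumes data: "cayley_map_data G \<Omega> \<rho>" and G': "group G'"
    and \<theta>: "\<theta> \<in> iso G G'" and comm: "\<And>\<omega>. \<omega> \<in> \<Omega> \<Longrightarrow> \<theta> (\<rho> \<omega>) = \<rho>' (\<theta> \<omega>)"
  shows "cayley_map G \<Omega> \<rho> \<cong>\<^sub>m cayley_map G' (\<theta> ` \<Omega>) \<rho>'"
    and "cayley_map_data G' (\<theta> ` \<Omega>) \<rho>'"
proof -
  interpret G: group G using data by (simp add: cayley_map_data_def)
  interpret G': group G' by fact
  interpret group_hom G G' \<theta> using \<theta> by unfold_locales (auto simp: iso_def)
  have sub: "\<Omega> \<subseteq> carrier G" and cyc: "cyclic_on \<rho> \<Omega>" and invs: "m_inv G ` \<Omega> = \<Omega>"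
    and gen: "generate G \<Omega> = carrier G" and one: "\<one>\<^bsub>G\<^esub> \<notin> \<Omega>" and fin: "finite (carrier G)"
    using data by (simp_all add: cayley_map_data_def)
  have inj: "inj_on \<theta> (carrier G)" and img: "\<theta> ` carrier G = carrier G'"
    using \<theta> by (auto simp: iso_def bij_betw_def)
  \<comment> \<open>Besides the action on vertices and arcs, the record must supply the head and
    tail functions of the target digraph.\<close>
  let ?h = "\<lparr>iso_verts = \<theta>, iso_arcs = map_prod \<theta> \<theta>, iso_head = (\<lambda>(\<eta>, \<omega>). \<eta> \<otimes>\<^bsub>G'\<^esub> \<omega>),
    iso_tail = (\<lambda>(\<eta>, \<omega>). \<eta>)\<rparr>"
  have "wf_digraph (cayley_digraph G \<Omega>)"
    using sub by unfold_locales (auto simp: cayley_digraph_def)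
  moreover have "inj_on (map_prod \<theta> \<theta>) (carrier G \<times> \<Omega>)"
    using inj inj_on_subset[OF inj sub] by (rule map_prod_inj_on)
  moreover have "map_prod \<theta> \<theta> ` (carrier G \<times> \<Omega>) = carrier G' \<times> \<theta> ` \<Omega>"
    by (rule map_prod_surj_on[OF img refl])
  moreover have "\<theta> (\<eta> \<otimes>\<^bsub>G\<^esub> \<omega>) = \<theta> \<eta> \<otimes>\<^bsub>G'\<^esub> \<theta> \<omega>" if "\<eta> \<in> carrier G" "\<omega> \<in> \<Omega>" for \<eta> \<omega>
    using that sub by (intro hom_mult) auto
  ultimately have "map_isomorphism (cayley_map G \<Omega> \<rho>) (cayley_map G' (\<theta> ` \<Omega>) \<rho>') ?h"
    using inj img comm
    by (simp add: map_isomorphism_def cayley_map_def cayley_digraph_def app_iso_def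
        pre_digraph.digraph_isomorphism_def split_paired_Ball_Sigma)
  then show "cayley_map G \<Omega> \<rho> \<cong>\<^sub>m cayley_map G' (\<theta> ` \<Omega>) \<rho>'" unfolding map_isomorphic_def by blast
  have "m_inv G' ` (\<theta> ` \<Omega>) = \<theta> ` (m_inv G ` \<Omega>)"
    unfolding image_image using sub by (intro image_cong refl hom_inv[symmetric]) blast
  moreover have "\<one>\<^bsub>G'\<^esub> \<notin> \<theta> ` \<Omega>"
  proof
    assume "\<one>\<^bsub>G'\<^esub> \<in> \<theta> ` \<Omega>"
    then obtain \<omega> where "\<omega> \<in> \<Omega>" "\<theta> \<omega> = \<theta> \<one>\<^bsub>G\<^esub>" by auto
    then show False using one sub inj_onD[OF inj, of \<omega> "\<one>\<^bsub>G\<^esub>"] by auto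
  qed
  moreover have "\<theta> ` \<Omega> \<subseteq> carrier G'" using sub img by blast
  moreover have "finite (carrier G')" using fin by (simp flip: img)
  ultimately show "cayley_map_data G' (\<theta> ` \<Omega>) \<rho>'"
    using G' cyclic_on_image[of \<rho> \<Omega> \<theta> \<rho>', OF cyc comm]
    by (simp add: cayley_map_data_def invs generate_img[OF sub] gen img)
qed


section \<open>Conjugacy in PGL(2)\<close>

lemma pgl_conj_eqI:
  assumes "det C \<noteq> 0" "det B \<noteq> 0" "C ** B = B' ** C"
  shows "pgl C \<otimes>\<^bsub>PGL2\<^esub> pgl B \<otimes>\<^bsub>PGL2\<^esub> inv\<^bsub>PGL2\<^esub> (pgl C) = pgl B'"
proof -
  have "det B' \<noteq> 0" using arg_cong[OF assms(3), of det] assms(1,2) by (auto simp: det_mul)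
  then have "pgl C \<otimes>\<^bsub>PGL2\<^esub> pgl B = pgl B' \<otimes>\<^bsub>PGL2\<^esub> pgl C"
    using pgl_mult[OF assms(1,2)] pgl_mult[OF \<open>det B' \<noteq> 0\<close> assms(1)] assms(3) by simp
  then show ?thesis using assms \<open>det B' \<noteq> 0\<close> by (simp add: PGL2.m_assoc)
qed

text \<open>The invariant is the squared trace over the determinant, unchanged by conjugation and by
  scalars; it is written without division.\<close>

lemma pgl_conj_invariant:
  assumes "\<sigma> \<in> carrier PGL2" "det B \<noteq> 0"
    "\<sigma> \<otimes>\<^bsub>PGL2\<^esub> pgl B \<otimes>\<^bsub>PGL2\<^esub> inv\<^bsub>PGL2\<^esub> \<sigma> = pgl B'"
  shows "(trace B')\<^sup>2 * det B = (trace B)\<^sup>2 * det B'"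
proof -
  obtain C where C: "\<sigma> = pgl C" "det C \<noteq> 0" using assms(1) by (rule pgl_cases)
  obtain B1 where B1: "C ** B = B1 ** C" "det B1 = det B" "trace B1 = trace B"
    using conj_action_psl_ex[OF C(2), of B] by metis
  have "pgl B1 = pgl B'" using pgl_conj_eqI[OF C(2) assms(2) B1(1)] assms(3) C(1) by simp
  then obtain c where "B1 = mat c ** B'" using pgl_eq_iff by blast
  moreover have "trace (mat c ** B') = c * trace B'"
    by (cases B' rule: matrix2_cases) (simp add: algebra_simps)
  ultimately have "trace B = c * trace B'" "det B = c\<^sup>2 * det B'" using B1 by (simp_all add: det_mul)
  then show ?thesis by (simp add: power_mult_distrib)
qed

lemma diag_pow:
  assumes "a \<noteq> 0" shows "pgl (matrix2 a 0 0 1) [^]\<^bsub>PGL2\<^esub> (k::nat) = pgl (matrix2 (a ^ k) 0 0 1)"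
  by (induction k) (use assms in \<open>simp_all add: one_PGL2 mat_eq_matrix2 pgl_mult mult.commute\<close>)

lemma unipotent_pgl_pow:
  "pgl (matrix2 1 b 0 1) [^]\<^bsub>PGL2\<^esub> (k::nat) = pgl (matrix2 1 (of_nat k * b) 0 1)"
  by (induction k) (simp_all add: one_PGL2 mat_eq_matrix2 pgl_mult algebra_simps)

lemma unipotent_psl_pow:
  "psl (matrix2 1 b 0 1) [^]\<^bsub>PSL2\<^esub> (k::nat) = psl (matrix2 1 (of_nat k * b) 0 1)"
  by (induction k) (simp_all add: one_PSL2 mat_eq_matrix2 psl_mult algebra_simps)

lemma unipotent_psl_pow':
  "psl (matrix2 1 0 b 1) [^]\<^bsub>PSL2\<^esub> (k::nat) = psl (matrix2 1 0 (of_nat k * b) 1)"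
  by (induction k) (simp_all add: one_PSL2 mat_eq_matrix2 psl_mult algebra_simps)

text \<open>One matrix represents the power in both groups, which lets statements on orders pass
  from \<open>PSL2\<close> to \<open>PGL2\<close>.\<close>

lemma psl_pow_pgl_pow:
  assumes "det A = 1"
  obtains X where "det X = 1" "psl A [^]\<^bsub>PSL2\<^esub> (k::nat) = psl X" "pgl A [^]\<^bsub>PGL2\<^esub> k = pgl X"
proof -
  have "\<exists>X. det X = 1 \<and> psl A [^]\<^bsub>PSL2\<^esub> k = psl X \<and> pgl A [^]\<^bsub>PGL2\<^esub> k = pgl X"
  proof (induction k)
    case 0
    have "det (mat 1 :: 'a^2^2) = 1" by simp
    then show ?case using one_PGL2 one_PSL2 by (metis PGL2.nat_pow_0 PSL2.nat_pow_0)
  next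
    case (Suc k)
    then obtain X where X: "det X = 1" "psl A [^]\<^bsub>PSL2\<^esub> k = psl X" "pgl A [^]\<^bsub>PGL2\<^esub> k = pgl X" by blast
    have "det (X ** A) = 1" using X assms by (simp add: det_mul)
    moreover have "psl A [^]\<^bsub>PSL2\<^esub> Suc k = psl (X ** A)" using X assms by (simp add: psl_mult)
    moreover have "pgl A [^]\<^bsub>PGL2\<^esub> Suc k = pgl (X ** A)" using X assms by (simp add: pgl_mult)
    ultimately show ?case by blast
  qed
  then show ?thesis using that by blast
qed

lemma psl_one_imp_pgl_one: "psl X = \<one>\<^bsub>PSL2\<^esub> \<Longrightarrow> pgl X = \<one>\<^bsub>PGL2\<^esub>"
proof -
  assume "psl X = \<one>\<^bsub>PSL2\<^esub>"
  then have "X = mat 1 ** mat 1 \<or> X = mat (- 1) ** mat 1"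
    unfolding mat_minus_one_mult by (simp add: one_PSL2 psl_eq_iff)
  then show ?thesis unfolding one_PGL2 pgl_eq_iff by (metis neg_equal_0_iff_equal one_neq_zero)
qed

lemma pgl_one_imp_psl_one: "det X = 1 \<Longrightarrow> pgl X = \<one>\<^bsub>PGL2\<^esub> \<Longrightarrow> psl X = \<one>\<^bsub>PSL2\<^esub>"
  by (auto simp: pgl_scalar_iff one_PSL2 psl_eq_iff mat_eq_matrix2 square_eq_1_iff)

text \<open>The rows of the conjugating matrix are a row vector v and v(A - 1); the intertwining
  relation then says that (A - 1)^2 = 0. The rows are independent as soon as v(A - 1) is nonzero: v
  is the first unit vector if \<open>b \<noteq> 0\<close>, the second otherwise.\<close>

lemma unipotent_conj:
  assumes "det A = 1" "trace A = 2" "A \<noteq> mat 1"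
  obtains C where "det C \<noteq> 0" "C ** A = matrix2 1 1 0 1 ** C"
proof (cases A rule: matrix2_cases)
  case (1 a b c d)
  have d: "d = 2 - a" using assms(2) 1 by (simp add: algebra_simps)
  have bc: "b * c = - (a - 1)\<^sup>2" using assms(1) 1 d by (simp add: algebra_simps power2_eq_square)
  show ?thesis
  proof (cases "b = 0")
    case False
    show ?thesis
      by (rule that[of "matrix2 1 0 (a - 1) b"])
        (use False bc in \<open>simp_all add: 1 d algebra_simps power2_eq_square\<close>)
  next
    case True
    then have "a = 1" using bc by simp
    then have "c \<noteq> 0" using assms(3) True d 1 by (auto simp: mat_eq_matrix2)
    then show ?thesis
      by (intro that[of "matrix2 0 1 c 0"]) (simp_all add: 1 d \<open>a = 1\<close> True)
  qed
qed

text \<open>A nonzero square discriminant yields two distinct eigenvalues, with difference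
  \<open>r\<close>; the rows of the conjugating matrix are left eigenvectors.\<close>

lemma split_conj:
  fixes B :: "'k::field^2^2"
  assumes B: "det B \<noteq> 0" and r: "(trace B)\<^sup>2 - 4 * det B = r\<^sup>2" "r \<noteq> 0" and two: "(2::'k) \<noteq> 0"
  obtains C and a b :: 'k where "det C \<noteq> 0" "a \<noteq> 0" "b \<noteq> 0" "C ** B = matrix2 a 0 0 b ** C"
proof (cases B rule: matrix2_cases)
  case (1 a b c d)
  show ?thesis
  proof (cases "c = 0")
    case True
    have "(a - d)\<^sup>2 = r\<^sup>2" using r 1 True by (simp add: algebra_simps power2_eq_square)
    then have "a - d \<noteq> 0" using r(2) by auto
    then show ?thesis using B
      by (intro that[of "matrix2 (a - d) b 0 1" a d]) (simp_all add: 1 True algebra_simps)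
  next
    case False
    define \<mu> where "\<mu> = (a + d + r) / 2"
    define \<nu> where "\<nu> = (a + d - r) / 2"
    have "x / 2 + x / 2 = x" for x :: 'k
      using two by (simp flip: add_divide_distrib mult_2)
    then have half: "x / 2 = x - x / 2" for x :: 'k by (metis add_diff_cancel)
    have sum: "\<mu> + \<nu> = a + d" and diff: "\<mu> - \<nu> = r"
      unfolding \<mu>_def \<nu>_def add_divide_distrib diff_divide_distrib
      using half[of a] half[of d] half[of r] by (simp_all add: algebra_simps)
    have "4 * (\<mu> * \<nu>) = (\<mu> + \<nu>)\<^sup>2 - (\<mu> - \<nu>)\<^sup>2" by (simp add: algebra_simps power2_eq_square)
    also have "\<dots> = 4 * (a * d - b * c)" using r 1 unfolding sum diff by (simp add: algebra_simps)
    moreover have "(4::'k) \<noteq> 0" using two by (metis mult_2 mult_eq_0_iff numeral_Bit0)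
    ultimately have prod: "\<mu> * \<nu> = a * d - b * c" by (metis mult_left_cancel)
    have root: "x * (x - a) = c * b + (x - a) * d" if "x = \<mu> \<or> x = \<nu>" for x
    proof -
      have "(x - \<mu>) * (x - \<nu>) = 0" using that by auto
      then have "x * x = x * (\<mu> + \<nu>) - \<mu> * \<nu>" by (simp add: algebra_simps)
      then show ?thesis unfolding sum prod by (simp add: algebra_simps)
    qed
    show ?thesis
    proof (rule that)
      have "c * (\<nu> - a) - (\<mu> - a) * c = - (c * (\<mu> - \<nu>))" by (simp add: algebra_simps)
      then show "det (matrix2 c (\<mu> - a) c (\<nu> - a)) \<noteq> 0" using False r(2) diff by simp
      have "\<mu> * \<nu> \<noteq> 0" using prod B 1 by simp
      then show "\<mu> \<noteq> 0" "\<nu> \<noteq> 0" by auto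
      show "matrix2 c (\<mu> - a) c (\<nu> - a) ** B = matrix2 \<mu> 0 0 \<nu> ** matrix2 c (\<mu> - a) c (\<nu> - a)"
        using root[of \<mu>] root[of \<nu>] unfolding 1 by (simp add: algebra_simps)
    qed
  qed
qed

text \<open>Write B = x + N with N of trace zero, so that N^2 is the scalar
  \<open>e * y\<^sup>2\<close>. With v the first unit vector, the rows of the conjugating matrix are
  e y v and v N; multiplying by N exchanges them up to the factors e y and y. Independence is
  \<open>b \<noteq> 0\<close>, which fails only if \<open>e\<close> is a square.\<close>

lemma nonsplit_conj:
  fixes B :: "'k::field^2^2"
  assumes B: "det B \<noteq> 0" and y: "(trace B)\<^sup>2 - 4 * det B = 4 * (e * y\<^sup>2)" "y \<noteq> 0" "e \<noteq> 0"
    and e: "\<And>t. t\<^sup>2 \<noteq> e" and two: "(2::'k) \<noteq> 0"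
  obtains C x where "det C \<noteq> 0" "C ** B = matrix2 x (e * y) y x ** (C :: 'k^2^2)"
proof (cases B rule: matrix2_cases)
  case (1 a b c d)
  define x where "x = (a + d) / 2"
  define h where "h = (a - d) / 2"
  have ad: "a = x + h" "d = x - h"
  proof -
    have "y / 2 + y / 2 = y" for y :: 'k
      using two by (simp flip: add_divide_distrib mult_2)
    then have half: "y / 2 = y - y / 2" for y :: 'k by (metis add_diff_cancel)
    show "a = x + h" "d = x - h"
      unfolding x_def h_def add_divide_distrib diff_divide_distrib
      using half[of a] half[of d] by (simp_all add: algebra_simps)
  qed
  have four: "(4::'k) \<noteq> 0" using two by (metis mult_2 mult_eq_0_iff numeral_Bit0)
  have "(trace B)\<^sup>2 - 4 * det B = 4 * (h\<^sup>2 + b * c)"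
    unfolding 1 ad by (simp add: algebra_simps power2_eq_square)
  then have hbc: "h\<^sup>2 + b * c = e * y\<^sup>2" using y(1) four by (metis mult_left_cancel)
  have "b \<noteq> 0"
  proof
    assume "b = 0"
    then have "(h / y)\<^sup>2 = e" using hbc y by (simp add: power_divide)
    then show False using e by blast
  qed
  show ?thesis
  proof (rule that)
    show "det (matrix2 (e * y) 0 h b) \<noteq> 0" using \<open>b \<noteq> 0\<close> y by simp
    show "matrix2 (e * y) 0 h b ** B = matrix2 x (e * y) y x ** matrix2 (e * y) 0 h b"
      using hbc unfolding 1 ad by (simp add: algebra_simps power2_eq_square)
  qed
qed


section \<open>Finite fields\<close>

text \<open>Multiplication by \<open>g\<close> is a cyclic permutation of the units, so the order of
  \<open>g\<close> is the length of that cycle.\<close>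

lemma generates_units_power_eq_1_iff:
  fixes g :: "'a::{field,finite}"
  assumes "generates_units g"
  shows "g ^ k = 1 \<longleftrightarrow> CARD('a) - 1 dvd k"
proof -
  have g0: "g \<noteq> 0"
    using assms unfolding generates_units_def by (metis DiffD2 power_one_right rangeI singletonI)
  have pow: "(((*) g) ^^ j) 1 = g ^ j" for j by (induction j) auto
  have "inverse g \<in> range (\<lambda>i::nat. g ^ i)" using assms g0 by (simp add: generates_units_def)
  then obtain i where i: "inverse g = g ^ i" by blast
  have one: "g ^ Suc i = 1" using i g0 by (metis power_Suc right_inverse)
  have "orbit ((*) g) 1 = range (\<lambda>i::nat. g ^ i)"
  proof (intro subset_antisym subsetI)
    fix y assume "y \<in> range (\<lambda>i::nat. g ^ i)"
    then obtain j where "y = g ^ j" by blast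
    \<comment> \<open>Orbits admit only positive exponents; adding the period \<open>Suc i\<close>
      makes the exponent positive.\<close>
    then have "y = (((*) g) ^^ (j + Suc i)) 1" unfolding pow by (simp only: power_add one mult_1_right)
    moreover have "0 < j + Suc i" by simp
    ultimately show "y \<in> orbit ((*) g) 1" unfolding orbit_altdef by blast
  qed (auto simp: orbit_altdef pow)
  then have "cyclic_on ((*) g) (UNIV - {0})"
    using assms unfolding cyclic_on_def generates_units_def by (intro bexI[of _ 1]) auto
  from cyclic_on_funpow_eq_iff[OF this, of 1 k] show ?thesis
    by (simp add: pow card_Diff_singleton)
qed

lemma CHAR_prime_field:
  assumes "CARD('a::{field,finite}) = p" "prime p"
  shows "CHAR('a) = p"
  using CHAR_dvd_CARD[where 'a = 'a] assms prime_nat_iff CHAR_not_1' by (metis One_nat_def)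

text \<open>In a prime field every elementary unipotent is thereby a power of a single one. This is
  why automorphisms of \<open>PSL2\<close> involve no field automorphisms.\<close>

lemma prime_field_of_nat:
  assumes "CARD('a::{field,finite}) = p" "prime p"
  obtains j where "x = (of_nat j :: 'a)"
proof -
  have ch: "CHAR('a) = p" using CHAR_prime_field[OF assms] .
  have "inj_on (of_nat :: nat \<Rightarrow> 'a) {..<p}"
    by (auto simp: inj_on_def of_nat_eq_iff_cong_CHAR ch cong_less_modulus_unique_nat)
  then have "card ((of_nat :: nat \<Rightarrow> 'a) ` {..<p}) = CARD('a)" using assms by (simp add: card_image)
  then have "(of_nat :: nat \<Rightarrow> 'a) ` {..<p} = UNIV" by (intro card_subset_eq) auto
  then show ?thesis using that by (metis UNIV_I imageE)
qed

text \<open>The larger field serves to describe the non-split torus of \<open>PGL2\<close> as its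
  units modulo the units of \<open>'k\<close>.\<close>

locale quadratic_extension =
  fixes p :: nat
    and e w1 w2 :: "'k::{field, finite}"
    and \<iota> :: "'k \<Rightarrow> 'l::{field, finite}"
    and s :: 'l
  assumes p: "prime p" "p > 5"
    and card_k: "CARD('k) = p" and card_l: "CARD('l) = p\<^sup>2" and emb: "field_embedding \<iota>"
    and gen_e: "generates_units e"
    and s: "s\<^sup>2 = \<iota> e"
    and gen_w: "generates_units (\<iota> w1 + \<iota> w2 * s)"
begin

lemma \<iota>_simps [simp]: "\<iota> 1 = 1" "\<iota> (x + y) = \<iota> x + \<iota> y" "\<iota> (x * y) = \<iota> x * \<iota> y"
  using emb by (simp_all add: field_embedding_def)

lemma \<iota>_0 [simp]: "\<iota> 0 = 0"
proof -
  have "\<iota> 0 + \<iota> 0 = \<iota> 0 + 0" using \<iota>_simps(2)[of 0 0] by (metis add_0_right)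
  then show ?thesis by (simp only: add_left_cancel)
qed

lemma \<iota>_minus [simp]: "\<iota> (- x) = - \<iota> x"
  using \<iota>_simps(2)[of x "- x"] by (simp del: \<iota>_simps add: eq_neg_iff_add_eq_0 add.commute)

lemma \<iota>_diff [simp]: "\<iota> (x - y) = \<iota> x - \<iota> y"
  using \<iota>_simps(2)[of x "- y"] by (simp del: \<iota>_simps)

lemma \<iota>_eq_0_iff [simp]: "\<iota> x = 0 \<longleftrightarrow> x = 0"
proof
  assume "\<iota> x = 0"
  show "x = 0"
  proof (rule ccontr)
    assume "x \<noteq> 0"
    then have "\<iota> (x * inverse x) = 1" by simp
    then show False using \<open>\<iota> x = 0\<close> by (simp del: right_inverse)
  qed
qed simp

lemma \<iota>_eq_iff [simp]: "\<iota> x = \<iota> y \<longleftrightarrow> x = y"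
  using \<iota>_eq_0_iff[of "x - y"] by (simp del: \<iota>_eq_0_iff)

lemma \<iota>_power [simp]: "\<iota> (x ^ k) = \<iota> x ^ k"
  by (induction k) simp_all

lemma \<iota>_of_nat [simp]: "\<iota> (of_nat k) = of_nat k"
  by (induction k) simp_all

lemma char_k: "CHAR('k) = p"
  by (rule CHAR_prime_field[OF card_k p(1)])

lemma char_l: "CHAR('l) = p"
proof -
  have "(of_nat p :: 'l) = \<iota> (of_nat p)" by (simp del: of_nat_CHAR)
  also have "\<dots> = 0" using of_nat_CHAR[where 'a = 'k] char_k by (simp del: \<iota>_of_nat of_nat_CHAR)
  finally have "CHAR('l) dvd p" by (simp add: of_nat_eq_0_iff_char_dvd)
  then show ?thesis using p(1) by (metis CHAR_not_1' One_nat_def prime_nat_iff)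
qed

lemma odd_p: "odd p"
  using p by (metis less_trans numeral_less_iff primes_dvd_imp_eq two_is_prime_nat less_irrefl semiring_norm(78) semiring_norm(77) less_num_simps)

lemma two: "(2::'k) \<noteq> 0"
proof
  assume "(2::'k) = 0"
  then have "of_nat 2 = (0::'k)" by simp
  then have "p dvd 2" unfolding of_nat_eq_0_iff_char_dvd char_k .
  then show False using p by (auto dest: dvd_imp_le)
qed

lemma e0: "e \<noteq> 0"
  using gen_e unfolding generates_units_def by (metis DiffD2 power_one_right rangeI singletonI)

lemma e_power_eq_1_iff: "e ^ k = 1 \<longleftrightarrow> p - 1 dvd k"
  using generates_units_power_eq_1_iff[OF gen_e] card_k by simp

lemma unit_e_power:
  assumes "x \<noteq> 0" obtains k where "x = e ^ k"
  using assms gen_e by (auto simp: generates_units_def)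

lemma fermat: "x \<noteq> 0 \<Longrightarrow> x ^ (p - 1) = (1::'k)"
proof -
  assume "x \<noteq> 0"
  then obtain k where "x = e ^ k" by (rule unit_e_power)
  then have "x ^ (p - 1) = e ^ ((p - 1) * k)" by (simp add: mult.commute flip: power_mult)
  then show ?thesis using e_power_eq_1_iff by simp
qed

lemma e_half: "e ^ ((p - 1) div 2) = - 1"
proof -
  have ev: "2 * ((p - 1) div 2) = p - 1" using odd_p by simp
  then have "(e ^ ((p - 1) div 2))\<^sup>2 = 1"
    using e_power_eq_1_iff[of "p - 1"] by (metis dvd_refl mult.commute power_mult)
  moreover have "\<not> p - 1 dvd (p - 1) div 2"
    using p ev by (auto dest!: dvd_imp_le)
  ultimately show ?thesis using e_power_eq_1_iff by (simp add: power2_eq_1_iff)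
qed

lemma minus_one_neq_one: "(- 1 :: 'k) \<noteq> 1"
  using two by (metis add_neg_numeral_special(7) one_add_one)

lemma e_not_square: "t\<^sup>2 \<noteq> e"
proof
  assume t: "t\<^sup>2 = e"
  then have "t \<noteq> 0" using e0 by auto
  have "e ^ ((p - 1) div 2) = t ^ (2 * ((p - 1) div 2))" by (simp add: power_mult t)
  also have "\<dots> = t ^ (p - 1)" using odd_p by simp
  finally show False using fermat[OF \<open>t \<noteq> 0\<close>] e_half minus_one_neq_one by simp
qed

text \<open>The parity of the exponent of \<open>e\<close> decides. Applied to discriminants, the
  three cases are a double root, the split torus and the non-split torus.\<close>

lemma nonsquare_cases:
  obtains "x = 0" | y where "x = y\<^sup>2" "y \<noteq> 0" | y where "x = e * y\<^sup>2" "y \<noteq> 0"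
proof (cases "x = 0")
  case False
  then obtain k where k: "x = e ^ k" by (rule unit_e_power)
  show ?thesis
  proof (cases "even k")
    case True
    then obtain j where "k = 2 * j" by (elim evenE)
    then have "x = (e ^ j)\<^sup>2" using k by (simp add: power_mult mult.commute)
    then show ?thesis using that(2) e0 by simp
  next
    case False
    then obtain j where "k = 2 * j + 1" by (elim oddE)
    then have "x = e * (e ^ j)\<^sup>2" using k by (simp add: power_mult mult.commute)
    then show ?thesis using that(3) e0 by simp
  qed
qed (use that in simp)

lemma ext_eq_iff: "\<iota> x + \<iota> y * s = \<iota> x' + \<iota> y' * s \<longleftrightarrow> x = x' \<and> y = y'"
proof
  assume eq: "\<iota> x + \<iota> y * s = \<iota> x' + \<iota> y' * s"
  have "y = y'"
  proof (rule ccontr)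
    assume "y \<noteq> y'"
    have "\<iota> (y - y') * s = \<iota> (x' - x)" using eq by (simp add: algebra_simps)
    then have "(\<iota> (y - y') * s)\<^sup>2 = (\<iota> (x' - x))\<^sup>2" by simp
    then have "\<iota> ((y - y')\<^sup>2 * e) = \<iota> ((x' - x)\<^sup>2)" by (simp add: power_mult_distrib s del: \<iota>_diff)
    then have "(y - y')\<^sup>2 * e = (x' - x)\<^sup>2" by (simp only: \<iota>_eq_iff)
    then have "((x' - x) / (y - y'))\<^sup>2 = e" using \<open>y \<noteq> y'\<close> by (simp add: power_divide field_simps)
    then show False using e_not_square by blast
  qed
  then show "x = x' \<and> y = y'" using eq by simp
qed simp

section \<open>The non-split torus as a quotient of the units of the quadratic extension\<close>

definition g :: 'l where "g = \<iota> w1 + \<iota> w2 * s"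

text \<open>Multiplication by x + y s in the basis 1, s of the extension; the determinant is the
  norm.\<close>

definition torus :: "'k \<Rightarrow> 'k \<Rightarrow> 'k^2^2" where "torus x y = matrix2 x (e * y) y x"

lemma g_power_eq_1_iff: "g ^ k = 1 \<longleftrightarrow> p\<^sup>2 - 1 dvd k"
  using generates_units_power_eq_1_iff[OF gen_w] card_l by (simp add: g_def)

lemma square_minus_one: "p\<^sup>2 - 1 = (p - 1) * (p + 1)"
  by (cases p) (simp_all add: power2_eq_square)

lemma g0: "g \<noteq> 0"
  using gen_w unfolding generates_units_def g_def by (metis DiffD2 power_one_right rangeI singletonI)

text \<open>A unit of the subfield is killed by the exponent p - 1, while \<open>g\<close> has order
  (p - 1)(p + 1).\<close>

lemma g_power_base_imp:
  assumes "g ^ k = \<iota> x" shows "p + 1 dvd k"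
proof -
  have "x \<noteq> 0" using assms g0 by auto
  then have "g ^ (k * (p - 1)) = \<iota> (x ^ (p - 1))" by (simp add: power_mult assms)
  then have "g ^ (k * (p - 1)) = 1" by (simp only: fermat[OF \<open>x \<noteq> 0\<close>] \<iota>_simps)
  then have "(p - 1) * (p + 1) dvd (p - 1) * k"
    unfolding g_power_eq_1_iff square_minus_one by (simp only: mult.commute[of k])
  moreover have "p - 1 \<noteq> 0" using p by simp
  ultimately show ?thesis by (simp only: nat_mult_dvd_cancel1)
qed

lemma w2: "w2 \<noteq> 0"
proof
  assume "w2 = 0"
  then have "g ^ 1 = \<iota> w1" unfolding g_def by simp
  then have "p + 1 dvd 1" by (rule g_power_base_imp)
  then show False using p by simp
qed

text \<open>The Frobenius map sends \<open>s\<close> to \<open>- s\<close>, because \<open>e\<close>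
  to the power (p - 1)/2 is -1. So \<open>g ^ p\<close> is the conjugate of \<open>g\<close>, and
  \<open>g ^ (p + 1)\<close> is its norm.\<close>

lemma g_power_norm: "g ^ (p + 1) = \<iota> (w1\<^sup>2 - e * w2\<^sup>2)"
proof -
  have base: "\<iota> x ^ p = \<iota> x" for x
  proof (cases "x = 0")
    case False
    have "p = Suc (p - 1)" using p by simp
    then have "x ^ p = x * x ^ (p - 1)" by (metis power_Suc)
    then have "x ^ p = x" using fermat[OF False] by simp
    then show ?thesis by (simp flip: \<iota>_power)
  qed (use p in simp)
  have "p = Suc (2 * ((p - 1) div 2))" using odd_p p by simp
  then have "s ^ p = s * (s\<^sup>2) ^ ((p - 1) div 2)" by (metis power_Suc power_mult)
  also have "\<dots> = s * \<iota> (e ^ ((p - 1) div 2))" by (simp add: s)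
  finally have sp: "s ^ p = - s" unfolding e_half by simp
  have "g ^ p = (\<iota> w1) ^ p + (\<iota> w2 * s) ^ p"
    unfolding g_def using char_l p by (intro freshmans_dream) simp_all
  then have "g ^ p = \<iota> w1 - \<iota> w2 * s" by (simp add: base sp power_mult_distrib)
  then have "g ^ (p + 1) = (\<iota> w1 - \<iota> w2 * s) * (\<iota> w1 + \<iota> w2 * s)" by (simp add: g_def)
  then show ?thesis by (simp add: algebra_simps power2_eq_square flip: s)
qed

lemma det_torus: "x \<noteq> 0 \<or> y \<noteq> 0 \<Longrightarrow> det (torus x y) \<noteq> 0"
proof
  assume xy: "x \<noteq> 0 \<or> y \<noteq> 0" and "det (torus x y) = 0"
  then have *: "x\<^sup>2 = e * y\<^sup>2" by (simp add: torus_def power2_eq_square mult_ac)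
  show False
  proof (cases "y = 0")
    case False
    then have "(x / y)\<^sup>2 = e" using * by (simp add: power_divide)
    then show ?thesis using e_not_square by blast
  qed (use xy * in simp)
qed

text \<open>Scaled by \<open>w2\<close> relative to the matrix of \<open>gamma_pgl\<close>, which is
  the same class, so that matrix powers follow the field powers of \<open>g\<close>.\<close>

definition \<gamma> :: "('k^2^2) set" where "\<gamma> = pgl (torus w1 w2)"

lemma gamma_pgl_eq: "gamma_pgl e (w1 / w2) = \<gamma>"
proof -
  have "torus w1 w2 = mat w2 ** matrix2 (w1 / w2) e 1 (w1 / w2)"
    using w2 by (simp add: torus_def mult.commute)
  then show ?thesis by (simp only: \<gamma>_def gamma_pgl_def pgl_mat_mult[OF w2])
qed

lemma \<gamma>_closed [simp]: "\<gamma> \<in> carrier PGL2"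
  using w2 by (simp add: \<gamma>_def det_torus)

lemma \<gamma>_pow_iff:
  assumes "g ^ k = \<iota> x + \<iota> y * s"
  shows "\<gamma> [^]\<^bsub>PGL2\<^esub> k = pgl (torus x y)"
  using assms
proof (induction k arbitrary: x y)
  case 0
  then have "\<iota> x + \<iota> y * s = \<iota> 1 + \<iota> 0 * s" by simp
  then have "x = 1" "y = 0" unfolding ext_eq_iff by auto
  then show ?case by (simp add: torus_def one_PGL2 mat_eq_matrix2)
next
  case (Suc k)
  define N where "N = w1\<^sup>2 - e * w2\<^sup>2"
  have N: "N \<noteq> 0" using det_torus[of w1 w2] w2 by (simp add: N_def torus_def power2_eq_square mult_ac)
  \<comment> \<open>\<open>a\<close> and \<open>b\<close> are the coordinates of (x + y s)/g:
    multiply by the conjugate of \<open>g\<close> and divide by its norm \<open>N\<close>.\<close>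
  define a where "a = (x * w1 - e * y * w2) / N"
  define b where "b = (y * w1 - x * w2) / N"
  have "w1 * a + e * w2 * b = x" "w2 * a + w1 * b = y"
    using N by (simp_all add: a_def b_def N_def divide_simps) (simp_all add: algebra_simps power2_eq_square)
  then have xy: "x = w1 * a + e * w2 * b" "y = w2 * a + w1 * b" by auto
  have "g * (\<iota> a + \<iota> b * s) = \<iota> x + \<iota> y * s"
    unfolding xy by (simp add: g_def algebra_simps power2_eq_square flip: s)
  then have "g ^ k = \<iota> a + \<iota> b * s" using Suc.prems g0 by (metis mult_cancel_left power_Suc)
  moreover have "a \<noteq> 0 \<or> b \<noteq> 0" using calculation g0 by auto
  moreover have "torus a b ** torus w1 w2 = torus x y"
    unfolding xy by (simp add: torus_def algebra_simps)
  ultimately show ?case using Suc.IH w2 by (simp add: \<gamma>_def pgl_mult det_torus)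
qed

lemma ext_cases: obtains x y where "z = \<iota> x + \<iota> y * s"
proof -
  have "inj (\<lambda>(x, y). \<iota> x + \<iota> y * s)" by (auto simp: inj_on_def ext_eq_iff)
  then have "card (range (\<lambda>(x, y). \<iota> x + \<iota> y * s)) = CARD('l)"
    by (simp add: card_image card_k card_l power2_eq_square card_prod)
  then have "range (\<lambda>(x, y). \<iota> x + \<iota> y * s) = UNIV" by (intro card_subset_eq) auto
  then have "z \<in> range (\<lambda>(x, y). \<iota> x + \<iota> y * s)" by simp
  then show ?thesis using that by auto
qed

lemma \<gamma>_pow:
  obtains x y where "x \<noteq> 0 \<or> y \<noteq> 0" "g ^ k = \<iota> x + \<iota> y * s" "\<gamma> [^]\<^bsub>PGL2\<^esub> k = pgl (torus x y)"
proof -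
  obtain x y where xy: "g ^ k = \<iota> x + \<iota> y * s" by (rule ext_cases)
  then have "x \<noteq> 0 \<or> y \<noteq> 0" using g0 by auto
  then show ?thesis using that xy \<gamma>_pow_iff by blast
qed

lemma torus_eq_\<gamma>_pow:
  assumes "x \<noteq> 0 \<or> y \<noteq> 0" obtains k where "pgl (torus x y) = \<gamma> [^]\<^bsub>PGL2\<^esub> (k::nat)"
proof -
  have "\<iota> x + \<iota> y * s \<noteq> \<iota> 0 + \<iota> 0 * s" unfolding ext_eq_iff using assms by simp
  then have "\<iota> x + \<iota> y * s \<in> range (\<lambda>i::nat. g ^ i)"
    using gen_w by (simp add: generates_units_def g_def)
  then show ?thesis using \<gamma>_pow_iff that by (metis imageE)
qed

text \<open>A power of \<open>\<gamma>\<close> is trivial exactly when the same power of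
  \<open>g\<close> lies in the subfield.\<close>

lemma \<gamma>_pow_eq_1_iff: "\<gamma> [^]\<^bsub>PGL2\<^esub> k = \<one>\<^bsub>PGL2\<^esub> \<longleftrightarrow> p + 1 dvd k"
proof
  assume "\<gamma> [^]\<^bsub>PGL2\<^esub> k = \<one>\<^bsub>PGL2\<^esub>"
  moreover obtain x y where xy: "x \<noteq> 0 \<or> y \<noteq> 0" "g ^ k = \<iota> x + \<iota> y * s" "\<gamma> [^]\<^bsub>PGL2\<^esub> k = pgl (torus x y)"
    by (rule \<gamma>_pow)
  ultimately have "y = 0" using det_torus by (auto simp: pgl_scalar_iff torus_def mat_eq_matrix2)
  then show "p + 1 dvd k" using xy g_power_base_imp[of k x] by simp
next
  assume "p + 1 dvd k"
  then obtain q where "k = (p + 1) * q" by (elim dvdE)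
  then have "g ^ k = \<iota> ((w1\<^sup>2 - e * w2\<^sup>2) ^ q) + \<iota> 0 * s" by (simp only: power_mult g_power_norm \<iota>_power) simp
  then have k: "\<gamma> [^]\<^bsub>PGL2\<^esub> k = pgl (torus ((w1\<^sup>2 - e * w2\<^sup>2) ^ q) 0)" by (rule \<gamma>_pow_iff)
  have "(w1\<^sup>2 - e * w2\<^sup>2) ^ q \<noteq> 0"
    using det_torus[of w1 w2] w2 by (simp add: torus_def power2_eq_square mult_ac)
  then show "\<gamma> [^]\<^bsub>PGL2\<^esub> k = \<one>\<^bsub>PGL2\<^esub>"
    unfolding k by (subst pgl_scalar_iff) (auto simp: torus_def mat_eq_matrix2)
qed

section \<open>The split torus, and conjugacy of elements into one of the two tori\<close>

definition \<alpha> :: "('k^2^2) set" where "\<alpha> = alpha_pgl e"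

lemma \<alpha>_closed [simp]: "\<alpha> \<in> carrier PGL2"
  using e0 by (simp add: \<alpha>_def alpha_pgl_def)

lemma \<alpha>_pow: "\<alpha> [^]\<^bsub>PGL2\<^esub> (k::nat) = pgl (matrix2 (e ^ k) 0 0 1)"
  using e0 by (simp add: \<alpha>_def alpha_pgl_def diag_pow)

lemma \<alpha>_pow_eq_1_iff: "\<alpha> [^]\<^bsub>PGL2\<^esub> k = \<one>\<^bsub>PGL2\<^esub> \<longleftrightarrow> p - 1 dvd k"
proof -
  have "\<alpha> [^]\<^bsub>PGL2\<^esub> k = \<one>\<^bsub>PGL2\<^esub> \<longleftrightarrow> e ^ k = 1"
    unfolding \<alpha>_pow using e0 by (subst pgl_scalar_iff) (auto simp: mat_eq_matrix2)
  then show ?thesis by (simp only: e_power_eq_1_iff)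
qed

text \<open>The discriminant of the characteristic polynomial is zero, a nonzero square or a
  nonsquare. The case of a double root is left as it is: for elements of order p it is the desired
  outcome, and for \<open>\<sigma>\<close> it is excluded by parity of the order.\<close>

lemma conj_cases:
  assumes "det B \<noteq> 0"
  obtains "(trace B)\<^sup>2 = 4 * det B"
  | \<sigma> k where "\<sigma> \<in> carrier PGL2" "\<sigma> \<otimes>\<^bsub>PGL2\<^esub> pgl B \<otimes>\<^bsub>PGL2\<^esub> inv\<^bsub>PGL2\<^esub> \<sigma> = \<alpha> [^]\<^bsub>PGL2\<^esub> (k::nat)"
  | \<sigma> k where "\<sigma> \<in> carrier PGL2" "\<sigma> \<otimes>\<^bsub>PGL2\<^esub> pgl B \<otimes>\<^bsub>PGL2\<^esub> inv\<^bsub>PGL2\<^esub> \<sigma> = \<gamma> [^]\<^bsub>PGL2\<^esub> (k::nat)"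
proof (rule nonsquare_cases[of "(trace B)\<^sup>2 - 4 * det B"])
  fix r assume "(trace B)\<^sup>2 - 4 * det B = r\<^sup>2" "r \<noteq> 0"
  then obtain C and a b :: 'k where C: "det C \<noteq> 0" "a \<noteq> 0" "b \<noteq> 0" "C ** B = matrix2 a 0 0 b ** C"
    using split_conj[OF assms _ _ two] by metis
  \<comment> \<open>Only the ratio of the eigenvalues survives in \<open>PGL2\<close>.\<close>
  obtain k where k: "a / b = e ^ k" using C by (metis divide_eq_0_iff unit_e_power)
  have "matrix2 a 0 0 b = mat b ** matrix2 (a / b) 0 0 1" using C by simp
  then have "pgl (matrix2 a 0 0 b) = \<alpha> [^]\<^bsub>PGL2\<^esub> k" unfolding \<alpha>_pow by (simp only: k pgl_mat_mult[OF C(3)])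
  then show ?thesis using that(2)[of "pgl C" k] pgl_conj_eqI[OF C(1) assms C(4)] C(1) by simp
next
  fix r assume r: "(trace B)\<^sup>2 - 4 * det B = e * r\<^sup>2" "r \<noteq> 0"
  \<comment> \<open>\<open>nonsplit_conj\<close> expects the discriminant in the form
    \<open>4 * (e * y\<^sup>2)\<close>, hence \<open>y = r / 2\<close>.\<close>
  have "e * (2 * (r / 2))\<^sup>2 = 4 * (e * (r / 2)\<^sup>2)" unfolding power_mult_distrib by simp
  then have "(trace B)\<^sup>2 - 4 * det B = 4 * (e * (r / 2)\<^sup>2)" using r(1) two by simp
  then obtain C x where C: "det C \<noteq> 0" "C ** B = torus x (r / 2) ** C"
    using nonsplit_conj[OF assms _ _ e0 e_not_square two, of "r / 2"] r two unfolding torus_def by auto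
  obtain k where "pgl (torus x (r / 2)) = \<gamma> [^]\<^bsub>PGL2\<^esub> (k::nat)"
    using torus_eq_\<gamma>_pow[of x "r / 2"] r two by auto
  then show ?thesis using that(3)[of "pgl C" k] pgl_conj_eqI[OF C(1) assms C(2)] C(1) by simp
qed (use that in simp)

text \<open>The invariant of diag(a, 1) is (a + 1)^2/a, and two nonzero values share it only if they
  are equal or mutually inverse.\<close>

lemma \<alpha>_pow_conj:
  assumes "\<sigma> \<in> carrier PGL2"
    and "\<sigma> \<otimes>\<^bsub>PGL2\<^esub> \<alpha> [^]\<^bsub>PGL2\<^esub> (j::nat) \<otimes>\<^bsub>PGL2\<^esub> inv\<^bsub>PGL2\<^esub> \<sigma> = \<alpha> [^]\<^bsub>PGL2\<^esub> (k::nat)"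
  shows "\<alpha> [^]\<^bsub>PGL2\<^esub> k = \<alpha> [^]\<^bsub>PGL2\<^esub> j \<or> \<alpha> [^]\<^bsub>PGL2\<^esub> k \<otimes>\<^bsub>PGL2\<^esub> \<alpha> [^]\<^bsub>PGL2\<^esub> j = \<one>\<^bsub>PGL2\<^esub>"
proof -
  define a b where "a = e ^ j" "b = e ^ k"
  have ab: "a \<noteq> 0" "b \<noteq> 0" using e0 by (simp_all add: a_b_def)
  have "(b + 1)\<^sup>2 * a = (a + 1)\<^sup>2 * b"
    using pgl_conj_invariant[OF assms(1) _ assms(2)[unfolded \<alpha>_pow]] ab by (simp add: a_b_def)
  then have "(b - a) * (b * a - 1) = 0" by (simp add: algebra_simps power2_eq_square)
  then have "b = a \<or> b * a = 1" by auto
  then show ?thesis unfolding \<alpha>_pow using ab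
    by (auto simp: pgl_mult one_PGL2 mat_eq_matrix2 simp flip: a_b_def)
qed

text \<open>The invariant 4x^2/(x^2 - e y^2) determines the ratio of \<open>x\<close> and
  \<open>y\<close> up to sign. Changing the sign is conjugation in the quadratic extension, which
  modulo scalars is inversion.\<close>

lemma \<gamma>_pow_conj:
  assumes "\<sigma> \<in> carrier PGL2"
    and "\<sigma> \<otimes>\<^bsub>PGL2\<^esub> \<gamma> [^]\<^bsub>PGL2\<^esub> (j::nat) \<otimes>\<^bsub>PGL2\<^esub> inv\<^bsub>PGL2\<^esub> \<sigma> = \<gamma> [^]\<^bsub>PGL2\<^esub> (k::nat)"
  shows "\<gamma> [^]\<^bsub>PGL2\<^esub> k = \<gamma> [^]\<^bsub>PGL2\<^esub> j \<or> \<gamma> [^]\<^bsub>PGL2\<^esub> k \<otimes>\<^bsub>PGL2\<^esub> \<gamma> [^]\<^bsub>PGL2\<^esub> j = \<one>\<^bsub>PGL2\<^esub>"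
proof -
  obtain x y where xy: "x \<noteq> 0 \<or> y \<noteq> 0" "\<gamma> [^]\<^bsub>PGL2\<^esub> j = pgl (torus x y)" using \<gamma>_pow by metis
  obtain x' y' where xy': "x' \<noteq> 0 \<or> y' \<noteq> 0" "\<gamma> [^]\<^bsub>PGL2\<^esub> k = pgl (torus x' y')" using \<gamma>_pow by metis
  have "(2 * x')\<^sup>2 * (x\<^sup>2 - e * y\<^sup>2) = (2 * x)\<^sup>2 * (x'\<^sup>2 - e * y'\<^sup>2)"
    using pgl_conj_invariant[OF assms(1) det_torus[OF xy(1)] assms(2)[unfolded xy xy']]
    by (simp add: torus_def power2_eq_square mult_ac)
  moreover have "2\<^sup>2 * e * ((x' * y)\<^sup>2 - (x * y')\<^sup>2)
      = (2 * x)\<^sup>2 * (x'\<^sup>2 - e * y'\<^sup>2) - (2 * x')\<^sup>2 * (x\<^sup>2 - e * y\<^sup>2)"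
    by (simp add: algebra_simps power2_eq_square)
  ultimately have "2\<^sup>2 * e * ((x' * y)\<^sup>2 - (x * y')\<^sup>2) = 0" by (simp only: diff_self)
  moreover have "(2::'k)\<^sup>2 * e \<noteq> 0" using two e0 by (metis mult_eq_0_iff power_not_zero)
  ultimately have "(x' * y)\<^sup>2 - (x * y')\<^sup>2 = 0" by (metis mult_eq_0_iff)
  then have "(x' * y)\<^sup>2 = (x * y')\<^sup>2" by (simp only: right_minus_eq)
  then consider "x' * y = x * y'" | "x' * y = - (x * y')" by (auto simp: power2_eq_iff)
  then show ?thesis
  proof cases
    case 1
    define c where "c = (if x = 0 then y' / y else x' / x)"
    have "torus x' y' = mat c ** torus x y" "c \<noteq> 0"
      using 1 xy(1) xy'(1) by (auto simp: c_def torus_def field_simps)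
    then show ?thesis unfolding xy xy' by (simp add: pgl_mat_mult)
  next
    case 2
    then have "torus x' y' ** torus x y = mat (x' * x + e * y' * y)"
      by (simp add: torus_def mat_eq_matrix2 algebra_simps)
    moreover have "det (torus x' y' ** torus x y) \<noteq> 0" using det_torus xy xy' by (simp add: det_mul)
    ultimately have "pgl (torus x' y' ** torus x y) = \<one>\<^bsub>PGL2\<^esub>" using pgl_scalar_iff by metis
    then show ?thesis unfolding xy xy' using det_torus xy(1) xy'(1) by (simp add: pgl_mult)
  qed
qed

end


section \<open>Automorphisms of PSL(2, p)\<close>

lemma (in group) conj_nat_pow:
  assumes "x \<in> carrier G" "y \<in> carrier G"
  shows "(x \<otimes> y \<otimes> inv x) [^] (k::nat) = x \<otimes> y [^] k \<otimes> inv x"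
proof (induction k)
  case (Suc k)
  have "inv x \<otimes> (x \<otimes> (y \<otimes> inv x)) = y \<otimes> inv x" using assms by (simp flip: m_assoc)
  moreover have "(x \<otimes> y \<otimes> inv x) [^] Suc k = (x \<otimes> y [^] k \<otimes> inv x) \<otimes> (x \<otimes> y \<otimes> inv x)"
    by (simp only: nat_pow_Suc Suc)
  ultimately show ?case using assms by (simp add: m_assoc)
qed (use assms in simp)

lemma (in group) conj_eq_one_iff:
  assumes "x \<in> carrier G" "y \<in> carrier G"
  shows "x \<otimes> y \<otimes> inv x = \<one> \<longleftrightarrow> y = \<one>"
proof
  assume "x \<otimes> y \<otimes> inv x = \<one>"
  then have "x \<otimes> y = x" using assms inv_solve_right'[of "\<one>" "x \<otimes> y" x] by simp
  then show "y = \<one>" using assms by simp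
qed (use assms in simp)

lemma (in group) ord_conj:
  assumes "x \<in> carrier G" "y \<in> carrier G"
  shows "ord (x \<otimes> y \<otimes> inv x) = ord y"
  by (rule ord_unique[THEN iffD2])
    (use assms in \<open>simp_all add: conj_nat_pow conj_eq_one_iff pow_eq_id\<close>)

text \<open>If \<open>c \<noteq> 0\<close> the matrix is a product upper - lower - upper of
  unipotents. If \<open>c = 0\<close>, adding the second column to the first puts
  \<open>d \<noteq> 0\<close> in the lower left corner, which reduces to that case.\<close>

lemma SL2_induct:
  fixes A :: "'k::field^2^2"
  assumes mult: "\<And>A B. det A = 1 \<Longrightarrow> det B = 1 \<Longrightarrow> P A \<Longrightarrow> P B \<Longrightarrow> P (A ** B)"
    and upper: "\<And>b. P (matrix2 1 b 0 1)" and lower: "\<And>c. P (matrix2 1 0 c 1)"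
    and A: "det A = 1"
  shows "P A"
proof -
  have nz: "P (matrix2 a b c d)" if "c \<noteq> 0" "a * d - b * c = 1" for a b c d
  proof -
    define r where "r = (a - 1) / c"
    define q where "q = (d - 1) / c"
    have rq: "r * c = a - 1" "c * q = d - 1" using that(1) by (simp_all add: r_def q_def)
    have "(a * q + r) * c = a * (c * q) + r * c" by (simp add: algebra_simps)
    also have "\<dots> = b * c" using that(2) unfolding rq by (simp add: algebra_simps)
    finally have "a * q + r = b" using that(1) by simp
    then have "matrix2 1 r 0 1 ** matrix2 1 0 c 1 ** matrix2 1 q 0 1 = matrix2 a b c d"
      using rq by simp
    moreover have "P (matrix2 1 r 0 1 ** matrix2 1 0 c 1 ** matrix2 1 q 0 1)"
      by (intro mult upper lower) (simp_all add: det_mul)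
    ultimately show ?thesis by (simp only:)
  qed
  obtain a b c d where 1: "A = matrix2 a b c d" by (rule matrix2_cases)
  show ?thesis
  proof (cases "c = 0")
    case True
    then have d: "d \<noteq> 0" "a * d = 1" using A 1 by auto
    have "P (matrix2 (a + b) b d d)" by (rule nz) (use d in \<open>simp_all add: algebra_simps\<close>)
    then have "P (matrix2 (a + b) b d d ** matrix2 1 0 (- 1) 1)"
      using d by (intro mult lower) (simp_all add: algebra_simps)
    then show ?thesis using 1 True by simp
  qed (use nz A 1 in simp)
qed

text \<open>Serves to show that the connection set would lie in a proper subgroup. The property is
  one of matrices, so it has to be stable under sign; inverses of generators are covered because
  \<open>\<Omega>\<close> is closed under inversion.\<close>

lemma generate_PSL2_induct:
  fixes A :: "'k::field^2^2"
  assumes data: "cayley_map_data PSL2 \<Omega> \<rho>"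
    and one: "P (mat 1)" and neg: "\<And>A. P A \<Longrightarrow> P (- A)"
    and mult: "\<And>A B. det A = 1 \<Longrightarrow> det B = 1 \<Longrightarrow> P A \<Longrightarrow> P B \<Longrightarrow> P (A ** B)"
    and \<Omega>: "\<And>A. det A = 1 \<Longrightarrow> psl A \<in> \<Omega> \<Longrightarrow> P A" and A: "det A = 1"
  shows "P A"
proof -
  have gen: "generate PSL2 \<Omega> = carrier PSL2" and sub: "\<Omega> \<subseteq> carrier PSL2"
    and invs: "m_inv PSL2 ` \<Omega> = \<Omega>"
    using data by (simp_all add: cayley_map_data_def)
  have "\<omega> \<in> carrier PSL2 \<and> (\<forall>A. det A = 1 \<longrightarrow> psl A = \<omega> \<longrightarrow> P A)" if "\<omega> \<in> generate PSL2 \<Omega>" for \<omega>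
    using that
  proof (induction rule: generate.induct)
    case one
    then show ?case using assms(2) neg by (auto simp: one_PSL2 psl_eq_iff)
  next
    case (incl \<omega>)
    then show ?case using \<Omega> sub by blast
  next
    case (inv \<omega>)
    then have "inv\<^bsub>PSL2\<^esub> \<omega> \<in> \<Omega>" using invs by blast
    then show ?case using \<Omega> sub by (metis subsetD)
  next
    case (eng \<omega>1 \<omega>2)
    obtain A1 where A1: "\<omega>1 = psl A1" "det A1 = 1" using psl_cases eng by metis
    obtain A2 where A2: "\<omega>2 = psl A2" "det A2 = 1" using psl_cases eng by metis
    have "P (A1 ** A2)" using mult eng A1 A2 by auto
    then have "P A" if "psl A = psl (A1 ** A2)" for A using that neg by (auto simp: psl_eq_iff)
    then show ?case using A1 A2 by (simp add: psl_mult det_mul)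
  qed
  then show ?thesis using gen A psl_closed[OF A] by blast
qed

context quadratic_extension
begin

lemma ord_\<alpha>_pow_dvd: "PGL2.ord (\<alpha> [^]\<^bsub>PGL2\<^esub> (k::nat)) dvd p - 1"
  by (subst PGL2.pow_eq_id[symmetric]) (simp_all add: PGL2.nat_pow_pow \<alpha>_pow_eq_1_iff)

lemma ord_\<gamma>_pow_dvd: "PGL2.ord (\<gamma> [^]\<^bsub>PGL2\<^esub> (k::nat)) dvd p + 1"
  by (subst PGL2.pow_eq_id[symmetric]) (simp_all only: \<gamma>_closed PGL2.nat_pow_closed PGL2.nat_pow_pow \<gamma>_pow_eq_1_iff dvd_triv_right)

text \<open>Both tori have order prime to p, namely p - 1 and p + 1, so an element of order p must
  have a double eigenvalue.\<close>

lemma order_p_trace: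
  fixes A :: "'k^2^2"
  assumes A: "det A = 1" and pow: "psl A [^]\<^bsub>PSL2\<^esub> p = \<one>\<^bsub>PSL2\<^esub>" and ne: "psl A \<noteq> \<one>\<^bsub>PSL2\<^esub>"
  shows "(trace A)\<^sup>2 = 4"
proof -
  have detA: "det A \<noteq> 0" using A by simp
  obtain X where "psl A [^]\<^bsub>PSL2\<^esub> p = psl X" "pgl A [^]\<^bsub>PGL2\<^esub> p = pgl X"
    using psl_pow_pgl_pow[OF A] by metis
  then have dvd_p: "PGL2.ord (pgl A) dvd p"
    using psl_one_imp_pgl_one[of X] pow detA by (metis PGL2.pow_eq_id pgl_closed)
  have no: False if "PGL2.ord (pgl A) dvd q" "coprime p q" for q
  proof -
    have "PGL2.ord (pgl A) = 1" using dvd_p that by (metis coprime_common_divisor_nat nat_dvd_1_iff_1 coprime_def)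
    then have "pgl A = \<one>\<^bsub>PGL2\<^esub>" using PGL2.ord_eq_1[OF pgl_closed[OF detA]] by simp
    then show False using ne A pgl_one_imp_psl_one by blast
  qed
  have co: "coprime p (p - 1)" "coprime p (p + 1)"
    using p(2) coprime_diff_one_right_nat[of p] by simp_all
  show ?thesis
    using detA
  proof (cases rule: conj_cases)
    case 1
    then show ?thesis using A by simp
  next
    case (2 \<sigma> k)
    have "PGL2.ord (pgl A) dvd p - 1"
      using PGL2.ord_conj[OF 2(1) pgl_closed[OF detA]] 2(2) ord_\<alpha>_pow_dvd[of k] by simp
    then show ?thesis using no co by blast
  next
    case (3 \<sigma> k)
    have "PGL2.ord (pgl A) dvd p + 1"
      using PGL2.ord_conj[OF 3(1) pgl_closed[OF detA]] 3(2) ord_\<gamma>_pow_dvd[of k] by simp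
    then show ?thesis using no co by blast
  qed
qed

text \<open>Isomorphisms preserve order p, which forces trace 2 or -2; the sign of the
  representative is chosen to make it 2.\<close>

lemma order_p_image:
  fixes \<theta> :: "('k^2^2) set \<Rightarrow> ('k^2^2) set"
  assumes \<theta>: "\<theta> \<in> iso PSL2 PSL2" and X: "det X = 1" "psl X [^]\<^bsub>PSL2\<^esub> p = \<one>\<^bsub>PSL2\<^esub>" "psl X \<noteq> \<one>\<^bsub>PSL2\<^esub>"
  obtains A :: "'k^2^2" where "det A = 1" "trace A = 2" "A \<noteq> mat 1" "\<theta> (psl X) = psl A"
proof -
  interpret group_hom PSL2 PSL2 \<theta> using \<theta> by unfold_locales (auto simp: iso_def)
  have inj: "inj_on \<theta> (carrier PSL2)" using \<theta> by (auto simp: iso_def bij_betw_def)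
  obtain A where A: "\<theta> (psl X) = psl A" "det A = 1" using psl_cases[of "\<theta> (psl X)"] X by auto
  have ne: "psl A \<noteq> \<one>\<^bsub>PSL2\<^esub>"
    using inj_onD[OF inj, of "psl X" "\<one>\<^bsub>PSL2\<^esub>"] X A by auto
  moreover have "psl A [^]\<^bsub>PSL2\<^esub> p = \<one>\<^bsub>PSL2\<^esub>"
    using X A hom_nat_pow[of "psl X" p] by simp
  ultimately have "(trace A)\<^sup>2 = 2\<^sup>2" using order_p_trace[OF A(2)] by simp
  then have "trace A = 2 \<or> trace A = - 2" by (simp only: power2_eq_iff)
  moreover have "A \<noteq> mat 1" "- A \<noteq> mat 1" using ne by (metis one_PSL2 psl_uminus)+
  ultimately show ?thesis using that[of A] that[of "- A"] A by auto
qed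

text \<open>
  The image of the class of \<open>(1 1; 0 1)\<close> is unipotent, so it may be assumed to be fixed; then
  that of \<open>(1 0; 1 1)\<close> may be assumed to be the class of \<open>(1 0; c 1)\<close>. That
  \<open>(1 1; 0 1) (1 0; -1 1) (1 1; 0 1)\<close> is an involution of PSL(2) forces \<open>c = 1\<close>.
\<close>

theorem automorphism_PSL2:
  fixes \<theta> :: "('k^2^2) set \<Rightarrow> ('k^2^2) set"
  assumes \<theta>: "\<theta> \<in> iso PSL2 PSL2"
  obtains \<sigma> where "\<sigma> \<in> carrier PGL2" "\<And>\<omega>. \<omega> \<in> carrier PSL2 \<Longrightarrow> \<theta> \<omega> = conj_action \<sigma> \<omega>"
proof -
  let ?u = "matrix2 1 1 0 1 :: 'k^2^2" and ?v = "matrix2 1 0 1 1 :: 'k^2^2"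
  define U V where "U = psl ?u" "V = psl ?v"
  have UV [simp]: "U \<in> carrier PSL2" "V \<in> carrier PSL2" by (simp_all add: U_V_def)
  have p0: "(of_nat p :: 'k) = 0" using char_k by (metis of_nat_CHAR)
  have ne: "psl ?u \<noteq> \<one>\<^bsub>PSL2\<^esub>" "psl ?v \<noteq> \<one>\<^bsub>PSL2\<^esub>"
    by (simp_all add: one_PSL2 psl_eq_iff mat_eq_matrix2)
  have up: "psl ?u [^]\<^bsub>PSL2\<^esub> p = \<one>\<^bsub>PSL2\<^esub>"
    using unipotent_psl_pow[of "1::'k" p] p0 by (simp add: one_PSL2 mat_eq_matrix2)
  have vp: "psl ?v [^]\<^bsub>PSL2\<^esub> p = \<one>\<^bsub>PSL2\<^esub>"
    using unipotent_psl_pow'[of "1::'k" p] p0 by (simp add: one_PSL2 mat_eq_matrix2)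
  obtain A where A: "det A = 1" "trace A = 2" "A \<noteq> mat 1" "\<theta> U = psl A"
    using order_p_image[OF \<theta> _ up ne(1)] by (auto simp: U_V_def)
  obtain C where C: "det C \<noteq> 0" "C ** A = ?u ** C" using unipotent_conj[OF A(1-3)] by metis
  define \<theta>1 where "\<theta>1 = conj_action (pgl C) \<circ> \<theta>"
  have \<theta>1: "\<theta>1 \<in> iso PSL2 PSL2"
    unfolding \<theta>1_def by (rule iso_set_trans[OF \<theta> conj_action_iso]) (simp add: C(1))
  have \<theta>1U: "\<theta>1 U = U" unfolding \<theta>1_def o_apply A(4) conj_action_psl_eqI[OF C] by (simp add: U_V_def)
  obtain A2 where A2: "det A2 = 1" "trace A2 = 2" "\<theta>1 V = psl A2"
    using order_p_image[OF \<theta>1 _ vp ne(2)] by (auto simp: U_V_def)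
  obtain a b c d where m: "A2 = matrix2 a b c d" by (rule matrix2_cases)
  have d: "d = 2 - a" using A2(2) m by (simp add: algebra_simps)
  have bc: "b * c = (1 - a) * (a - 1)" using A2(1) m d by (simp add: algebra_simps)
  \<comment> \<open>With \<open>c = 0\<close> the image of \<open>V\<close> would commute with
    \<open>U\<close>, the image of \<open>U\<close>, although \<open>V\<close> and \<open>U\<close>
    do not commute.\<close>
  have "c \<noteq> 0"
  proof
    assume "c = 0"
    then have "a = 1" using bc by simp
    then have "psl A2 \<otimes>\<^bsub>PSL2\<^esub> U = U \<otimes>\<^bsub>PSL2\<^esub> psl A2"
      using A2(1) unfolding U_V_def m d \<open>c = 0\<close> by (simp add: psl_mult add.commute)
    then have "\<theta>1 (V \<otimes>\<^bsub>PSL2\<^esub> U) = \<theta>1 (U \<otimes>\<^bsub>PSL2\<^esub> V)"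
      using \<theta>1 \<theta>1U A2(3) by (simp add: iso_def hom_def)
    then have "V \<otimes>\<^bsub>PSL2\<^esub> U = U \<otimes>\<^bsub>PSL2\<^esub> V"
      using \<theta>1 by (auto simp: iso_def bij_betw_def dest: inj_onD)
    then have "psl (matrix2 1 1 1 2) = psl (matrix2 2 1 1 (1::'k))"
      by (simp add: U_V_def psl_mult)
    moreover have "(1::'k) \<noteq> 2" using one_add_one by (metis add_cancel_left_left zero_neq_one)
    ultimately have "(1::'k) = - 1" by (simp add: psl_eq_iff)
    then show False using minus_one_neq_one by simp
  qed
  \<comment> \<open>Conjugation by \<open>matrix2 1 t 0 1\<close> fixes \<open>U\<close>; this
    \<open>t\<close> makes the upper left entry of the image of \<open>V\<close> equal to 1, and
    trace and determinant then settle the other diagonal entry and the corner.\<close>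
  define t where "t = (1 - a) / c"
  have t: "t * c = 1 - a" using \<open>c \<noteq> 0\<close> by (simp add: t_def)
  have "b * c = t * c * (a - 1)" unfolding bc t ..
  also have "\<dots> = t * (a - 1) * c" by (simp add: mult_ac)
  finally have "b * c = t * (a - 1) * c" .
  then have b: "b = t * (a - 1)" using \<open>c \<noteq> 0\<close> by simp
  define \<theta>2 where "\<theta>2 = conj_action (pgl (matrix2 1 t 0 1)) \<circ> \<theta>1"
  have \<theta>2: "\<theta>2 \<in> iso PSL2 PSL2"
    unfolding \<theta>2_def by (rule iso_set_trans[OF \<theta>1 conj_action_iso]) simp
  then interpret \<theta>2: group_hom PSL2 PSL2 \<theta>2 by unfold_locales (auto simp: iso_def)
  have \<theta>2U: "\<theta>2 U = U"
    unfolding \<theta>2_def o_apply \<theta>1U unfolding U_V_def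
    by (rule conj_action_psl_eqI) (simp_all add: algebra_simps)
  have \<theta>2V: "\<theta>2 V = psl (matrix2 1 0 c 1)"
    unfolding \<theta>2_def o_apply A2(3) m d
    by (rule conj_action_psl_eqI) (use t b in \<open>simp_all add: algebra_simps\<close>)
  define W where "W = U \<otimes>\<^bsub>PSL2\<^esub> inv\<^bsub>PSL2\<^esub> V \<otimes>\<^bsub>PSL2\<^esub> U"
  have W: "W \<in> carrier PSL2" by (simp add: W_def)
  have "W = psl (matrix2 0 1 (- 1) 0)" by (simp add: W_def U_V_def inv_psl psl_mult)
  then have "W \<otimes>\<^bsub>PSL2\<^esub> W = \<one>\<^bsub>PSL2\<^esub>" by (simp add: psl_mult one_PSL2 psl_eq_iff mat_eq_matrix2)
  then have "\<theta>2 W \<otimes>\<^bsub>PSL2\<^esub> \<theta>2 W = \<one>\<^bsub>PSL2\<^esub>" using \<theta>2.hom_mult[OF W W] \<theta>2.hom_one by simp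
  moreover have "\<theta>2 W = psl (matrix2 (1 - c) (2 - c) (- c) (1 - c))"
    by (simp add: W_def \<theta>2.hom_mult \<theta>2.hom_inv \<theta>2U \<theta>2V) (simp add: U_V_def inv_psl psl_mult)
  moreover have "det (matrix2 (1 - c) (2 - c) (- c) (1 - c)) = 1" by (simp add: algebra_simps)
  ultimately have "- c * (1 - c) + (1 - c) * - c = 0"
    by (auto simp: psl_mult one_PSL2 psl_eq_iff mat_eq_matrix2 simp del: det_matrix2)
  then have "2 * c * (1 - c) = 0" by (simp add: algebra_simps)
  then have "c = 1" using two \<open>c \<noteq> 0\<close> by simp
  have "\<theta>2 (psl A) = psl A" if "det A = 1" for A
  proof (rule SL2_induct[OF _ _ _ that])
    show "\<theta>2 (psl (A ** B)) = psl (A ** B)"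
      if "det A = 1" "det B = 1" "\<theta>2 (psl A) = psl A" "\<theta>2 (psl B) = psl B" for A B
      using that \<theta>2.hom_mult[of "psl A" "psl B"] by (simp add: psl_mult)
    show "\<theta>2 (psl (matrix2 1 b 0 1)) = psl (matrix2 1 b 0 1)" for b
    proof -
      obtain j where "b = of_nat j" by (rule prime_field_of_nat[OF card_k p(1)])
      then have "psl (matrix2 1 b 0 1) = U [^]\<^bsub>PSL2\<^esub> j" by (simp add: U_V_def unipotent_psl_pow)
      then show ?thesis using \<theta>2U by (simp add: \<theta>2.hom_nat_pow)
    qed
    show "\<theta>2 (psl (matrix2 1 0 b 1)) = psl (matrix2 1 0 b 1)" for b
    proof -
      obtain j where "b = of_nat j" by (rule prime_field_of_nat[OF card_k p(1)])
      then have "psl (matrix2 1 0 b 1) = V [^]\<^bsub>PSL2\<^esub> j" by (simp add: U_V_def unipotent_psl_pow')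
      then show ?thesis using \<theta>2V \<open>c = 1\<close> by (simp add: \<theta>2.hom_nat_pow U_V_def)
    qed
  qed
  then have id: "\<theta>2 \<omega> = \<omega>" if "\<omega> \<in> carrier PSL2" for \<omega> using that psl_cases by metis
  let ?\<sigma> = "pgl (matrix2 1 t 0 1) \<otimes>\<^bsub>PGL2\<^esub> pgl C"
  have \<sigma>: "?\<sigma> \<in> carrier PGL2" using C(1) by simp
  have "\<theta> \<omega> = conj_action (inv\<^bsub>PGL2\<^esub> ?\<sigma>) \<omega>" if \<omega>: "\<omega> \<in> carrier PSL2" for \<omega>
  proof -
    have cl: "\<theta> \<omega> \<in> carrier PSL2" using \<theta> \<omega> by (auto simp: iso_def hom_def)
    then have "conj_action ?\<sigma> (\<theta> \<omega>) = \<theta>2 \<omega>"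
      unfolding \<theta>2_def \<theta>1_def using C(1) by (simp add: conj_action_comp)
    then show ?thesis using conj_action_inv(1)[OF \<sigma> cl] id[OF \<omega>] by simp
  qed
  then show ?thesis using that[of "inv\<^bsub>PGL2\<^esub> ?\<sigma>"] \<sigma> by blast
qed

end


section \<open>Regular balanced Cayley maps on PSL(2, p)\<close>

lemma orbit_set_eq_orbit:
  assumes "\<sigma> \<in> carrier PGL2" "\<omega> \<in> carrier PSL2"
  shows "orbit_set \<sigma> \<omega> = orbit (conj_action \<sigma>) \<omega>"
  unfolding orbit_set_def orbit_altdef using conj_action_funpow[OF assms] by force

text \<open>Combines generation by \<open>\<Omega>\<close> with faithfulness of the action; it turns
  relations between rotations into relations in \<open>PGL2\<close>.\<close>

lemma conj_action_eq_on_generators: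
  fixes \<sigma> \<tau> :: "('k::field^2^2) set"
  assumes data: "cayley_map_data PSL2 \<Omega> \<rho>" and \<sigma>: "\<sigma> \<in> carrier PGL2" and \<tau>: "\<tau> \<in> carrier PGL2"
    and eq: "\<And>\<omega>. \<omega> \<in> \<Omega> \<Longrightarrow> conj_action \<sigma> \<omega> = conj_action \<tau> \<omega>" and two: "(2::'k) \<noteq> 0"
  shows "\<sigma> = \<tau>"
proof -
  have gen: "generate PSL2 \<Omega> = carrier PSL2" and sub: "\<Omega> \<subseteq> carrier PSL2"
    using data by (simp_all add: cayley_map_data_def)
  have "\<omega> \<in> carrier PSL2 \<and> conj_action \<sigma> \<omega> = conj_action \<tau> \<omega>" if "\<omega> \<in> generate PSL2 \<Omega>" for \<omega>
    using that
  proof (induction rule: generate.induct)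
    case one
    have "\<one>\<^bsub>PSL2\<^esub> \<otimes>\<^bsub>PSL2\<^esub> \<one>\<^bsub>PSL2\<^esub> = \<one>\<^bsub>PSL2\<^esub>" by simp
    then have "conj_action \<sigma>' \<one>\<^bsub>PSL2\<^esub> = \<one>\<^bsub>PSL2\<^esub>" if "\<sigma>' \<in> carrier PGL2" for \<sigma>' :: "('k^2^2) set"
      using conj_action_mult[OF that, of "\<one>\<^bsub>PSL2\<^esub>" "\<one>\<^bsub>PSL2\<^esub>"] that
      by (metis PSL2.l_cancel_one conj_action_closed PSL2.one_closed)
    then show ?case using \<sigma> \<tau> by simp
  next
    case (incl \<omega>)
    then show ?case using eq sub by blast
  next
    case (inv \<omega>)
    then show ?case using eq[OF inv] sub \<sigma> \<tau> by (auto simp: conj_action_m_inv subset_iff)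
  next
    case (eng \<omega>1 \<omega>2)
    then show ?case using \<sigma> \<tau> by (simp add: conj_action_mult)
  qed
  then have all: "conj_action \<sigma> \<omega> = conj_action \<tau> \<omega>" if "\<omega> \<in> carrier PSL2" for \<omega>
    using that gen by blast
  have "inv\<^bsub>PGL2\<^esub> \<tau> \<otimes>\<^bsub>PGL2\<^esub> \<sigma> = \<one>\<^bsub>PGL2\<^esub>"
  proof (rule conj_action_faithful[OF _ _ two])
    show "conj_action (inv\<^bsub>PGL2\<^esub> \<tau> \<otimes>\<^bsub>PGL2\<^esub> \<sigma>) \<omega> = \<omega>" if "\<omega> \<in> carrier PSL2" for \<omega>
      using \<sigma> \<tau> that all[OF that] conj_action_inv(1)[OF \<tau> that] by (simp add: conj_action_comp)
  qed (use \<sigma> \<tau> in simp)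
  then show ?thesis using \<sigma> \<tau> by (metis PGL2.inv_equality PGL2.inv_inv PGL2.inv_closed PGL2.inv_comm)
qed

text \<open>The existence half: conjugating \<open>\<sigma>\<close> moves the whole map along, and
  the image of the connection set is a single orbit of \<open>\<sigma>'\<close> because the rotation
  is one cycle.\<close>

lemma transport_by_conj:
  fixes \<sigma> c :: "('k::{field,finite}^2^2) set"
  assumes data: "cayley_map_data PSL2 \<Omega> \<rho>" and \<sigma>: "\<sigma> \<in> carrier PGL2" and c: "c \<in> carrier PGL2"
    and \<rho>: "\<And>\<omega>. \<omega> \<in> \<Omega> \<Longrightarrow> \<rho> \<omega> = conj_action \<sigma> \<omega>" and \<omega>: "\<omega> \<in> \<Omega>"
    and \<sigma>': "c \<otimes>\<^bsub>PGL2\<^esub> \<sigma> \<otimes>\<^bsub>PGL2\<^esub> inv\<^bsub>PGL2\<^esub> c = \<sigma>'"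
  shows "CM_data \<sigma>' (conj_action c \<omega>)"
    and "cayley_map PSL2 \<Omega> \<rho> \<cong>\<^sub>m CM \<sigma>' (conj_action c \<omega>)"
proof -
  have sub: "\<Omega> \<subseteq> carrier PSL2" and cyc: "cyclic_on \<rho> \<Omega>"
    using data by (simp_all add: cayley_map_data_def)
  have \<sigma>'_closed: "\<sigma>' \<in> carrier PGL2" using c \<sigma> \<sigma>' by blast
  have "\<sigma>' \<otimes>\<^bsub>PGL2\<^esub> c = c \<otimes>\<^bsub>PGL2\<^esub> \<sigma>"
    unfolding \<sigma>'[symmetric] using c \<sigma> by (simp add: PGL2.m_assoc)
  then have comm: "conj_action c (\<rho> \<omega>) = conj_action \<sigma>' (conj_action c \<omega>)" if "\<omega> \<in> \<Omega>" for \<omega>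
    using conj_action_comp[OF \<sigma>'_closed c, of \<omega>] conj_action_comp[OF c \<sigma>, of \<omega>] that sub
    by (auto simp: \<rho>)
  have "cyclic_on (conj_action \<sigma>') (conj_action c ` \<Omega>)"
    by (rule cyclic_on_image[of \<rho> \<Omega> "conj_action c" "conj_action \<sigma>'", OF cyc comm])
  then have "conj_action c ` \<Omega> = orbit (conj_action \<sigma>') (conj_action c \<omega>)"
    using \<omega> by (simp add: cyclic_on_alldef)
  also have "\<dots> = orbit_set \<sigma>' (conj_action c \<omega>)"
    using \<omega> sub c \<sigma>'_closed by (intro orbit_set_eq_orbit[symmetric] conj_action_closed) auto
  finally have img: "conj_action c ` \<Omega> = orbit_set \<sigma>' (conj_action c \<omega>)" .
  show "CM_data \<sigma>' (conj_action c \<omega>)"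
    using group_iso_imp_map_isomorphic(2)[OF data PSL2.is_group conj_action_iso[OF c] comm]
    unfolding CM_data_def img .
  show "cayley_map PSL2 \<Omega> \<rho> \<cong>\<^sub>m CM \<sigma>' (conj_action c \<omega>)"
    using group_iso_imp_map_isomorphic(1)[OF data PSL2.is_group conj_action_iso[OF c] comm]
    unfolding CM_def img .
qed

text \<open>By Cayley-Hamilton the square of such a matrix is -1.\<close>

lemma trace_0_imp_involution:
  assumes "det A = 1" "trace A = 0"
  shows "psl A \<otimes>\<^bsub>PSL2\<^esub> psl A = \<one>\<^bsub>PSL2\<^esub>"
proof (cases A rule: matrix2_cases)
  case (1 a b c d)
  then have "d = - a" using assms(2) by (simp add: add_eq_0_iff)
  have "- (a * a) - b * c = 1" using assms(1) unfolding 1 \<open>d = - a\<close> by simp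
  then have *: "- (a * a) = 1 + b * c" by (simp only: diff_eq_eq)
  have "b * c = - (a * a) - 1" unfolding * by simp
  then have "A ** A = - mat 1" unfolding 1 \<open>d = - a\<close> by (simp add: mat_eq_matrix2 mult.commute)
  then show ?thesis using assms(1) by (simp add: psl_mult one_PSL2)
qed

context quadratic_extension
begin

text \<open>The order of \<open>\<sigma>\<close> is the valency: a power of \<open>\<sigma>\<close>
  is determined by its action on \<open>\<Omega>\<close>, where \<open>\<sigma>\<close> acts as one
  cycle of length 2n.\<close>

lemma regular_balanced_obtain_conj:
  fixes \<Omega> :: "('k^2^2) set set"
  assumes data: "cayley_map_data PSL2 \<Omega> \<rho>" and card: "card \<Omega> = 2 * n"
    and reg: "regular_map (cayley_map PSL2 \<Omega> \<rho>)" and half: "\<And>\<omega>. \<omega> \<in> \<Omega> \<Longrightarrow> inv\<^bsub>PSL2\<^esub> \<omega> = (\<rho> ^^ n) \<omega>"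
  obtains \<sigma> where "\<sigma> \<in> carrier PGL2" "\<And>\<omega>. \<omega> \<in> \<Omega> \<Longrightarrow> \<rho> \<omega> = conj_action \<sigma> \<omega>" "PGL2.ord \<sigma> = 2 * n"
proof -
  have sub: "\<Omega> \<subseteq> carrier PSL2" and cyc: "cyclic_on \<rho> \<Omega>"
    using data by (simp_all add: cayley_map_data_def)
  obtain \<theta> where \<theta>: "\<theta> \<in> iso PSL2 PSL2" "\<And>\<omega>. \<omega> \<in> \<Omega> \<Longrightarrow> \<theta> \<omega> = \<rho> \<omega>"
    using regular_balanced_imp_automorphism[OF data half reg] by metis
  obtain \<sigma> where \<sigma>: "\<sigma> \<in> carrier PGL2" "\<And>\<omega>. \<omega> \<in> carrier PSL2 \<Longrightarrow> \<theta> \<omega> = conj_action \<sigma> \<omega>"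
    using automorphism_PSL2[OF \<theta>(1)] by metis
  have \<rho>: "\<rho> \<omega> = conj_action \<sigma> \<omega>" if "\<omega> \<in> \<Omega>" for \<omega> using that \<theta>(2) \<sigma>(2) sub by auto
  have pow: "(\<rho> ^^ j) \<omega> = conj_action (\<sigma> [^]\<^bsub>PGL2\<^esub> j) \<omega>" if "\<omega> \<in> \<Omega>" for \<omega> j
  proof -
    have "(\<rho> ^^ j) \<omega> = (conj_action \<sigma> ^^ j) \<omega>"
    proof (induction j)
      case (Suc j)
      then show ?case using cyclic_on_funpow_in[OF cyc that, of j] \<rho> by simp
    qed simp
    then show ?thesis using conj_action_funpow[OF \<sigma>(1), of \<omega> j] that sub by auto
  qed
  have "\<sigma> [^]\<^bsub>PGL2\<^esub> j = \<one>\<^bsub>PGL2\<^esub> \<longleftrightarrow> 2 * n dvd j" for j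
  proof
    assume "\<sigma> [^]\<^bsub>PGL2\<^esub> j = \<one>\<^bsub>PGL2\<^esub>"
    moreover obtain \<omega> where "\<omega> \<in> \<Omega>" using cyc by (auto simp: cyclic_on_def)
    ultimately have "(\<rho> ^^ j) \<omega> = \<omega>" using pow sub by auto
    then show "2 * n dvd j" using cyclic_on_funpow_eq_iff[OF cyc \<open>\<omega> \<in> \<Omega>\<close>] card by simp
  next
    assume "2 * n dvd j"
    then have "conj_action (\<sigma> [^]\<^bsub>PGL2\<^esub> j) \<omega> = conj_action \<one>\<^bsub>PGL2\<^esub> \<omega>" if "\<omega> \<in> \<Omega>" for \<omega>
    proof -
      have "(\<rho> ^^ j) \<omega> = \<omega>" using cyclic_on_funpow_eq_iff[OF cyc that] card \<open>2 * n dvd j\<close> by simp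
      then show ?thesis using pow[OF that, of j] conj_action_one that sub by (metis subsetD)
    qed
    then show "\<sigma> [^]\<^bsub>PGL2\<^esub> j = \<one>\<^bsub>PGL2\<^esub>"
      using conj_action_eq_on_generators[OF data _ _ _ two] \<sigma>(1) by simp
  qed
  then have "PGL2.ord \<sigma> = 2 * n" using PGL2.ord_unique[OF \<sigma>(1)] by blast
  then show ?thesis using that \<sigma>(1) \<rho> by blast
qed

text \<open>The uniqueness half. The group isomorphism behind a map isomorphism is conjugation by
  some \<open>c\<close>; compatibility with the rotations is an equality of actions on
  \<open>\<Omega>\<close>, hence an equality in \<open>PGL2\<close>.\<close>

lemma isomorphic_CM_obtain_conj:
  fixes \<Omega> :: "('k^2^2) set set"
  assumes data: "cayley_map_data PSL2 \<Omega> \<rho>" and \<sigma>: "\<sigma> \<in> carrier PGL2"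
    and \<rho>: "\<And>\<omega>. \<omega> \<in> \<Omega> \<Longrightarrow> \<rho> \<omega> = conj_action \<sigma> \<omega>"
    and half: "\<And>\<omega>. \<omega> \<in> \<Omega> \<Longrightarrow> inv\<^bsub>PSL2\<^esub> \<omega> = (\<rho> ^^ n) \<omega>"
    and \<sigma>': "\<sigma>' \<in> carrier PGL2" and \<omega>': "\<omega>' \<in> carrier PSL2"
    and half': "conj_action (\<sigma>' [^]\<^bsub>PGL2\<^esub> n) \<omega>' = inv\<^bsub>PSL2\<^esub> \<omega>'"
    and data': "CM_data \<sigma>' \<omega>'" and iso: "cayley_map PSL2 \<Omega> \<rho> \<cong>\<^sub>m CM \<sigma>' \<omega>'"
  obtains c where "c \<in> carrier PGL2" "c \<otimes>\<^bsub>PGL2\<^esub> \<sigma> \<otimes>\<^bsub>PGL2\<^esub> inv\<^bsub>PGL2\<^esub> c = \<sigma>'"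
    "conj_action c ` \<Omega> = orbit_set \<sigma>' \<omega>'"
proof -
  have sub: "\<Omega> \<subseteq> carrier PSL2" using data by (simp add: cayley_map_data_def)
  \<comment> \<open>The relation at \<open>\<omega>'\<close> spreads over its orbit because powers
    of \<open>\<sigma>'\<close> commute.\<close>
  have half'': "inv\<^bsub>PSL2\<^esub> \<omega> = (conj_action \<sigma>' ^^ n) \<omega>" if \<omega>: "\<omega> \<in> orbit_set \<sigma>' \<omega>'" for \<omega>
  proof -
    obtain j where j: "\<omega> = conj_action (\<sigma>' [^]\<^bsub>PGL2\<^esub> (j::nat)) \<omega>'" using \<omega> by (auto simp: orbit_set_def)
    have "inv\<^bsub>PSL2\<^esub> \<omega> = conj_action (\<sigma>' [^]\<^bsub>PGL2\<^esub> j) (conj_action (\<sigma>' [^]\<^bsub>PGL2\<^esub> n) \<omega>')"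
      unfolding j half' using \<sigma>' \<omega>' by (simp add: conj_action_m_inv)
    also have "\<dots> = conj_action (\<sigma>' [^]\<^bsub>PGL2\<^esub> n) (conj_action (\<sigma>' [^]\<^bsub>PGL2\<^esub> j) \<omega>')"
      using conj_action_comp[of "\<sigma>' [^]\<^bsub>PGL2\<^esub> j" "\<sigma>' [^]\<^bsub>PGL2\<^esub> n" \<omega>'] conj_action_comp[of "\<sigma>' [^]\<^bsub>PGL2\<^esub> n" "\<sigma>' [^]\<^bsub>PGL2\<^esub> j" \<omega>'] \<sigma>' \<omega>'
      by (simp add: PGL2.nat_pow_mult add.commute)
    finally show ?thesis using conj_action_funpow[OF \<sigma>', of \<omega> n] \<sigma>' \<omega>' by (simp add: j)
  qed
  obtain h where h: "map_isomorphism (cayley_map PSL2 \<Omega> \<rho>) (cayley_map PSL2 (orbit_set \<sigma>' \<omega>') (conj_action \<sigma>')) h"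
    using iso unfolding map_isomorphic_def CM_def by blast
  obtain \<theta> where \<theta>: "\<theta> \<in> iso PSL2 PSL2" "\<theta> ` \<Omega> = orbit_set \<sigma>' \<omega>'"
      "\<And>\<omega>. \<omega> \<in> \<Omega> \<Longrightarrow> \<theta> (\<rho> \<omega>) = conj_action \<sigma>' (\<theta> \<omega>)"
    using map_isomorphism_imp_group_iso[OF data data'[unfolded CM_data_def] half half'' h] by metis
  obtain c where c: "c \<in> carrier PGL2" "\<And>\<omega>. \<omega> \<in> carrier PSL2 \<Longrightarrow> \<theta> \<omega> = conj_action c \<omega>"
    using automorphism_PSL2[OF \<theta>(1)] by metis
  have "conj_action (c \<otimes>\<^bsub>PGL2\<^esub> \<sigma>) \<omega> = conj_action (\<sigma>' \<otimes>\<^bsub>PGL2\<^esub> c) \<omega>" if "\<omega> \<in> \<Omega>" for \<omega>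
  proof -
    have "\<omega> \<in> carrier PSL2" using that sub by blast
    then show ?thesis using \<theta>(3)[OF that] c \<sigma> \<sigma>' that by (simp add: conj_action_comp \<rho>)
  qed
  then have "c \<otimes>\<^bsub>PGL2\<^esub> \<sigma> = \<sigma>' \<otimes>\<^bsub>PGL2\<^esub> c"
    using conj_action_eq_on_generators[OF data _ _ _ two] c(1) \<sigma> \<sigma>' by simp
  then have "c \<otimes>\<^bsub>PGL2\<^esub> \<sigma> \<otimes>\<^bsub>PGL2\<^esub> inv\<^bsub>PGL2\<^esub> c = \<sigma>'" using c(1) \<sigma>' by (simp add: PGL2.m_assoc)
  moreover have "conj_action c ` \<Omega> = orbit_set \<sigma>' \<omega>'"
    unfolding \<theta>(2)[symmetric] using c(2) sub by (intro image_cong refl) auto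
  ultimately show ?thesis using that c(1) by blast
qed

text \<open>For \<open>n = 1\<close> the connection set is \<open>\<omega>\<close> and its inverse.
  Conjugation by \<open>\<omega>\<close> fixes both, hence is trivial, and faithfulness gives the
  contradiction that \<open>\<omega>\<close> is the identity.\<close>

lemma half_valency_ge_2:
  fixes \<Omega> :: "('k^2^2) set set"
  assumes data: "cayley_map_data PSL2 \<Omega> \<rho>" and card: "card \<Omega> = 2 * n"
    and half: "\<And>\<omega>. \<omega> \<in> \<Omega> \<Longrightarrow> inv\<^bsub>PSL2\<^esub> \<omega> = (\<rho> ^^ n) \<omega>"
  shows "2 \<le> n"
proof -
  have sub: "\<Omega> \<subseteq> carrier PSL2" and cyc: "cyclic_on \<rho> \<Omega>" and one: "\<one>\<^bsub>PSL2\<^esub> \<notin> \<Omega>"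
    using data by (simp_all add: cayley_map_data_def)
  obtain \<omega> where \<omega>: "\<omega> \<in> \<Omega>" using cyc by (auto simp: cyclic_on_def)
  then have "n \<noteq> 0" using card finite_cyclic_on[OF cyc] by (metis card_0_eq empty_iff mult_0_right)
  moreover have "n \<noteq> 1"
  proof
    assume "n = 1"
    have "\<omega>' = \<omega> \<or> \<omega>' = inv\<^bsub>PSL2\<^esub> \<omega>" if "\<omega>' \<in> \<Omega>" for \<omega>'
    proof -
      obtain j where "\<omega>' = (\<rho> ^^ j) \<omega>" using cyclic_on_obtain[OF cyc \<omega> \<open>\<omega>' \<in> \<Omega>\<close>] by blast
      moreover have "(\<rho> ^^ j) \<omega> = \<omega> \<or> (\<rho> ^^ j) \<omega> = inv\<^bsub>PSL2\<^esub> \<omega>"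
      proof (induction j)
        case (Suc j)
        have "\<rho> (inv\<^bsub>PSL2\<^esub> \<omega>) = \<omega>"
          using cyclic_on_funpow_eq_iff[OF cyc \<omega>, of 2] card half[OF \<omega>] \<open>n = 1\<close> by (simp add: numeral_2_eq_2)
        then show ?case using Suc half[OF \<omega>] \<open>n = 1\<close> by auto
      qed simp
      ultimately show ?thesis by simp
    qed
    moreover obtain A where A: "\<omega> = psl A" "det A = 1" using psl_cases sub \<omega> by blast
    have A_fix: "conj_action (pgl A) \<omega> = \<omega>" unfolding A(1) by (rule conj_action_psl_eqI) (use A in simp_all)
    moreover have "conj_action (pgl A) (inv\<^bsub>PSL2\<^esub> \<omega>) = inv\<^bsub>PSL2\<^esub> \<omega>"
      using A_fix \<omega> sub A(2) by (subst conj_action_m_inv) auto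
    ultimately have "conj_action (pgl A) \<omega>' = conj_action \<one>\<^bsub>PGL2\<^esub> \<omega>'" if "\<omega>' \<in> \<Omega>" for \<omega>'
      using that sub by (metis conj_action_one subsetD)
    then have "pgl A = \<one>\<^bsub>PGL2\<^esub>"
      using conj_action_eq_on_generators[OF data _ _ _ two, of "pgl A" "\<one>\<^bsub>PGL2\<^esub>"] A(2) by simp
    then have "\<omega> = \<one>\<^bsub>PSL2\<^esub>" using pgl_one_imp_psl_one A by metis
    then show False using one \<omega> by simp
  qed
  ultimately show ?thesis by simp
qed

text \<open>Rescaling by 2/trace makes the matrix unipotent of determinant 1, so it is trivial or
  conjugate to the elementary one.\<close>

lemma double_root_pow_p:
  assumes B: "det B \<noteq> 0" and tr: "(trace B)\<^sup>2 = 4 * det (B :: 'k^2^2)"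
  shows "pgl B [^]\<^bsub>PGL2\<^esub> p = \<one>\<^bsub>PGL2\<^esub>"
proof -
  have four: "(4::'k) \<noteq> 0" using two by (metis mult_2 mult_eq_0_iff numeral_Bit0)
  define c where "c = 2 / trace B"
  have t: "trace B \<noteq> 0" using tr B four by auto
  then have c: "c \<noteq> 0" "c * trace B = 2" using two by (simp_all add: c_def)
  define A where "A = mat c ** B"
  have "trace A = c * trace B"
    unfolding A_def by (cases B rule: matrix2_cases) (simp add: algebra_simps)
  then have trA: "trace A = 2" using c by simp
  have "4 * det A = (c * trace B)\<^sup>2" unfolding A_def power_mult_distrib tr by (simp add: det_mul)
  then have "4 * det A = 4 * 1" unfolding c(2) by simp
  then have detA: "det A = 1" using four by (metis mult_left_cancel)
  have pglA: "pgl A = pgl B" unfolding A_def by (rule pgl_mat_mult[OF c(1)])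
  show ?thesis
  proof (cases "A = mat 1")
    case True
    then show ?thesis using pglA one_PGL2 by (metis PGL2.nat_pow_one)
  next
    case False
    then obtain C where C: "det C \<noteq> 0" "C ** A = matrix2 1 1 0 1 ** C"
      using unipotent_conj[OF detA trA] by metis
    have "(of_nat p :: 'k) = 0" using char_k by (metis of_nat_CHAR)
    then have "pgl (matrix2 1 (1::'k) 0 1) [^]\<^bsub>PGL2\<^esub> p = \<one>\<^bsub>PGL2\<^esub>"
      by (simp add: unipotent_pgl_pow one_PGL2 mat_eq_matrix2)
    then have "(pgl C \<otimes>\<^bsub>PGL2\<^esub> pgl A \<otimes>\<^bsub>PGL2\<^esub> inv\<^bsub>PGL2\<^esub> (pgl C)) [^]\<^bsub>PGL2\<^esub> p = \<one>\<^bsub>PGL2\<^esub>"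
      using pgl_conj_eqI[OF C(1) _ C(2)] detA by simp
    moreover have cl: "pgl C \<in> carrier PGL2" "pgl A \<in> carrier PGL2" using C(1) detA by simp_all
    ultimately show ?thesis
      unfolding PGL2.conj_nat_pow[OF cl] PGL2.conj_eq_one_iff[OF cl(1) PGL2.nat_pow_closed[OF cl(2)]]
      by (simp only: pglA)
  qed
qed

end


section \<open>Exponents in a cyclic torus, up to inversion\<close>

lemma (in group) pow_eq_pow_imp_dvd:
  assumes "x \<in> carrier G" "x [^] (i::nat) = x [^] (j::nat)" "i \<le> j"
  shows "ord x dvd j - i"
proof -
  have "x [^] i \<otimes> x [^] (j - i) = x [^] j" using assms(1,3) by (simp add: nat_pow_mult)
  then have "x [^] i \<otimes> x [^] (j - i) = x [^] i \<otimes> \<one>" using assms(1,2) by simp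
  then have "x [^] (j - i) = \<one>" using assms(1) by (metis l_cancel_one nat_pow_closed one_closed r_one)
  then show ?thesis using assms(1) pow_eq_id by blast
qed

text \<open>Both \<open>\<bar>u - v\<bar>\<close> and \<open>u + v\<close> are below 2n; the first
  then vanishes, and the second, being positive, rules out mutually inverse powers.\<close>

lemma (in group) torus_pow_inj:
  assumes \<tau>: "\<tau> \<in> carrier G" "ord \<tau> = 2 * n * m" "0 < m"
    and uv: "1 \<le> u" "u < n" "1 \<le> v" "v < n"
    and eq: "\<tau> [^] (m * u) = \<tau> [^] (m * v) \<or> \<tau> [^] (m * u) \<otimes> \<tau> [^] (m * v) = \<one>"
  shows "u = v"
  using eq
proof
  have imp: "i = j" if "\<tau> [^] (m * i) = \<tau> [^] (m * j)" "i \<le> j" "j < n" for i j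
  proof -
    have "m * (2 * n) dvd m * (j - i)"
      using pow_eq_pow_imp_dvd[OF \<tau>(1) that(1)] that(2) \<tau>(2) by (simp add: diff_mult_distrib2 mult.commute)
    then have "2 * n dvd j - i" using \<tau>(3) by simp
    then show ?thesis using that by (auto dest: dvd_imp_le)
  qed
  assume "\<tau> [^] (m * u) = \<tau> [^] (m * v)"
  then show "u = v" using imp[of u v] imp[of v u] uv by (cases "u \<le> v") auto
next
  assume "\<tau> [^] (m * u) \<otimes> \<tau> [^] (m * v) = \<one>"
  then have "\<tau> [^] (m * (u + v)) = \<one>" using \<tau>(1) by (simp add: nat_pow_mult distrib_left)
  then have "m * (2 * n) dvd m * (u + v)" using pow_eq_id[OF \<tau>(1)] \<tau>(2) by (simp add: mult.commute)
  then have "2 * n dvd u + v" using \<tau>(3) by simp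
  then show "u = v" using uv by (auto dest: dvd_imp_le)
qed

text \<open>An element of order exactly 2n has exponent \<open>m\<close> times a unit modulo 2n. Its
  residue differs from \<open>n\<close> as \<open>n \<ge> 2\<close>; if it exceeds \<open>n\<close>,
  conjugating by the inverting element \<open>s\<close> reflects it to the lower half.\<close>

lemma (in group) torus_normal_form:
  assumes \<tau>: "\<tau> \<in> carrier G" "ord \<tau> = 2 * n * m" "0 < m" and n: "2 \<le> n"
    and s: "s \<in> carrier G" "s \<otimes> \<tau> \<otimes> inv s = inv \<tau>"
    and \<sigma>: "\<sigma> \<in> carrier G" "ord \<sigma> = 2 * n"
    and c: "c \<in> carrier G" "c \<otimes> \<sigma> \<otimes> inv c = \<tau> [^] (k::nat)"
  obtains c' u where "c' \<in> carrier G" "coprime u (2 * n)" "1 \<le> u" "u < n"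
    "c' \<otimes> \<sigma> \<otimes> inv c' = \<tau> [^] (m * u)"
proof -
  have ord: "ord (\<tau> [^] k) = 2 * n" using ord_conj[OF c(1) \<sigma>(1)] \<sigma>(2) c(2) by simp
  have pow: "(\<tau> [^] k) [^] j = \<one> \<longleftrightarrow> 2 * n * m dvd k * j" for j :: nat
    using \<tau> by (simp add: nat_pow_pow pow_eq_id)
  have "2 * n * m dvd k * (2 * n)" using pow[of "2 * n"] ord pow_ord_eq_1[of "\<tau> [^] k"] \<tau>(1) by simp
  then have "2 * n * m dvd 2 * n * k" by (simp only: mult.commute[of k])
  then have "m dvd k" using n by simp
  then obtain k' where k': "k = m * k'" by (elim dvdE)
  have cop: "coprime k' (2 * n)"
  proof -
    \<comment> \<open>\<open>h\<close> is 2n divided by the gcd and already kills the power, so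
      order 2n forces the gcd to be 1.\<close>
    obtain f h where fh: "k' = gcd k' (2 * n) * f" "2 * n = gcd k' (2 * n) * h"
      by (metis gcd_dvd1 gcd_dvd2 dvdE)
    have "k * h = 2 * n * m * f"
      by (subst fh(2), unfold k', subst (1) fh(1)) (simp only: mult_ac)
    then have "(\<tau> [^] k) [^] h = \<one>" by (simp only: pow dvd_triv_left)
    then have "2 * n dvd h" using pow_eq_id[of "\<tau> [^] k" h] ord \<tau>(1) by simp
    moreover have "h \<noteq> 0"
    proof
      assume "h = 0"
      then have "2 * n = 0" using fh(2) by simp
      then show False using n by simp
    qed
    ultimately have "2 * n \<le> h" by (intro dvd_imp_le) simp_all
    then have "gcd k' (2 * n) * h \<le> 1 * h" using fh(2) by simp
    then have "gcd k' (2 * n) \<le> 1" using \<open>h \<noteq> 0\<close> by simp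
    moreover have "gcd k' (2 * n) \<noteq> 0" using n by simp
    ultimately have "gcd k' (2 * n) = 1" by linarith
    then show ?thesis by (simp only: coprime_iff_gcd_eq_1)
  qed
  have period: "\<tau> [^] (m * (r + 2 * n * q)) = \<tau> [^] (m * r)" for r q
  proof -
    have "m * (r + 2 * n * q) = m * r + 2 * n * m * q" by (simp add: algebra_simps)
    moreover have "\<tau> [^] (2 * n * m * q) = \<one>" using \<tau> by (simp add: pow_eq_id)
    ultimately show ?thesis using \<tau>(1) by (simp flip: nat_pow_mult)
  qed
  define r where "r = k' mod (2 * n)"
  have c_r: "c \<otimes> \<sigma> \<otimes> inv c = \<tau> [^] (m * r)"
    using period[of r "k' div (2 * n)"] unfolding c(2) k' by (simp add: r_def)
  have "2 * n \<noteq> 0" using n by simp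
  from coprime_mod_left_iff[OF this, of k'] have cop_r: "coprime r (2 * n)"
    unfolding r_def using cop by blast
  then have "odd r" by simp
  then have "r \<noteq> 0" by (metis even_zero)
  moreover have "r \<noteq> n" using cop_r n by auto
  moreover have "r < 2 * n" using n by (simp add: r_def)
  ultimately consider "1 \<le> r" "r < n" | "n < r" "r < 2 * n" by linarith
  then show ?thesis
  proof cases
    case 1
    then show ?thesis using that c(1) c_r cop_r by blast
  next
    case 2
    define u where "u = 2 * n - r"
    have u: "u + r = 2 * n" using 2 by (simp add: u_def)
    have "coprime u (2 * n)"
    proof -
      have "gcd u (u + r) = gcd r (u + r)" by (metis gcd_add1 gcd_add2 gcd.commute)
      then show ?thesis using cop_r by (simp add: coprime_iff_gcd_eq_1 u)
    qed
    moreover have "s \<otimes> c \<otimes> \<sigma> \<otimes> inv (s \<otimes> c) = \<tau> [^] (m * u)"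
    proof -
      have "s \<otimes> c \<otimes> \<sigma> \<otimes> inv (s \<otimes> c) = s \<otimes> (c \<otimes> \<sigma> \<otimes> inv c) \<otimes> inv s"
        using s(1) c(1) \<sigma>(1) by (simp add: inv_mult_group m_assoc)
      also have "\<dots> = (s \<otimes> \<tau> \<otimes> inv s) [^] (m * r)"
        unfolding c_r using s(1) \<tau>(1) by (simp add: conj_nat_pow)
      also have "\<dots> = inv (\<tau> [^] (m * r))" unfolding s(2) using \<tau>(1) by (simp add: nat_pow_inv)
      also have "\<dots> = \<tau> [^] (m * u)"
      proof (rule inv_equality)
        have "\<tau> [^] (m * u) \<otimes> \<tau> [^] (m * r) = \<tau> [^] (m * (u + r))"
          using \<tau>(1) by (simp add: nat_pow_mult distrib_left)
        also have "\<dots> = \<one>" using period[of 0 1] by (simp add: u)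
        finally show "\<tau> [^] (m * u) \<otimes> \<tau> [^] (m * r) = \<one>" .
      qed (use \<tau>(1) in simp_all)
      finally show ?thesis .
    qed
    ultimately show ?thesis using that[of "s \<otimes> c" u] s(1) c(1) 2 by (simp add: u_def)
  qed
qed

context quadratic_extension
begin

text \<open>
  \<open>\<tau>\<close> generates a maximal torus of order \<open>2nm\<close>, and \<open>F a\<close> is the normal form of the
  elements of trace \<open>\<plusminus>2a\<close> inverted by the involution of the torus.
\<close>

lemma classification:
  fixes \<Omega> :: "('k^2^2) set set" and F :: "'k \<Rightarrow> ('k^2^2) set"
  assumes data: "cayley_map_data PSL2 \<Omega> \<rho>" and type: "type_I PSL2 \<Omega>"
    and \<sigma>: "\<sigma> \<in> carrier PGL2" "PGL2.ord \<sigma> = 2 * n"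
    and \<rho>: "\<And>\<omega>. \<omega> \<in> \<Omega> \<Longrightarrow> \<rho> \<omega> = conj_action \<sigma> \<omega>"
    and half: "\<And>\<omega>. \<omega> \<in> \<Omega> \<Longrightarrow> inv\<^bsub>PSL2\<^esub> \<omega> = (\<rho> ^^ n) \<omega>" and n: "2 \<le> n"
    and \<tau>: "\<tau> \<in> carrier PGL2" "PGL2.ord \<tau> = 2 * n * m" "0 < m"
    and r: "r \<in> carrier PGL2" "r \<otimes>\<^bsub>PGL2\<^esub> \<tau> \<otimes>\<^bsub>PGL2\<^esub> inv\<^bsub>PGL2\<^esub> r = inv\<^bsub>PGL2\<^esub> \<tau>"
    and c0: "c0 \<in> carrier PGL2" "c0 \<otimes>\<^bsub>PGL2\<^esub> \<sigma> \<otimes>\<^bsub>PGL2\<^esub> inv\<^bsub>PGL2\<^esub> c0 = \<tau> [^]\<^bsub>PGL2\<^esub> (k0::nat)"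
    and uniq: "\<And>c (j::nat) (k::nat). c \<in> carrier PGL2 \<Longrightarrow>
        c \<otimes>\<^bsub>PGL2\<^esub> \<tau> [^]\<^bsub>PGL2\<^esub> j \<otimes>\<^bsub>PGL2\<^esub> inv\<^bsub>PGL2\<^esub> c = \<tau> [^]\<^bsub>PGL2\<^esub> k \<Longrightarrow>
        \<tau> [^]\<^bsub>PGL2\<^esub> k = \<tau> [^]\<^bsub>PGL2\<^esub> j \<or> \<tau> [^]\<^bsub>PGL2\<^esub> k \<otimes>\<^bsub>PGL2\<^esub> \<tau> [^]\<^bsub>PGL2\<^esub> j = \<one>\<^bsub>PGL2\<^esub>"
    and norm: "\<And>u A. coprime u (2 * n) \<Longrightarrow> det A = 1 \<Longrightarrow> CM_data (\<tau> [^]\<^bsub>PGL2\<^esub> (m * u)) (psl A) \<Longrightarrow>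
        conj_action (\<tau> [^]\<^bsub>PGL2\<^esub> (n * m)) (psl A) = inv\<^bsub>PSL2\<^esub> (psl A) \<Longrightarrow>
        psl A \<otimes>\<^bsub>PSL2\<^esub> psl A \<noteq> \<one>\<^bsub>PSL2\<^esub> \<Longrightarrow>
        Q (trace A / 2) \<and> (\<exists>c \<in> carrier PGL2. c \<otimes>\<^bsub>PGL2\<^esub> \<tau> = \<tau> \<otimes>\<^bsub>PGL2\<^esub> c \<and> conj_action c (psl A) = F (trace A / 2))"
    and F: "\<And>a. \<exists>A. det A = 1 \<and> trace A = 2 * a \<and> F a = psl A"
      "\<And>a. conj_action (\<tau> [^]\<^bsub>PGL2\<^esub> (n * m)) (F a) = inv\<^bsub>PSL2\<^esub> (F a)"
  shows "\<exists>a0 u0. {(a, u). Q a \<and> coprime u (2 * n) \<and> 1 \<le> u \<and> u < n \<and>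
        CM_data (\<tau> [^]\<^bsub>PGL2\<^esub> (m * u)) (F a) \<and> cayley_map PSL2 \<Omega> \<rho> \<cong>\<^sub>m CM (\<tau> [^]\<^bsub>PGL2\<^esub> (m * u)) (F a)}
      = {(a0, u0), (- a0, u0)}"
proof -
  have sub: "\<Omega> \<subseteq> carrier PSL2" and cyc: "cyclic_on \<rho> \<Omega>"
    using data by (simp_all add: cayley_map_data_def)
  obtain c u where c: "c \<in> carrier PGL2" "c \<otimes>\<^bsub>PGL2\<^esub> \<sigma> \<otimes>\<^bsub>PGL2\<^esub> inv\<^bsub>PGL2\<^esub> c = \<tau> [^]\<^bsub>PGL2\<^esub> (m * u)"
    and u: "coprime u (2 * n)" "1 \<le> u" "u < n"
    using PGL2.torus_normal_form[OF \<tau> n r \<sigma> c0] by metis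
  \<comment> \<open>The exponent \<open>v\<close> is odd, so the \<open>n\<close>-th power is always
    the same involution of the torus.\<close>
  have half_pow: "\<tau> [^]\<^bsub>PGL2\<^esub> (m * v * n) = \<tau> [^]\<^bsub>PGL2\<^esub> (n * m)" if "coprime v (2 * n)" for v
  proof -
    have "odd v" using that by simp
    then obtain q where "v = 2 * q + 1" by (elim oddE)
    then have "m * v * n = n * m + 2 * n * m * q" by (simp add: algebra_simps)
    moreover have "\<tau> [^]\<^bsub>PGL2\<^esub> (2 * n * m * q) = \<one>\<^bsub>PGL2\<^esub>" using \<tau> by (simp add: PGL2.pow_eq_id)
    ultimately show ?thesis using \<tau>(1) by (simp flip: PGL2.nat_pow_mult)
  qed
  obtain \<omega> where \<omega>: "\<omega> \<in> \<Omega>" using cyc by (auto simp: cyclic_on_def)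
  then have \<omega>c: "\<omega> \<in> carrier PSL2" using sub by blast
  obtain A where A: "conj_action c \<omega> = psl A" "det A = 1"
    using psl_cases[OF conj_action_closed[OF c(1) \<omega>c]] by metis
  have pow_n: "(\<rho> ^^ j) \<omega> = conj_action (\<sigma> [^]\<^bsub>PGL2\<^esub> j) \<omega>" for j
  proof -
    have "(\<rho> ^^ j) \<omega> = (conj_action \<sigma> ^^ j) \<omega>"
    proof (induction j)
      case (Suc j)
      then show ?case using cyclic_on_funpow_in[OF cyc \<omega>, of j] \<rho> by simp
    qed simp
    then show ?thesis using conj_action_funpow[OF \<sigma>(1) \<omega>c, of j] by simp
  qed
  have inverted: "conj_action (\<tau> [^]\<^bsub>PGL2\<^esub> (n * m)) (psl A) = inv\<^bsub>PSL2\<^esub> (psl A)"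
  proof -
    have "\<tau> [^]\<^bsub>PGL2\<^esub> (n * m) = c \<otimes>\<^bsub>PGL2\<^esub> \<sigma> [^]\<^bsub>PGL2\<^esub> n \<otimes>\<^bsub>PGL2\<^esub> inv\<^bsub>PGL2\<^esub> c"
      using half_pow[OF u(1)] c \<sigma>(1) \<tau>(1) by (simp add: PGL2.nat_pow_pow flip: PGL2.conj_nat_pow)
    then have "\<tau> [^]\<^bsub>PGL2\<^esub> (n * m) \<otimes>\<^bsub>PGL2\<^esub> c = c \<otimes>\<^bsub>PGL2\<^esub> \<sigma> [^]\<^bsub>PGL2\<^esub> n"
      using c(1) \<sigma>(1) by (simp add: PGL2.m_assoc)
    then have "conj_action (\<tau> [^]\<^bsub>PGL2\<^esub> (n * m)) (conj_action c \<omega>) = conj_action c (conj_action (\<sigma> [^]\<^bsub>PGL2\<^esub> n) \<omega>)"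
      using c(1) \<sigma>(1) \<tau>(1) \<omega>c by (simp flip: conj_action_comp)
    also have "\<dots> = conj_action c (inv\<^bsub>PSL2\<^esub> \<omega>)" using half[OF \<omega>] pow_n by simp
    also have "\<dots> = inv\<^bsub>PSL2\<^esub> (conj_action c \<omega>)" by (rule conj_action_m_inv[OF c(1) \<omega>c])
    finally show ?thesis unfolding A(1) .
  qed
  have ni: "psl A \<otimes>\<^bsub>PSL2\<^esub> psl A \<noteq> \<one>\<^bsub>PSL2\<^esub>"
  proof
    assume eq: "psl A \<otimes>\<^bsub>PSL2\<^esub> psl A = \<one>\<^bsub>PSL2\<^esub>"
    interpret group_hom PSL2 PSL2 "conj_action c"
      using conj_action_iso[OF c(1)] by unfold_locales (auto simp: iso_def)
    have "conj_action c (\<omega> \<otimes>\<^bsub>PSL2\<^esub> \<omega>) = conj_action c \<one>\<^bsub>PSL2\<^esub>"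
      using eq hom_mult[OF \<omega>c \<omega>c] A(1) by simp
    then have "\<omega> \<otimes>\<^bsub>PSL2\<^esub> \<omega> = \<one>\<^bsub>PSL2\<^esub>"
      using conj_action_inv(1)[OF c(1)] \<omega>c by (metis PSL2.m_closed PSL2.one_closed)
    then show False using type \<omega> by (simp add: type_I_def)
  qed
  let ?S = "{(a, u). Q a \<and> coprime u (2 * n) \<and> 1 \<le> u \<and> u < n \<and>
        CM_data (\<tau> [^]\<^bsub>PGL2\<^esub> (m * u)) (F a) \<and> cayley_map PSL2 \<Omega> \<rho> \<cong>\<^sub>m CM (\<tau> [^]\<^bsub>PGL2\<^esub> (m * u)) (F a)}"
  \<comment> \<open>Stated for every representative of one class: \<open>A\<close> and
    \<open>- A\<close> produce the two members of the solution set.\<close>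
  have mem: "(trace B / 2, u) \<in> ?S" if B: "det B = 1" "psl B = psl A" for B
  proof -
    have "CM_data (\<tau> [^]\<^bsub>PGL2\<^esub> (m * u)) (psl B)"
      using transport_by_conj(1)[OF data \<sigma>(1) c(1) \<rho> \<omega> c(2)] A(1) B(2) by simp
    then have "Q (trace B / 2) \<and> (\<exists>c \<in> carrier PGL2. c \<otimes>\<^bsub>PGL2\<^esub> \<tau> = \<tau> \<otimes>\<^bsub>PGL2\<^esub> c \<and> conj_action c (psl B) = F (trace B / 2))"
      using inverted ni B(2) by (intro norm[OF u(1) B(1)]) simp_all
    then obtain c' where Q: "Q (trace B / 2)" and c': "c' \<in> carrier PGL2" "c' \<otimes>\<^bsub>PGL2\<^esub> \<tau> = \<tau> \<otimes>\<^bsub>PGL2\<^esub> c'"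
      "conj_action c' (psl B) = F (trace B / 2)" by blast
    have "c' \<otimes>\<^bsub>PGL2\<^esub> \<tau> \<otimes>\<^bsub>PGL2\<^esub> inv\<^bsub>PGL2\<^esub> c' = \<tau>" unfolding c'(2) using c'(1) \<tau>(1) by (simp add: PGL2.m_assoc)
    then have "c' \<otimes>\<^bsub>PGL2\<^esub> \<tau> [^]\<^bsub>PGL2\<^esub> (m * u) \<otimes>\<^bsub>PGL2\<^esub> inv\<^bsub>PGL2\<^esub> c' = \<tau> [^]\<^bsub>PGL2\<^esub> (m * u)"
      using PGL2.conj_nat_pow[OF c'(1) \<tau>(1), of "m * u"] by simp
    moreover have "(c' \<otimes>\<^bsub>PGL2\<^esub> c) \<otimes>\<^bsub>PGL2\<^esub> \<sigma> \<otimes>\<^bsub>PGL2\<^esub> inv\<^bsub>PGL2\<^esub> (c' \<otimes>\<^bsub>PGL2\<^esub> c) =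
        c' \<otimes>\<^bsub>PGL2\<^esub> (c \<otimes>\<^bsub>PGL2\<^esub> \<sigma> \<otimes>\<^bsub>PGL2\<^esub> inv\<^bsub>PGL2\<^esub> c) \<otimes>\<^bsub>PGL2\<^esub> inv\<^bsub>PGL2\<^esub> c'"
      using c'(1) c(1) \<sigma>(1) by (simp add: PGL2.inv_mult_group PGL2.m_assoc)
    ultimately have conj: "(c' \<otimes>\<^bsub>PGL2\<^esub> c) \<otimes>\<^bsub>PGL2\<^esub> \<sigma> \<otimes>\<^bsub>PGL2\<^esub> inv\<^bsub>PGL2\<^esub> (c' \<otimes>\<^bsub>PGL2\<^esub> c) = \<tau> [^]\<^bsub>PGL2\<^esub> (m * u)"
      by (simp only: c(2))
    have cc: "c' \<otimes>\<^bsub>PGL2\<^esub> c \<in> carrier PGL2" using c c' by simp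
    have "conj_action (c' \<otimes>\<^bsub>PGL2\<^esub> c) \<omega> = F (trace B / 2)"
      using conj_action_comp[OF c'(1) c(1) \<omega>c] A(1) B(2) c'(3) by simp
    then show ?thesis
      using transport_by_conj[OF data \<sigma>(1) cc \<rho> \<omega> conj] Q u by simp
  qed
  have only: "v = u \<and> (a = trace A / 2 \<or> a = - (trace A / 2))" if "(a, v) \<in> ?S" for a v
  proof -
    have v: "coprime v (2 * n)" "1 \<le> v" "v < n" and CM: "CM_data (\<tau> [^]\<^bsub>PGL2\<^esub> (m * v)) (F a)"
      "cayley_map PSL2 \<Omega> \<rho> \<cong>\<^sub>m CM (\<tau> [^]\<^bsub>PGL2\<^esub> (m * v)) (F a)"
      using \<open>(a, v) \<in> ?S\<close> by simp_all
    obtain B where B: "det B = 1" "trace B = 2 * a" "F a = psl B" using F(1) by blast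
    let ?\<tau> = "\<tau> [^]\<^bsub>PGL2\<^esub> (m * v)"
    have \<tau>v: "?\<tau> \<in> carrier PGL2" and Fa: "F a \<in> carrier PSL2" using \<tau>(1) B by simp_all
    have "?\<tau> [^]\<^bsub>PGL2\<^esub> n = \<tau> [^]\<^bsub>PGL2\<^esub> (n * m)" using half_pow[OF v(1)] \<tau>(1) by (simp add: PGL2.nat_pow_pow)
    then have "conj_action (?\<tau> [^]\<^bsub>PGL2\<^esub> n) (F a) = inv\<^bsub>PSL2\<^esub> (F a)" using F(2) by simp
    then obtain d where d: "d \<in> carrier PGL2" "d \<otimes>\<^bsub>PGL2\<^esub> \<sigma> \<otimes>\<^bsub>PGL2\<^esub> inv\<^bsub>PGL2\<^esub> d = ?\<tau>"
        "conj_action d ` \<Omega> = orbit_set ?\<tau> (F a)"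
      using isomorphic_CM_obtain_conj[OF data \<sigma>(1) \<rho> half \<tau>v Fa _ CM] by metis
    \<comment> \<open>Both powers of \<open>\<tau>\<close> are conjugates of
      \<open>\<sigma>\<close>; \<open>?d\<close> conjugates one to the other, so that
      \<open>uniq\<close> applies.\<close>
    let ?d = "d \<otimes>\<^bsub>PGL2\<^esub> inv\<^bsub>PGL2\<^esub> c"
    have "\<sigma> = inv\<^bsub>PGL2\<^esub> c \<otimes>\<^bsub>PGL2\<^esub> \<tau> [^]\<^bsub>PGL2\<^esub> (m * u) \<otimes>\<^bsub>PGL2\<^esub> c"
      unfolding c(2)[symmetric] using c(1) \<sigma>(1)
      by (simp add: PGL2.m_assoc) (simp flip: PGL2.m_assoc)
    then have "?d \<otimes>\<^bsub>PGL2\<^esub> \<tau> [^]\<^bsub>PGL2\<^esub> (m * u) \<otimes>\<^bsub>PGL2\<^esub> inv\<^bsub>PGL2\<^esub> ?d = ?\<tau>"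
      unfolding d(2)[symmetric] using c(1) d(1) \<tau>(1) by (simp add: PGL2.inv_mult_group PGL2.m_assoc)
    then have "?\<tau> = \<tau> [^]\<^bsub>PGL2\<^esub> (m * u) \<or> ?\<tau> \<otimes>\<^bsub>PGL2\<^esub> \<tau> [^]\<^bsub>PGL2\<^esub> (m * u) = \<one>\<^bsub>PGL2\<^esub>"
      using uniq[of ?d] d(1) c(1) by simp
    then have "v = u" by (intro PGL2.torus_pow_inj[OF \<tau> v(2,3) u(2,3)])
    \<comment> \<open>Exponents in \<open>orbit_set\<close> start at 1, so the base point is reached
      with exponent 2n instead of 0.\<close>
    have "\<tau> [^]\<^bsub>PGL2\<^esub> (m * v * (2 * n)) = \<one>\<^bsub>PGL2\<^esub>" using \<tau> by (simp add: PGL2.pow_eq_id)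
    then have "conj_action (?\<tau> [^]\<^bsub>PGL2\<^esub> (2 * n)) (F a) = F a"
      using \<tau>(1) Fa by (simp add: PGL2.nat_pow_pow)
    moreover have "1 \<le> 2 * n" using n by simp
    ultimately have "F a \<in> orbit_set ?\<tau> (F a)" unfolding orbit_set_def by (metis (mono_tags, lifting) mem_Collect_eq)
    then have "F a \<in> conj_action d ` \<Omega>" by (simp only: d(3))
    then obtain \<omega>' where \<omega>': "F a = conj_action d \<omega>'" "\<omega>' \<in> \<Omega>" by (rule imageE)
    obtain j where "\<omega>' = (\<rho> ^^ j) \<omega>" using cyclic_on_obtain[OF cyc \<omega> \<omega>'(2)] by metis
    then have j: "\<omega>' = conj_action (\<sigma> [^]\<^bsub>PGL2\<^esub> j) \<omega>" using pow_n by simp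
    \<comment> \<open>\<open>?e\<close> undoes \<open>c\<close>, rotates \<open>\<omega>\<close> to
      \<open>\<omega>'\<close> and applies \<open>d\<close>. It carries the class of
      \<open>A\<close> to \<open>F a\<close>, which fixes the trace up to sign.\<close>
    let ?e = "d \<otimes>\<^bsub>PGL2\<^esub> (\<sigma> [^]\<^bsub>PGL2\<^esub> j \<otimes>\<^bsub>PGL2\<^esub> inv\<^bsub>PGL2\<^esub> c)"
    have e: "?e \<in> carrier PGL2" using c(1) d(1) \<sigma>(1) by simp
    have "conj_action (inv\<^bsub>PGL2\<^esub> c) (psl A) = \<omega>" using conj_action_inv(1)[OF c(1) \<omega>c] A(1) by simp
    then have "conj_action ?e (psl A) = psl B"
      using c(1) d(1) \<sigma>(1) A(2) \<omega>'(1) j B(3) by (simp add: conj_action_comp)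
    then have "(2 * a)\<^sup>2 = (trace A)\<^sup>2" using conj_action_trace[OF e] B(2) by metis
    then have "2 * a = trace A \<or> 2 * a = - trace A" by (simp only: power2_eq_iff)
    then have "a = trace A / 2 \<or> a = - (trace A / 2)"
    proof
      assume "2 * a = trace A"
      then show ?thesis using two by (metis nonzero_mult_div_cancel_left)
    next
      assume "2 * a = - trace A"
      then show ?thesis using two by (metis nonzero_mult_div_cancel_left minus_divide_left)
    qed
    then show ?thesis using \<open>v = u\<close> by blast
  qed
  have "(- (trace A / 2), u) \<in> ?S"
    using mem[of "- A"] A(2) by (simp add: minus_divide_left del: divide_minus_left)
  then have "{(trace A / 2, u), (- (trace A / 2), u)} \<subseteq> ?S" using mem[OF A(2) refl] by blast
  moreover have "?S \<subseteq> {(trace A / 2, u), (- (trace A / 2), u)}"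
  proof (rule subrelI)
    fix a v assume "(a, v) \<in> ?S"
    then have "v = u \<and> (a = trace A / 2 \<or> a = - (trace A / 2))" by (rule only)
    then show "(a, v) \<in> {(trace A / 2, u), (- (trace A / 2), u)}" by blast
  qed
  ultimately have "?S = {(trace A / 2, u), (- (trace A / 2), u)}" by (rule subset_antisym[rotated])
  then show ?thesis by blast
qed

end


section \<open>The split torus\<close>

lemma diag_orbit_set:
  fixes t :: "'k::field"
  assumes t: "t \<noteq> 0" and A: "a * d - b * c = 1"
    and X: "psl X \<in> orbit_set (pgl (matrix2 t 0 0 1)) (psl (matrix2 a b c d))"
  obtains j where "X = matrix2 a (b * t ^ j) (c / t ^ j) d \<or> X = - matrix2 a (b * t ^ j) (c / t ^ j) d"
proof -
  obtain j where "psl X = conj_action (pgl (matrix2 t 0 0 1) [^]\<^bsub>PGL2\<^esub> (j::nat)) (psl (matrix2 a b c d))"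
    using X by (auto simp: orbit_set_def)
  also have "\<dots> = conj_action (pgl (matrix2 (t ^ j) 0 0 1)) (psl (matrix2 a b c d))"
    by (simp only: diag_pow[OF t])
  also have "\<dots> = psl (matrix2 a (b * t ^ j) (c / t ^ j) d)"
    using t by (intro conj_action_psl_eqI) simp_all
  finally show ?thesis using that by (simp add: psl_eq_iff)
qed

text \<open>Diagonal conjugation only rescales the off-diagonal entries. If one vanished, the whole
  connection set would be triangular and could not generate.\<close>

lemma diag_offdiagonal_nonzero:
  fixes t :: "'k::field"
  assumes data: "CM_data (pgl (matrix2 t 0 0 1)) (psl (matrix2 a b c d))"
    and t: "t \<noteq> 0" and A: "a * d - b * c = 1"
  shows "b \<noteq> 0" "c \<noteq> 0"
proof -
  note data' = data[unfolded CM_data_def]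
  show "b \<noteq> 0"
  proof
    assume "b = 0"
    have "matrix2 1 1 0 1 $ 1 $ 2 = (0::'k)"
    proof (rule generate_PSL2_induct[OF data', where P = "\<lambda>X. X $ 1 $ 2 = 0"])
      show "(X ** Y) $ 1 $ 2 = 0" if "X $ 1 $ 2 = 0" "Y $ 1 $ 2 = 0" for X Y :: "'k^2^2"
        using that by (simp add: matrix_matrix_mult_def sum_2)
      show "X $ 1 $ 2 = 0" if "psl X \<in> orbit_set (pgl (matrix2 t 0 0 1)) (psl (matrix2 a b c d))" for X
        by (rule diag_orbit_set[OF t A that]) (auto simp: \<open>b = 0\<close>)
    qed (simp_all add: mat_eq_matrix2)
    then show False by simp
  qed
  show "c \<noteq> 0"
  proof
    assume "c = 0"
    have "matrix2 1 0 1 1 $ 2 $ 1 = (0::'k)"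
    proof (rule generate_PSL2_induct[OF data', where P = "\<lambda>X. X $ 2 $ 1 = 0"])
      show "(X ** Y) $ 2 $ 1 = 0" if "X $ 2 $ 1 = 0" "Y $ 2 $ 1 = 0" for X Y :: "'k^2^2"
        using that by (simp add: matrix_matrix_mult_def sum_2)
      show "X $ 2 $ 1 = 0" if "psl X \<in> orbit_set (pgl (matrix2 t 0 0 1)) (psl (matrix2 a b c d))" for X
        by (rule diag_orbit_set[OF t A that]) (auto simp: \<open>c = 0\<close>)
    qed (simp_all add: mat_eq_matrix2)
    then show False by simp
  qed
qed

text \<open>
  If \<open>\<sigma>\<close> has order 4 and \<open>2a\<^sup>2 = 1\<close>, then \<open>\<Omega>\<close> generates a group isomorphic to \<open>S\<^sub>4\<close>: it permutes
  by conjugation the three involutions of the Klein group, represented by the matrices below.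
\<close>

definition klein :: "'k::field \<Rightarrow> 'k \<Rightarrow> 'k \<Rightarrow> 'k \<Rightarrow> ('k^2^2) set" where
  "klein a i b c = (let Z = matrix2 i 0 0 (- i); X = matrix2 0 (2 * a * b) (2 * a * c) 0;
      Y = matrix2 0 (2 * a * b * i) (- (2 * a * c * i)) 0 in {Z, - Z, X, - X, Y, - Y})"

text \<open>Conjugation by diag(i, 1) multiplies \<open>b\<close> by \<open>i\<close> and divides
  \<open>c\<close> by \<open>i\<close>. It interchanges the two antidiagonal involutions up to sign,
  so a single Klein group serves the whole orbit.\<close>

lemma klein_rotate:
  assumes "i\<^sup>2 = - 1" shows "klein a i (b * i) (c / i) = klein a i b c"
proof -
  have "i \<noteq> 0" using assms by auto
  have ii: "i * i = - 1" using assms by (simp add: power2_eq_square)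
  then have "1 / i = - i" using \<open>i \<noteq> 0\<close> by (simp add: divide_eq_eq)
  then have ci: "c / i = - (c * i)" by (metis mult.right_neutral mult_minus_right times_divide_eq_right)
  have m: "x * i * i = - x" for x using ii by (simp add: mult.assoc)
  show ?thesis unfolding klein_def ci Let_def by (auto simp: m mult.assoc[symmetric])
qed

text \<open>Origin of the matrices: under these relations \<open>?X\<close> is the square of
  \<open>?g\<close>, \<open>?Z\<close> is a scalar multiple of diag(-1, 1), the square of the
  rotating element diag(i, 1), and \<open>?Y\<close> is the product of \<open>?Z\<close> and
  \<open>?X\<close>. So \<open>?g\<close> commutes with \<open>?X\<close> and sends
  \<open>?Y\<close> to \<open>?Z\<close> and \<open>?Z\<close> to \<open>- ?Y\<close>, a quarter
  turn of the octahedron.\<close>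

lemma klein_conj:
  fixes a i b c :: "'k::field"
  assumes i: "i\<^sup>2 = - 1" and a: "2 * a\<^sup>2 = 1" and bc: "2 * (b * c) = - 1"
    and k: "k \<in> klein a i b c"
  shows "\<exists>k' \<in> klein a i b c. matrix2 a b c a ** k = k' ** matrix2 a b c a"
proof -
  have aa: "2 * a * a = 1" "2 * a * a * x = x" for x
    using a by (simp_all add: power2_eq_square mult.assoc)
  let ?Z = "matrix2 i 0 0 (- i)" and ?X = "matrix2 0 (2 * a * b) (2 * a * c) 0"
    and ?Y = "matrix2 0 (2 * a * b * i) (- (2 * a * c * i)) 0" and ?g = "matrix2 a b c a"
  have r: "2 * a * b * c = - a" "2 * a * c * b = - a" "2 * a * b * i * c = - (a * i)" "2 * a * c * i * b = - (a * i)"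
  proof -
    have "2 * a * b * c = a * (2 * (b * c))" by (simp add: mult_ac)
    then show *: "2 * a * b * c = - a" unfolding bc by simp
    then show "2 * a * c * b = - a" by (simp add: mult_ac)
    have "2 * a * b * i * c = (2 * a * b * c) * i" by (simp add: mult_ac)
    then show "2 * a * b * i * c = - (a * i)" unfolding * by simp
    then show "2 * a * c * i * b = - (a * i)" by (simp add: mult_ac)
  qed
  have q: "2 * a * b * a = b" "2 * a * c * a = c" "2 * a * b * i * a = b * i" "2 * a * c * i * a = c * i"
  proof -
    have "2 * a * b * a = 2 * a * a * b" by (simp add: mult_ac)
    then show "2 * a * b * a = b" unfolding aa(2) .
    have "2 * a * c * a = 2 * a * a * c" by (simp add: mult_ac)
    then show "2 * a * c * a = c" unfolding aa(2) .
    have "2 * a * b * i * a = 2 * a * a * (b * i)" by (simp add: mult_ac)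
    then show "2 * a * b * i * a = b * i" unfolding aa(2) .
    have "2 * a * c * i * a = 2 * a * a * (c * i)" by (simp add: mult_ac)
    then show "2 * a * c * i * a = c * i" unfolding aa(2) .
  qed
  have c: "a * (2 * a * b) = b" "a * (2 * a * c) = c" "b * (2 * a * c) = - a" "c * (2 * a * b) = - a"
    "a * (2 * a * b * i) = b * i" "a * (2 * a * c * i) = c * i" "b * (2 * a * c * i) = - (a * i)" "c * (2 * a * b * i) = - (a * i)"
    using r q by (simp_all only: mult.commute[of a "_ * _"] mult.commute[of b "_ * _"] mult.commute[of c "_ * _"])
  have X: "?g ** ?X = ?X ** ?g" and Y: "?g ** ?Y = ?Z ** ?g" and Z: "?g ** ?Z = (- ?Y) ** ?g"
    unfolding matrix2_mult uminus_matrix2 matrix2_eq_iff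
    by (simp_all only: mult_minus_left mult_minus_right minus_minus r q c mult_zero_left mult_zero_right add_0_left add_0_right)
      (simp_all add: mult.commute)
  show ?thesis
    using k X Y Z unfolding klein_def Let_def
    by (auto simp del: matrix2_mult uminus_matrix2 matrix2_eq_iff)
qed

lemma diag_order_4_trace:
  fixes a i :: "'k::field"
  assumes data: "CM_data (pgl (matrix2 i 0 0 1)) (psl (matrix2 a b c a))"
    and i: "i\<^sup>2 = - 1" and det: "a * a - b * c = 1" and two: "(2::'k) \<noteq> 0"
  shows "2 * a\<^sup>2 \<noteq> 1"
proof
  assume a: "2 * a\<^sup>2 = 1"
  have i0: "i \<noteq> 0" using i by auto
  have bc: "2 * (b * c) = - 1"
  proof -
    have "b * c = a\<^sup>2 - 1" using det by (simp add: power2_eq_square algebra_simps)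
    then have "2 * (b * c) = 2 * a\<^sup>2 - 2 * 1" by (simp only: right_diff_distrib)
    then show ?thesis unfolding a by simp
  qed
  let ?P = "\<lambda>M. \<forall>k \<in> klein a i b c. \<exists>k' \<in> klein a i b c. M ** k = k' ** M"
  have rot: "klein a i (b * i ^ j) (c / i ^ j) = klein a i b c" for j
  proof (induction j)
    case (Suc j)
    then show ?case using klein_rotate[OF i, of a "b * i ^ j" "c / i ^ j"] by (simp add: mult_ac)
  qed simp
  have P_neg: "?P (- M)" if "?P M" for M using that by simp
  have "?P (matrix2 1 1 0 1)"
  proof (rule generate_PSL2_induct[OF data[unfolded CM_data_def], where P = ?P])
    show "?P (mat 1)" by auto
    show "?P (- M)" if "?P M" for M using P_neg that .
    show "?P (M ** N)" if M: "?P M" and N: "?P N" for M N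
    proof
      fix k assume "k \<in> klein a i b c"
      then obtain k' where k': "k' \<in> klein a i b c" "N ** k = k' ** N" using N by blast
      then obtain k'' where k'': "k'' \<in> klein a i b c" "M ** k' = k'' ** M" using M by blast
      have "(M ** N) ** k = k'' ** (M ** N)"
        by (metis k'(2) k''(2) matrix_mul_assoc)
      then show "\<exists>k' \<in> klein a i b c. (M ** N) ** k = k' ** (M ** N)" using k''(1) by blast
    qed
    show "?P X" if X: "psl X \<in> orbit_set (pgl (matrix2 i 0 0 1)) (psl (matrix2 a b c a))" for X
    proof (rule diag_orbit_set[OF i0 det X])
      fix j
      let ?g = "matrix2 a (b * i ^ j) (c / i ^ j) a"
      have "2 * ((b * i ^ j) * (c / i ^ j)) = - 1" using i0 bc by simp
      from klein_conj[OF i a this] have P: "?P ?g" unfolding rot by blast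
      assume "X = ?g \<or> X = - ?g"
      then show "?P X" using P P_neg[OF P] by metis
    qed
  qed simp
  moreover have "matrix2 i 0 0 (- i) \<in> klein a i b c" by (simp add: klein_def Let_def)
  \<comment> \<open>Conjugating diag(i, -i) by the unipotent gives a triangular matrix with corner
    -2i, which is neither diagonal nor antidiagonal.\<close>
  ultimately obtain k where "k \<in> klein a i b c" "matrix2 1 1 0 1 ** matrix2 i 0 0 (- i) = k ** matrix2 1 1 0 1" by blast
  moreover have "i \<noteq> - i" using i0 eq_minus_self_iff[OF two, of i] by simp
  ultimately show False using i0 by (auto simp: klein_def Let_def)
qed

context quadratic_extension
begin

lemma \<alpha>_inverter:
  "pgl (matrix2 0 1 1 0) \<otimes>\<^bsub>PGL2\<^esub> \<alpha> \<otimes>\<^bsub>PGL2\<^esub> inv\<^bsub>PGL2\<^esub> (pgl (matrix2 0 1 1 0)) = inv\<^bsub>PGL2\<^esub> \<alpha>"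
proof -
  have "pgl (matrix2 0 1 1 0) \<otimes>\<^bsub>PGL2\<^esub> \<alpha> \<otimes>\<^bsub>PGL2\<^esub> inv\<^bsub>PGL2\<^esub> (pgl (matrix2 0 1 1 0)) = pgl (matrix2 1 0 0 e)"
    unfolding \<alpha>_def alpha_pgl_def by (rule pgl_conj_eqI) (simp_all add: e0)
  also have "\<dots> = inv\<^bsub>PGL2\<^esub> \<alpha>"
  proof (rule PGL2.inv_equality[symmetric])
    have "pgl (matrix2 e 0 0 e) = \<one>\<^bsub>PGL2\<^esub>" using e0 by (subst pgl_scalar_iff) (auto simp: mat_eq_matrix2)
    then show "pgl (matrix2 1 0 0 e) \<otimes>\<^bsub>PGL2\<^esub> \<alpha> = \<one>\<^bsub>PGL2\<^esub>"
      unfolding \<alpha>_def alpha_pgl_def using e0 by (simp add: pgl_mult)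
  qed (use e0 in simp_all)
  finally show ?thesis .
qed

lemma ord_\<alpha>: "PGL2.ord \<alpha> = p - 1"
  using PGL2.ord_unique[OF \<alpha>_closed] \<alpha>_pow_eq_1_iff by blast

lemma \<alpha>_half: "\<alpha> [^]\<^bsub>PGL2\<^esub> ((p - 1) div 2) = pgl (matrix2 (- 1) 0 0 1)"
  by (simp only: \<alpha>_pow e_half)

lemma omega_i_inverted:
  "conj_action (\<alpha> [^]\<^bsub>PGL2\<^esub> ((p - 1) div 2)) (omega_i a) = inv\<^bsub>PSL2\<^esub> (omega_i a)"
proof -
  have "inv\<^bsub>PSL2\<^esub> (omega_i a) = psl (matrix2 a (- 1) (1 - a\<^sup>2) a)"
    unfolding omega_i_def by (subst inv_psl) (simp_all add: power2_eq_square)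
  then show ?thesis
    unfolding \<alpha>_half omega_i_def by (simp only:) (rule conj_action_psl_eqI; simp)
qed

text \<open>Since \<open>b \<noteq> 0\<close>, being inverted by diag(-1, 1) means that the diagonal
  entries agree. Conjugation by diag(1/b, 1), which commutes with \<open>\<alpha>\<close>, then
  normalises the upper right entry to 1. For \<open>n = 2\<close> the entry \<open>e ^ k\<close> is
  a square root of -1, so the octahedral case is excluded.\<close>

lemma split_normal_form:
  fixes A :: "'k^2^2"
  assumes A: "det A = 1" and data: "CM_data (\<alpha> [^]\<^bsub>PGL2\<^esub> (k::nat)) (psl A)"
    and inverted: "conj_action (\<alpha> [^]\<^bsub>PGL2\<^esub> ((p - 1) div 2)) (psl A) = inv\<^bsub>PSL2\<^esub> (psl A)"
    and order_4: "n = 2 \<Longrightarrow> e ^ (2 * k) = - 1"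
    and ni: "psl A \<otimes>\<^bsub>PSL2\<^esub> psl A \<noteq> \<one>\<^bsub>PSL2\<^esub>"
  shows "(trace A / 2 \<notin> {1, - 1, 0} \<and> (n = 2 \<longrightarrow> 2 * (trace A / 2)\<^sup>2 \<noteq> 1)) \<and>
    (\<exists>c \<in> carrier PGL2. c \<otimes>\<^bsub>PGL2\<^esub> \<alpha> = \<alpha> \<otimes>\<^bsub>PGL2\<^esub> c \<and> conj_action c (psl A) = omega_i (trace A / 2))"
proof (cases A rule: matrix2_cases)
  case (1 a b c d)
  have det: "a * d - b * c = 1" using A 1 by simp
  have ek: "e ^ k \<noteq> 0" using e0 by simp
  note data' = data[unfolded \<alpha>_pow 1]
  have bc: "b \<noteq> 0" "c \<noteq> 0" using diag_offdiagonal_nonzero[OF data' ek det] by auto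
  have "conj_action (\<alpha> [^]\<^bsub>PGL2\<^esub> ((p - 1) div 2)) (psl A) = psl (matrix2 a (- b) (- c) d)"
    unfolding \<alpha>_half 1 by (rule conj_action_psl_eqI) simp_all
  then have "psl (matrix2 a (- b) (- c) d) = psl (matrix2 d (- b) (- c) a)"
    unfolding inverted unfolding 1 inv_psl[OF det] by simp
  then have "d = a \<or> b = - b"
    unfolding psl_eq_iff uminus_matrix2 matrix2_eq_iff minus_minus by metis
  then have "d = a" using bc eq_minus_self_iff[OF two, of b] by blast
  then have det': "a * a - b * c = 1" and tr: "trace A / 2 = a"
    using det two 1 by (simp_all flip: mult_2)
  have "a \<noteq> 0"
    using trace_0_imp_involution[OF A] ni 1 \<open>d = a\<close> by auto
  moreover have "a\<^sup>2 \<noteq> 1" using det' bc by (auto simp: power2_eq_square)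
  then have "a \<noteq> 1" "a \<noteq> - 1" by auto
  moreover have "2 * a\<^sup>2 \<noteq> 1" if "n = 2"
  proof (rule diag_order_4_trace[OF data'[unfolded \<open>d = a\<close>] _ det' two])
    show "(e ^ k)\<^sup>2 = - 1" using order_4[OF that] by (simp add: power_mult mult.commute flip: power_mult)
  qed
  moreover have "conj_action (pgl (matrix2 (1 / b) 0 0 1)) (psl A) = omega_i a"
    unfolding omega_i_def 1 \<open>d = a\<close>
  proof (rule conj_action_psl_eqI)
    have "a\<^sup>2 - 1 = c * b" using det' by (simp add: power2_eq_square algebra_simps)
    then show "matrix2 (1 / b) 0 0 1 ** matrix2 a b c a = matrix2 a 1 (a\<^sup>2 - 1) a ** matrix2 (1 / b) 0 0 1"
      using bc by simp
  qed (use bc in simp)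
  moreover have "pgl (matrix2 (1 / b) 0 0 1) \<otimes>\<^bsub>PGL2\<^esub> \<alpha> = \<alpha> \<otimes>\<^bsub>PGL2\<^esub> pgl (matrix2 (1 / b) 0 0 1)"
    unfolding \<alpha>_def alpha_pgl_def using bc e0 by (simp add: pgl_mult)
  moreover have "pgl (matrix2 (1 / b) 0 0 1) \<in> carrier PGL2" using bc by simp
  ultimately show ?thesis unfolding tr by blast
qed


section \<open>The non-split torus\<close>

text \<open>diag(1, -1) acts on the torus as conjugation of the quadratic extension, and the product
  with the conjugate is a norm, hence scalar.\<close>

lemma \<gamma>_inverter:
  "pgl (matrix2 1 0 0 (- 1)) \<otimes>\<^bsub>PGL2\<^esub> \<gamma> \<otimes>\<^bsub>PGL2\<^esub> inv\<^bsub>PGL2\<^esub> (pgl (matrix2 1 0 0 (- 1))) = inv\<^bsub>PGL2\<^esub> \<gamma>"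
proof -
  have det: "det (torus w1 w2) \<noteq> 0" "det (torus w1 (- w2)) \<noteq> 0" using w2 by (auto intro!: det_torus)
  have "pgl (matrix2 1 0 0 (- 1)) \<otimes>\<^bsub>PGL2\<^esub> \<gamma> \<otimes>\<^bsub>PGL2\<^esub> inv\<^bsub>PGL2\<^esub> (pgl (matrix2 1 0 0 (- 1))) = pgl (torus w1 (- w2))"
    unfolding \<gamma>_def by (rule pgl_conj_eqI) (use det in \<open>simp_all add: torus_def\<close>)
  also have "\<dots> = inv\<^bsub>PGL2\<^esub> \<gamma>"
  proof (rule PGL2.inv_equality[symmetric])
    have "torus w1 (- w2) ** torus w1 w2 = mat (w1 * w1 - e * w2 * w2)"
      by (simp add: torus_def mat_eq_matrix2 mult_ac)
    moreover have "det (torus w1 (- w2) ** torus w1 w2) \<noteq> 0" using det by (simp add: det_mul)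
    ultimately have "pgl (torus w1 (- w2) ** torus w1 w2) = \<one>\<^bsub>PGL2\<^esub>" using pgl_scalar_iff by metis
    then show "pgl (torus w1 (- w2)) \<otimes>\<^bsub>PGL2\<^esub> \<gamma> = \<one>\<^bsub>PGL2\<^esub>"
      unfolding \<gamma>_def by (simp only: pgl_mult[OF det(2,1)])
  qed (use det in simp_all)
  finally show ?thesis .
qed

lemma ord_\<gamma>: "PGL2.ord \<gamma> = p + 1"
  using PGL2.ord_unique[OF \<gamma>_closed] \<gamma>_pow_eq_1_iff by blast

text \<open>Identified as the only involution of the torus: the square of x + y s is in the subfield
  only if x y = 0, and \<open>y \<noteq> 0\<close> leaves the class of \<open>s\<close>.\<close>

lemma \<gamma>_half: "\<gamma> [^]\<^bsub>PGL2\<^esub> ((p + 1) div 2) = pgl (matrix2 0 e 1 0)"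
proof -
  obtain x y where xy: "x \<noteq> 0 \<or> y \<noteq> 0" "\<gamma> [^]\<^bsub>PGL2\<^esub> ((p + 1) div 2) = pgl (torus x y)"
    using \<gamma>_pow by metis
  have det: "det (torus x y) \<noteq> 0" by (rule det_torus[OF xy(1)])
  have "\<not> p + 1 dvd (p + 1) div 2" using p(2) by (auto dest!: dvd_imp_le)
  then have "pgl (torus x y) \<noteq> \<one>\<^bsub>PGL2\<^esub>" using \<gamma>_pow_eq_1_iff xy(2) by metis
  then have "y \<noteq> 0" using det by (auto simp: pgl_scalar_iff torus_def mat_eq_matrix2)
  have "(p + 1) div 2 + (p + 1) div 2 = p + 1" using odd_p by presburger
  then have "pgl (torus x y) \<otimes>\<^bsub>PGL2\<^esub> pgl (torus x y) = \<one>\<^bsub>PGL2\<^esub>"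
    unfolding xy(2)[symmetric] using \<gamma>_pow_eq_1_iff[of "p + 1"] by (simp only: PGL2.nat_pow_mult[OF \<gamma>_closed] dvd_refl)
  then have "pgl (torus x y ** torus x y) = \<one>\<^bsub>PGL2\<^esub>" using det by (simp add: pgl_mult)
  moreover have "det (torus x y ** torus x y) \<noteq> 0" using det by (simp add: det_mul)
  ultimately obtain r where "torus x y ** torus x y = mat r" using pgl_scalar_iff by metis
  then have "y * x + x * y = 0" by (simp add: torus_def mat_eq_matrix2)
  then have "2 * (y * x) = 0" by (simp add: mult.commute)
  then have "x = 0" using \<open>y \<noteq> 0\<close> two by simp
  then have "torus x y = mat y ** matrix2 0 e 1 0" by (simp add: torus_def mult.commute)
  then show ?thesis unfolding xy(2) by (simp only: pgl_mat_mult[OF \<open>y \<noteq> 0\<close>])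
qed

text \<open>Being inverted means \<open>b = - (e * h)\<close>, the other sign forcing trace 0. Then
  A = a + N, where N acts on the quadratic extension by sending v to \<xi> times the conjugate of v,
  with \<xi> = X + h s. Conjugating by a torus element t multiplies \<xi> by t over its conjugate,
  and determinant 1 says that \<xi> has norm a^2 - 1. By Hilbert 90 any two solutions of this norm
  equation are related by the torus.\<close>

lemma nonsplit_normal_form:
  fixes A :: "'k^2^2" and x z :: "'k \<Rightarrow> 'k"
  assumes A: "det A = 1" and xz: "\<And>a. (x a - a)\<^sup>2 - e * (z a)\<^sup>2 = a\<^sup>2 - 1"
    and inverted: "conj_action (\<gamma> [^]\<^bsub>PGL2\<^esub> ((p + 1) div 2)) (psl A) = inv\<^bsub>PSL2\<^esub> (psl A)"
    and ni: "psl A \<otimes>\<^bsub>PSL2\<^esub> psl A \<noteq> \<one>\<^bsub>PSL2\<^esub>"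
  shows "trace A / 2 \<notin> {1, - 1, 0} \<and>
    (\<exists>c \<in> carrier PGL2. c \<otimes>\<^bsub>PGL2\<^esub> \<gamma> = \<gamma> \<otimes>\<^bsub>PGL2\<^esub> c \<and> conj_action c (psl A) = omega_tilde_i e x z (trace A / 2))"
proof (cases A rule: matrix2_cases)
  case (1 q b h d)
  have det: "q * d - b * h = 1" using A 1 by simp
  have tr0: "trace A \<noteq> 0" using trace_0_imp_involution[OF A] ni by blast
  have "conj_action (\<gamma> [^]\<^bsub>PGL2\<^esub> ((p + 1) div 2)) (psl A) = psl (matrix2 d (e * h) (b / e) q)"
    unfolding \<gamma>_half 1 by (rule conj_action_psl_eqI) (use e0 in simp_all)
  then have "psl (matrix2 d (e * h) (b / e) q) = psl (matrix2 d (- b) (- h) q)"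
    unfolding inverted unfolding 1 inv_psl[OF det] by simp
  then have "- b = e * h \<or> d = - d \<and> q = - q"
    unfolding psl_eq_iff uminus_matrix2 matrix2_eq_iff by metis
  moreover have "\<not> (d = - d \<and> q = - q)"
    using tr0 1 eq_minus_self_iff[OF two, of d] eq_minus_self_iff[OF two, of q] by fastforce
  ultimately have b: "b = - (e * h)" by (metis minus_minus)
  define a where "a = trace A / 2"
  define X where "X = q - a"
  have "2 * a = q + d" using 1 two by (simp add: a_def)
  then have q: "q = a + X" and d: "d = a - X" by (simp_all add: X_def algebra_simps)
  have norm: "X\<^sup>2 - e * h\<^sup>2 = a\<^sup>2 - 1"
    using det unfolding q d b by (simp add: algebra_simps power2_eq_square)
  have "a \<noteq> 0" using tr0 two by (simp add: a_def)
  moreover have "a\<^sup>2 \<noteq> 1"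
  proof
    assume "a\<^sup>2 = 1"
    then have eq: "X\<^sup>2 = e * h\<^sup>2" using norm by simp
    \<comment> \<open>The norm form is anisotropic, so norm 0 forces \<open>X = h = 0\<close> and
      \<open>A\<close> is plus or minus the identity.\<close>
    have "h = 0"
    proof (rule ccontr)
      assume "h \<noteq> 0"
      then have "(X / h)\<^sup>2 = e" using eq by (simp add: power_divide)
      then show False using e_not_square by blast
    qed
    then have "X = 0" using eq by simp
    then have "A ** A = mat 1" using \<open>a\<^sup>2 = 1\<close> \<open>h = 0\<close> unfolding 1 q d b
      by (simp add: mat_eq_matrix2 power2_eq_square)
    then show False using ni A by (simp add: psl_mult one_PSL2)
  qed
  moreover define X' where "X' = x a - a"
  define h' where "h' = z a"
  have norm': "X'\<^sup>2 - e * h'\<^sup>2 = a\<^sup>2 - 1" unfolding X'_def h'_def by (rule xz)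
  \<comment> \<open>Hilbert 90 made explicit: with \<xi>' = X' + h' s, the element t = r + s sqrt(e)
    is \<xi>' plus the conjugate of \<xi>. If that sum vanishes, sqrt(e) times the conjugate of
    \<xi> works instead, taken here with the opposite sign.\<close>
  obtain r s where rs: "r \<noteq> 0 \<or> s \<noteq> 0" "r * (X' - X) = e * s * (h + h')" "r * (h' - h) = s * (X + X')"
  proof (cases "X + X' = 0 \<and> h' - h = 0")
    case False
    have "(X + X') * (X' - X) = X'\<^sup>2 - X\<^sup>2" by (simp add: algebra_simps power2_eq_square)
    also have "\<dots> = e * h'\<^sup>2 - e * h\<^sup>2"
      unfolding norm[unfolded diff_eq_eq] norm'[unfolded diff_eq_eq] by simp
    also have "\<dots> = e * (h' - h) * (h + h')" by (simp add: algebra_simps power2_eq_square)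
    finally show ?thesis using False by (intro that[of "X + X'" "h' - h"]) (auto simp: mult.commute)
  next
    case True
    then have *: "X' = - X" "h' = h" by (simp_all add: add_eq_0_iff)
    have "h \<noteq> 0 \<or> X \<noteq> 0" using norm \<open>a\<^sup>2 \<noteq> 1\<close> by auto
    then show ?thesis using e0 by (intro that[of "e * h" "- X"]) (auto simp: * algebra_simps)
  qed
  have "conj_action (pgl (torus r s)) (psl A) = omega_tilde_i e x z a"
    unfolding omega_tilde_i_def 1
  proof (rule conj_action_psl_eqI)
    show "det (torus r s) \<noteq> 0" by (rule det_torus[OF rs(1)])
    have x: "x a = a + X'" "2 * a - x a = a - X'" by (simp_all add: X'_def)
    have rs': "r * X' = r * X + e * s * (h + h')" "r * h' = r * h + s * (X + X')"
      using rs(2,3) by (simp_all add: algebra_simps)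
    have e1: "r * (a + X) + e * s * h = (a + X') * r + - e * h' * s"
      using rs'(1) by (simp add: algebra_simps)
    have e2: "r * - (e * h) + e * s * (a - X) = (a + X') * (e * s) + - e * h' * r"
    proof -
      have "e * (r * h') = e * (r * h + s * (X + X'))" by (simp only: rs'(2))
      then show ?thesis by (simp add: algebra_simps)
    qed
    have e3: "s * (a + X) + r * h = h' * r + (a - X') * s"
      using rs'(2) by (simp add: algebra_simps)
    have e4: "s * - (e * h) + r * (a - X) = h' * (e * s) + (a - X') * r"
      using rs'(1) by (simp add: algebra_simps)
    show "torus r s ** matrix2 q b h d = matrix2 (x a) (- e * z a) (z a) (2 * a - x a) ** torus r s"
      unfolding torus_def matrix2_mult matrix2_eq_iff x(2) unfolding x(1) q d b h'_def[symmetric]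
      using e1 e2 e3 e4 by blast
  qed
  moreover have "pgl (torus r s) \<otimes>\<^bsub>PGL2\<^esub> \<gamma> = \<gamma> \<otimes>\<^bsub>PGL2\<^esub> pgl (torus r s)"
  proof -
    have "torus r s ** torus w1 w2 = torus w1 w2 ** torus r s" by (simp add: torus_def algebra_simps)
    then show ?thesis unfolding \<gamma>_def using det_torus[OF rs(1)] det_torus[of w1 w2] w2 by (simp add: pgl_mult)
  qed
  moreover have "pgl (torus r s) \<in> carrier PGL2" using det_torus[OF rs(1)] by simp
  moreover have "a \<noteq> 1" "a \<noteq> - 1" using \<open>a\<^sup>2 \<noteq> 1\<close> by auto
  ultimately show ?thesis unfolding a_def[symmetric] by blast
qed

lemma omega_tilde_i_inverted:
  assumes xz: "\<And>a. (x a - a)\<^sup>2 - e * (z a)\<^sup>2 = a\<^sup>2 - 1"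
  shows "x a * (2 * a - x a) - - e * z a * z a = 1"
    and "conj_action (\<gamma> [^]\<^bsub>PGL2\<^esub> ((p + 1) div 2)) (omega_tilde_i e x z a) = inv\<^bsub>PSL2\<^esub> (omega_tilde_i e x z a)"
proof -
  have "x a * (2 * a - x a) - - e * z a * z a = a\<^sup>2 - ((x a - a)\<^sup>2 - e * (z a)\<^sup>2)"
    by (simp add: algebra_simps power2_eq_square)
  then show det: "x a * (2 * a - x a) - - e * z a * z a = 1" unfolding xz by simp
  show "conj_action (\<gamma> [^]\<^bsub>PGL2\<^esub> ((p + 1) div 2)) (omega_tilde_i e x z a) = inv\<^bsub>PSL2\<^esub> (omega_tilde_i e x z a)"
    unfolding omega_tilde_i_def inv_psl[OF det] \<gamma>_half
    by (rule conj_action_psl_eqI) (use e0 in \<open>simp_all add: mult_ac\<close>)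
qed

end

theorem theorem3p3:
  fixes p n :: nat
    and e w w1 w2 :: "'k::{field, finite}"
    and x z :: "'k \<Rightarrow> 'k"
    and \<iota> :: "'k \<Rightarrow> 'l::{field, finite}"
    and sqrt_e :: 'l
    and \<Omega> :: "('k ^ 2 ^ 2) set set"
    and \<rho> :: "('k ^ 2 ^ 2) set \<Rightarrow> ('k ^ 2 ^ 2) set"
  assumes "prime p" and "p > 5"
    and "CARD('k) = p" and "CARD('l) = p\<^sup>2" and "field_embedding \<iota>"
    and "generates_units e"
    and "sqrt_e\<^sup>2 = \<iota> e"
    and "generates_units (\<iota> w1 + \<iota> w2 * sqrt_e)" and "w = w1 / w2"
    and "\<forall>a. (x a - a)\<^sup>2 - e * (z a)\<^sup>2 = a\<^sup>2 - 1"
    and "cayley_map_data PSL2 \<Omega> \<rho>"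
    and "card \<Omega> = 2 * n"
    and "regular_map (cayley_map PSL2 \<Omega> \<rho>)"
    and "balanced PSL2 \<Omega> \<rho>"
    and "type_I PSL2 \<Omega>"
  shows "(2 * n dvd p - 1 \<or> 2 * n dvd p + 1) \<and>
    (2 * n dvd p - 1 \<longrightarrow>
      (\<exists>a\<^sub>0 u\<^sub>0.
        {(a, u). a \<notin> {1, - 1, 0} \<and> coprime u (2 * n) \<and> 1 \<le> u \<and> u < n \<and>
          (n = 2 \<longrightarrow> 2 * a\<^sup>2 \<noteq> 1) \<and>
          CM_data (alpha_pgl e [^]\<^bsub>PGL2\<^esub> ((p - 1) * u div (2 * n))) (omega_i a) \<and>
          cayley_map PSL2 \<Omega> \<rho> \<cong>\<^sub>m
            CM (alpha_pgl e [^]\<^bsub>PGL2\<^esub> ((p - 1) * u div (2 * n))) (omega_i a)}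
        = {(a\<^sub>0, u\<^sub>0), (- a\<^sub>0, u\<^sub>0)})) \<and>
    (2 * n dvd p + 1 \<longrightarrow>
      (\<exists>a\<^sub>0 v\<^sub>0.
        {(a, v). a \<notin> {1, - 1, 0} \<and> coprime v (2 * n) \<and> 1 \<le> v \<and> v < n \<and>
          CM_data (gamma_pgl e w [^]\<^bsub>PGL2\<^esub> ((p + 1) * v div (2 * n))) (omega_tilde_i e x z a) \<and>
          cayley_map PSL2 \<Omega> \<rho> \<cong>\<^sub>m
            CM (gamma_pgl e w [^]\<^bsub>PGL2\<^esub> ((p + 1) * v div (2 * n))) (omega_tilde_i e x z a)}
        = {(a\<^sub>0, v\<^sub>0), (- a\<^sub>0, v\<^sub>0)}))"
proof -
  interpret quadratic_extension p e w1 w2 \<iota> sqrt_e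
    using assms(1-8) by unfold_locales
  have xz: "(x a - a)\<^sup>2 - e * (z a)\<^sup>2 = a\<^sup>2 - 1" for a using assms(10) by blast
  note data = assms(11) and card = assms(12) and reg = assms(13) and bal = assms(14) and type = assms(15)
  note half = m_inv_eq_half_rotation[OF data card bal type]
  have n: "2 \<le> n" by (rule half_valency_ge_2[OF data card half])
  obtain \<sigma> where \<sigma>: "\<sigma> \<in> carrier PGL2" "PGL2.ord \<sigma> = 2 * n"
    and \<rho>: "\<And>\<omega>. \<omega> \<in> \<Omega> \<Longrightarrow> \<rho> \<omega> = conj_action \<sigma> \<omega>"
    using regular_balanced_obtain_conj[OF data card reg half] by metis
  obtain B where B: "\<sigma> = pgl B" "det B \<noteq> 0" using \<sigma>(1) by (rule pgl_cases)
  \<comment> \<open>The two numbers differ by 2 while 2n is at least 4, so in each case below the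
    implication for the other torus is vacuous.\<close>
  have not_both: "\<not> (2 * n dvd p - 1 \<and> 2 * n dvd p + 1)"
  proof
    assume "2 * n dvd p - 1 \<and> 2 * n dvd p + 1"
    then have "2 * n dvd (p + 1) - (p - 1)" by (metis dvd_diff_nat)
    then have "2 * n dvd 2" using p by simp
    then show False using n by (auto dest: dvd_imp_le)
  qed
  from B(2) consider
    (split) c k where "c \<in> carrier PGL2" "c \<otimes>\<^bsub>PGL2\<^esub> \<sigma> \<otimes>\<^bsub>PGL2\<^esub> inv\<^bsub>PGL2\<^esub> c = \<alpha> [^]\<^bsub>PGL2\<^esub> (k::nat)" "2 * n dvd p - 1"
  | (nonsplit) c k where "c \<in> carrier PGL2" "c \<otimes>\<^bsub>PGL2\<^esub> \<sigma> \<otimes>\<^bsub>PGL2\<^esub> inv\<^bsub>PGL2\<^esub> c = \<gamma> [^]\<^bsub>PGL2\<^esub> (k::nat)" "2 * n dvd p + 1"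
  proof (cases rule: conj_cases)
    case 1
    \<comment> \<open>A double root would make the even order 2n divide the odd prime p.\<close>
    then have "2 * n dvd p" using double_root_pow_p[OF B(2)] PGL2.pow_eq_id[OF \<sigma>(1)] \<sigma>(2) B(1) by simp
    then show ?thesis using odd_p by (meson dvd_mult_left)
  next
    case (2 c k)
    then have "2 * n dvd p - 1"
      using PGL2.ord_conj[OF 2(1) \<sigma>(1)] \<sigma>(2) ord_\<alpha>_pow_dvd[of k] B(1) by simp
    then show ?thesis using that(1) 2 B(1) by blast
  next
    case (3 c k)
    then have "2 * n dvd p + 1"
      using PGL2.ord_conj[OF 3(1) \<sigma>(1)] \<sigma>(2) ord_\<gamma>_pow_dvd[of k] B(1) by simp
    then show ?thesis using that(2) 3 B(1) by blast
  qed
  then show ?thesis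
  proof cases
    case split
    then obtain m where m: "p - 1 = 2 * n * m" by (elim dvdE)
    have exponent: "(p - 1) * u div (2 * n) = m * u" for u using m n by simp
    have half_p: "n * m = (p - 1) div 2" using m by simp
    have ord: "PGL2.ord \<alpha> = 2 * n * m" using ord_\<alpha> m by simp
    have "0 < m" using m p by (intro Nat.gr0I) auto
    have inverter: "pgl (matrix2 0 1 1 0) \<in> carrier (PGL2 :: ('k^2^2) set monoid)" by simp
    \<comment> \<open>For \<open>n = 2\<close> the exponent is an odd multiple of (p - 1)/2, where
      \<open>e\<close> takes the value -1.\<close>
    have order_4: "e ^ (2 * (m * u)) = - 1" if "coprime u (2 * n)" "n = 2" for u
    proof -
      have "odd u" using that(1) by simp
      have "2 * (m * u) = (p - 1) div 2 * u" using half_p that(2) by (simp add: mult_ac)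
      then show ?thesis using \<open>odd u\<close> by (simp only: power_mult e_half) simp
    qed
    have "\<exists>a0 u0. {(a, u). (a \<notin> {1, - 1, 0} \<and> (n = 2 \<longrightarrow> 2 * a\<^sup>2 \<noteq> 1)) \<and> coprime u (2 * n) \<and> 1 \<le> u \<and> u < n \<and>
        CM_data (\<alpha> [^]\<^bsub>PGL2\<^esub> (m * u)) (omega_i a) \<and> cayley_map PSL2 \<Omega> \<rho> \<cong>\<^sub>m CM (\<alpha> [^]\<^bsub>PGL2\<^esub> (m * u)) (omega_i a)}
      = {(a0, u0), (- a0, u0)}"
    proof (rule classification[OF data type \<sigma> \<rho> half n \<alpha>_closed ord \<open>0 < m\<close> inverter \<alpha>_inverter split(1,2) \<alpha>_pow_conj])
      show "(trace A / 2 \<notin> {1, - 1, 0} \<and> (n = 2 \<longrightarrow> 2 * (trace A / 2)\<^sup>2 \<noteq> 1)) \<and>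
        (\<exists>c \<in> carrier PGL2. c \<otimes>\<^bsub>PGL2\<^esub> \<alpha> = \<alpha> \<otimes>\<^bsub>PGL2\<^esub> c \<and> conj_action c (psl A) = omega_i (trace A / 2))"
        if "coprime u (2 * n)" "det A = 1" "CM_data (\<alpha> [^]\<^bsub>PGL2\<^esub> (m * u)) (psl A)"
          "conj_action (\<alpha> [^]\<^bsub>PGL2\<^esub> (n * m)) (psl A) = inv\<^bsub>PSL2\<^esub> (psl A)" "psl A \<otimes>\<^bsub>PSL2\<^esub> psl A \<noteq> \<one>\<^bsub>PSL2\<^esub>" for u A
        using split_normal_form[OF that(2,3) that(4)[unfolded half_p] order_4[OF that(1)] that(5)] .
      show "\<exists>A. det A = 1 \<and> trace A = 2 * a \<and> omega_i a = psl A" for a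
        unfolding omega_i_def by (rule exI[of _ "matrix2 a 1 (a\<^sup>2 - 1) a"]) (simp add: power2_eq_square)
      show "conj_action (\<alpha> [^]\<^bsub>PGL2\<^esub> (n * m)) (omega_i a) = inv\<^bsub>PSL2\<^esub> (omega_i a)" for a
        unfolding half_p by (rule omega_i_inverted)
    qed
    then show ?thesis
      using split(3) not_both unfolding exponent \<alpha>_def by (simp only: conj_ac simp_thms) 
  next
    case nonsplit
    then obtain m where m: "p + 1 = 2 * n * m" by (elim dvdE)
    have exponent: "(p + 1) * u div (2 * n) = m * u" for u unfolding m using n by simp
    have half_p: "n * m = (p + 1) div 2" unfolding m by simp
    have ord: "PGL2.ord \<gamma> = 2 * n * m" using ord_\<gamma> m by simp
    have "0 < m" using m by (intro Nat.gr0I) auto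
    have inverter: "pgl (matrix2 1 0 0 (- 1)) \<in> carrier (PGL2 :: ('k^2^2) set monoid)" by simp
    have "\<exists>a0 u0. {(a, u). a \<notin> {1, - 1, 0} \<and> coprime u (2 * n) \<and> 1 \<le> u \<and> u < n \<and>
        CM_data (\<gamma> [^]\<^bsub>PGL2\<^esub> (m * u)) (omega_tilde_i e x z a) \<and> cayley_map PSL2 \<Omega> \<rho> \<cong>\<^sub>m CM (\<gamma> [^]\<^bsub>PGL2\<^esub> (m * u)) (omega_tilde_i e x z a)}
      = {(a0, u0), (- a0, u0)}"
    proof (rule classification[OF data type \<sigma> \<rho> half n \<gamma>_closed ord \<open>0 < m\<close> inverter \<gamma>_inverter nonsplit(1,2) \<gamma>_pow_conj])
      show "trace A / 2 \<notin> {1, - 1, 0} \<and>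
        (\<exists>c \<in> carrier PGL2. c \<otimes>\<^bsub>PGL2\<^esub> \<gamma> = \<gamma> \<otimes>\<^bsub>PGL2\<^esub> c \<and> conj_action c (psl A) = omega_tilde_i e x z (trace A / 2))"
        if "det A = 1"
          "conj_action (\<gamma> [^]\<^bsub>PGL2\<^esub> (n * m)) (psl A) = inv\<^bsub>PSL2\<^esub> (psl A)" "psl A \<otimes>\<^bsub>PSL2\<^esub> psl A \<noteq> \<one>\<^bsub>PSL2\<^esub>" for A
        using nonsplit_normal_form[OF that(1) xz that(2)[unfolded half_p] that(3)] .
      show "\<exists>A. det A = 1 \<and> trace A = 2 * a \<and> omega_tilde_i e x z a = psl A" for a
        unfolding omega_tilde_i_def
        by (rule exI[of _ "matrix2 (x a) (- e * z a) (z a) (2 * a - x a)"])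
          (simp only: det_matrix2 trace_matrix2 omega_tilde_i_inverted(1)[OF xz], simp)
      show "conj_action (\<gamma> [^]\<^bsub>PGL2\<^esub> (n * m)) (omega_tilde_i e x z a) = inv\<^bsub>PSL2\<^esub> (omega_tilde_i e x z a)" for a
        unfolding half_p by (rule omega_tilde_i_inverted(2)[OF xz])
    qed
    then show ?thesis
      using nonsplit(3) not_both unfolding exponent assms(9) gamma_pgl_eq by simp
  qed
qed

end
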